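(* Let $s\in(0,1)$ and let $\Omega_a,\Omega_b\subset\mathbb{R}^N$ be bounded open sets contained in an open ball $D$ of $\mathbb{R}^N$. Assume that $\Omega_a$ satisfies the $(\rho,\theta)$-Lipschitz cone condition for some $\rho>0$, $\theta\in(0,\pi/2)$. Let $f\in L^2(\mathbb{R}^N)$ and let $u_a\in\mathcal{X}^s_0(\Omega_a)$ and $u_b\in\mathcal{X}^s_0(\Omega_b)$ be the weak solutions of $(-\Delta)^su=f$ in $\Omega$, $u=0$ in $\mathbb{R}^N\setminus\Omega$, with $\Omega=\Omega_a$ and $\Omega=\Omega_b$, respectively. Then there is a positive constant $C$, depending only on $N$, $s$, $\rho$, $\theta$ and $\mathrm{diam}\,D$, such that, if $$\mathfrak{d}(\Omega_b,\Omega_a)<\frac{\rho\sin\theta}{2},$$ then $$\|u_a-u_b\|_s\le C\,\|f\|^{1/2}_{L^2(\mathbb{R}^N)}\|f\|^{1/2}_{H^{-s}(\mathbb{R}^N)}\,\mathfrak{d}(\Omega_b,\Omega_a)^{s/2}.$$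
   Context: Gagliardo seminorm: $\|v\|_s^2:=\iint_{\mathbb{R}^{2N}}\frac{|v(x)-v(y)|^2}{|x-y|^{N+2s}}\,dx\,dy$. For an open set $\Omega\subseteq\mathbb{R}^N$, $\mathcal{X}^s_0(\Omega):=\{v\in H^s(\mathbb{R}^N): v=0\text{ a.e. in }\mathbb{R}^N\setminus\Omega\}$. $H^{-s}(\mathbb{R}^N)$ is the dual of $H^s(\mathbb{R}^N)$ (normed by $(\|v\|^2_{L^2}+\|v\|_s^2)^{1/2}$); $f\in L^2(\mathbb{R}^N)$ is viewed as the functional $\langle f,\varphi\rangle=\int_{\mathbb{R}^N} f\varphi\,dx$. $(-\Delta)^{s/2}$ is the Fourier multiplier with symbol $|\xi|^s$. Weak solution of $(-\Delta)^su=f$ in $\Omega$, $u=0$ in $\mathbb{R}^N\setminus\Omega$: $u\in\mathcal{X}^s_0(\Omega)$ with $\int_{\mathbb{R}^N}(-\Delta)^{s/2}u\,(-\Delta)^{s/2}\varphi\,dx=\langle f,\varphi\rangle$ for all $\varphi\in\mathcal{X}^s_0(\Omega)$ (it exists and is unique for bounded $\Omega$). Set distance: for $E,F\subseteq\mathbb{R}^N$, $e(E,F):=\sup_{x\in E}d(x,F)$, $e^c(F,E):=e(\mathbb{R}^N\setminus E,\mathbb{R}^N\setminus F)=\sup_{x\in F\setminus E}d(x,\mathbb{R}^N\setminus F)$, and $\mathfrak{d}(E,F):=e(E,F)+e^c(F,E)$ (not symmetric in general). Lipschitz cone condition: for a unit vector $\mathbf n$, $\rho>0$ and $\theta\in(0,\pi/2)$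 let $\mathcal{C}_{\rho,\theta}(\mathbf n):=\{\mathbf v\in\mathbb{R}^N:0<|\mathbf v|<\rho,\ \mathbf v\cdot\mathbf n>|\mathbf v|\cos\theta\}$. For an open set $\Omega$ and $x_0\in\mathbb{R}^N$ let $\mathcal{N}_{\rho,\theta}(x_0,\Omega)$ be the set of unit vectors $\mathbf n$ such that for every $\mathbf v\in\mathcal{C}_{\rho,\theta}(\mathbf n)$: (i) $y-\mathbf v\in\Omega$ for every $y\in B_{3\rho}(x_0)\cap\Omega$; (ii) $y+\mathbf v\in\mathbb{R}^N\setminus\Omega$ for every $y\in B_{3\rho}(x_0)\setminus\Omega$. $\Omega$ satisfies the (uniform) $(\rho,\theta)$-Lipschitz cone condition if $\mathcal{N}_{\rho,\theta}(x_0,\Omega)\ne\emptyset$ for all $x_0\in\mathbb{R}^N$. *)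

theory Defs
  imports "HOL-Analysis.Analysis"
begin

section \<open>Square integrable functions and fractional Sobolev spaces\<close>

text \<open>Elements of function spaces are represented by Borel functions; every Lebesgue class has a
  Borel representative, and all notions below are invariant under changes on null sets.
  Throughout, \<open>'a\<close> plays the role of the Euclidean space of dimension \<open>DIM('a)\<close>.\<close>

definition square_integrable :: "('a::euclidean_space \<Rightarrow> 'b::euclidean_space) \<Rightarrow> bool" where
  "square_integrable f \<longleftrightarrow>
     f \<in> borel_measurable borel \<and> integrable lborel (\<lambda>x. (norm (f x))\<^sup>2)"

definition l2_norm :: "('a::euclidean_space \<Rightarrow> 'b::euclidean_space) \<Rightarrow> real" where
  "l2_norm f = sqrt (LINT x|lborel. (norm (f x))\<^sup>2)"

text \<open>On the diagonal the integrand is \<open>0 / 0 = 0\<close>; the diagonal is a null set.\<close>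

definition gagliardo_integrand :: "real \<Rightarrow> ('a::euclidean_space \<Rightarrow> real) \<Rightarrow> 'a \<times> 'a \<Rightarrow> real" where
  "gagliardo_integrand s v = (\<lambda>(x, y). \<bar>v x - v y\<bar>\<^sup>2 / norm (x - y) powr (real DIM('a) + 2 * s))"

definition gagliardo_seminorm :: "real \<Rightarrow> ('a::euclidean_space \<Rightarrow> real) \<Rightarrow> real" where
  "gagliardo_seminorm s v = sqrt (LINT z|(lborel \<Otimes>\<^sub>M lborel). gagliardo_integrand s v z)"

definition sobolev :: "real \<Rightarrow> ('a::euclidean_space \<Rightarrow> real) set" where
  "sobolev s = {v. square_integrable v \<and> integrable (lborel \<Otimes>\<^sub>M lborel) (gagliardo_integrand s v)}"

definition sobolev_norm :: "real \<Rightarrow> ('a::euclidean_space \<Rightarrow> real) \<Rightarrow> real" where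
  "sobolev_norm s v = sqrt ((l2_norm v)\<^sup>2 + (gagliardo_seminorm s v)\<^sup>2)"

definition sobolev_zero :: "real \<Rightarrow> 'a::euclidean_space set \<Rightarrow> ('a \<Rightarrow> real) set" where
  "sobolev_zero s \<Omega> = {v \<in> sobolev s. AE x in lborel. x \<notin> \<Omega> \<longrightarrow> v x = 0}"

text \<open>The dual norm of the functional on \<open>sobolev s\<close> induced by a square integrable \<open>f\<close>. The set is
  bounded above by \<open>l2_norm f\<close>, so the supremum is the genuine one.\<close>

definition dual_pairing :: "('a::euclidean_space \<Rightarrow> real) \<Rightarrow> ('a \<Rightarrow> real) \<Rightarrow> real" where
  "dual_pairing f \<phi> = (LINT x|lborel. f x * \<phi> x)"

definition dual_sobolev_norm :: "real \<Rightarrow> ('a::euclidean_space \<Rightarrow> real) \<Rightarrow> real" where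
  "dual_sobolev_norm s f = (SUP \<phi>\<in>{\<phi> \<in> sobolev s. sobolev_norm s \<phi> \<le> 1}. \<bar>dual_pairing f \<phi>\<bar>)"

section \<open>Fourier multipliers and the fractional Laplacian\<close>

definition fourier_truncated :: "real \<Rightarrow> ('a::euclidean_space \<Rightarrow> complex) \<Rightarrow> 'a \<Rightarrow> complex" where
  "fourier_truncated R u \<xi> =
     complex_of_real ((2 * pi) powr (- real DIM('a) / 2)) *
     (LINT x:ball 0 R|lborel. exp (- \<i> * complex_of_real (\<xi> \<bullet> x)) * u x)"

text \<open>\<open>g\<close> is the Fourier transform of the square integrable function \<open>u\<close>: the mean square limit
  of the transforms of the truncations of \<open>u\<close> to balls. It determines \<open>g\<close> up to null sets.\<close>

definition is_fourier_transform ::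
    "('a::euclidean_space \<Rightarrow> complex) \<Rightarrow> ('a \<Rightarrow> complex) \<Rightarrow> bool" where
  "is_fourier_transform u g \<longleftrightarrow>
     square_integrable u \<and> square_integrable g \<and>
     ((\<lambda>R. \<integral>\<^sup>+ \<xi>. ennreal ((cmod (fourier_truncated R u \<xi> - g \<xi>))\<^sup>2) \<partial>lborel) \<longlongrightarrow> 0) at_top"

text \<open>The choice is only among almost everywhere equal functions, as the Fourier transform is
  injective on square integrable functions modulo null sets.\<close>

definition fourier_multiplier ::
    "('a::euclidean_space \<Rightarrow> complex) \<Rightarrow> ('a \<Rightarrow> complex) \<Rightarrow> 'a \<Rightarrow> complex" where
  "fourier_multiplier m u =
     (SOME w. \<exists>u' w'. is_fourier_transform u u' \<and> is_fourier_transform w w' \<and>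
                      (AE \<xi> in lborel. w' \<xi> = m \<xi> * u' \<xi>))"

text \<open>The operator \<open>(-\<Delta>)\<close> to the power \<open>s / 2\<close>.\<close>

definition half_frac_laplacian :: "real \<Rightarrow> ('a::euclidean_space \<Rightarrow> real) \<Rightarrow> 'a \<Rightarrow> complex" where
  "half_frac_laplacian s u =
     fourier_multiplier (\<lambda>\<xi>. complex_of_real (norm \<xi> powr s)) (\<lambda>x. complex_of_real (u x))"

text \<open>For real \<open>u\<close> and \<open>\<phi>\<close> both factors below are real almost everywhere, so no conjugate
  is needed.\<close>

definition weak_solution ::
    "real \<Rightarrow> 'a::euclidean_space set \<Rightarrow> ('a \<Rightarrow> real) \<Rightarrow> ('a \<Rightarrow> real) \<Rightarrow> bool" where
  "weak_solution s \<Omega> f u \<longleftrightarrow>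
     u \<in> sobolev_zero s \<Omega> \<and>
     (\<forall>\<phi>\<in>sobolev_zero s \<Omega>.
        (LINT x|lborel. half_frac_laplacian s u x * half_frac_laplacian s \<phi> x)
          = complex_of_real (dual_pairing f \<phi>))"

section \<open>Set distances\<close>

text \<open>Extended nonnegative values give the usual conventions for empty sets: the distance of a point
  to the empty set is infinite (whereas \<open>infdist x {} = 0\<close>), and the supremum over the empty set
  is \<open>0\<close>.\<close>

definition point_set_dist :: "'a::metric_space \<Rightarrow> 'a set \<Rightarrow> ennreal" where
  "point_set_dist x F = (INF y\<in>F. ennreal (dist x y))"

definition excess :: "'a::metric_space set \<Rightarrow> 'a set \<Rightarrow> ennreal" where
  "excess E F = (SUP x\<in>E. point_set_dist x F)"

definition complementary_excess :: "'a::metric_space set \<Rightarrow> 'a set \<Rightarrow> ennreal" where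
  "complementary_excess F E = excess (- E) (- F)"

definition set_deviation :: "'a::metric_space set \<Rightarrow> 'a set \<Rightarrow> ennreal" where
  "set_deviation E F = excess E F + complementary_excess F E"

section \<open>Lipschitz cone condition\<close>

definition open_cone :: "real \<Rightarrow> real \<Rightarrow> 'a::euclidean_space \<Rightarrow> 'a set" where
  "open_cone \<rho> \<theta> n = {v. 0 < norm v \<and> norm v < \<rho> \<and> v \<bullet> n > norm v * cos \<theta>}"

definition cone_directions :: "real \<Rightarrow> real \<Rightarrow> 'a::euclidean_space \<Rightarrow> 'a set \<Rightarrow> 'a set" where
  "cone_directions \<rho> \<theta> x0 \<Omega> =
     {n. norm n = 1 \<and>
         (\<forall>v\<in>open_cone \<rho> \<theta> n.
            (\<forall>y\<in>ball x0 (3 * \<rho>) \<inter> \<Omega>. y - v \<in> \<Omega>) \<and>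
            (\<forall>y\<in>ball x0 (3 * \<rho>) - \<Omega>. y + v \<in> - \<Omega>))}"

definition lipschitz_cone_condition :: "real \<Rightarrow> real \<Rightarrow> 'a::euclidean_space set \<Rightarrow> bool" where
  "lipschitz_cone_condition \<rho> \<theta> \<Omega> \<longleftrightarrow> (\<forall>x0. cone_directions \<rho> \<theta> x0 \<Omega> \<noteq> {})"

end

theory Submission
  imports Defs "HOL-Probability.Characteristic_Functions"
begin

text \<open>The solution on an open set \<open>\<Omega>\<close> minimises the convex functional
  \<open>J v = E v / (2 \<kappa>) - \<langle>f, v\<rangle>\<close> over the functions that vanish outside \<open>\<Omega>\<close>, where \<open>E\<close> is the
  square of the Gagliardo seminorm and \<open>E / \<kappa>\<close> is the quadratic form of the fractional Laplacian.
  Let \<open>m\<close> be the mean of the two solutions. By the parallelogram law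
  \<open>J m = (J u\<^sub>a + J u\<^sub>b) / 2 - E (u\<^sub>a - u\<^sub>b) / (8 \<kappa>)\<close>, so any competitor \<open>v\<close> that is admissible on
  both domains at once gives \<open>E (u\<^sub>a - u\<^sub>b) \<le> 8 \<kappa> (J v - J m)\<close> (lemma \<open>energy_gap\<close>).

  The competitor is obtained by pushing \<open>m\<close> inwards. Near a point where \<open>n\<close> is a cone direction of
  \<open>\<Omega>\<^sub>a\<close>, a translation by \<open>t n\<close> carries the complement of \<open>\<Omega>\<^sub>a \<inter> \<Omega>\<^sub>b\<close> into the complement of
  \<open>\<Omega>\<^sub>a \<union> \<Omega>\<^sub>b\<close> as soon as \<open>t sin \<theta>\<close> exceeds the deviation of the two sets (lemma
  \<open>cone_translation_leaves_union\<close>): the ball of radius \<open>t sin \<theta>\<close> about the axis point \<open>t n\<close> lies in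
  the cone, and one excess is spent at each end of the translation vector. These local translations
  are glued by a Lipschitz partition of unity whose size depends only on \<open>\<rho>\<close>, the diameter of \<open>D\<close>
  and the dimension. Convexity of the square shows that the glued function \<open>v\<close> satisfies
  \<open>E v \<le> (1 + C t\<^sup>s) E m\<close>, and translations move \<open>m\<close> by at most \<open>C t\<^sup>s \<parallel>m\<parallel>\<^sub>s\<close> in mean square; hence
  \<open>J v - J m\<close> is at most \<open>C t\<^sup>s \<parallel>m\<parallel>\<^sub>s (\<parallel>m\<parallel>\<^sub>s + \<parallel>f\<parallel>)\<close>. The seminorm of \<open>m\<close> is bounded by the dual norm
  of \<open>f\<close> through the Poincare inequality, and letting \<open>t\<close> decrease to its least admissible value
  gives the theorem.

  Weak solutions are defined through a Fourier multiplier. Relating it to the Gagliardo seminorm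
  takes the Plancherel theorem, the inversion formula and the identity
  \<open>E u = \<kappa> \<integral> |\<xi>|\<^bsup>2s\<^esup> |F u|\<^sup>2\<close> (\<open>gagliardo_energy_fourier\<close>), which also yields the translation estimate
  and the Poincare inequality.\<close>

section \<open>Square integrable functions\<close>

lemma square_integrable_measurable:
  "square_integrable f \<Longrightarrow> f \<in> borel_measurable borel"
  by (simp add: square_integrable_def)

lemma square_integrable_integrable:
  "square_integrable f \<Longrightarrow> integrable lborel (\<lambda>x. (norm (f x))\<^sup>2)"
  by (simp add: square_integrable_def)

lemma square_integrableI:
  assumes [measurable]: "f \<in> borel_measurable borel"
    and "(\<integral>\<^sup>+ x. ennreal ((norm (f x))\<^sup>2) \<partial>lborel) < \<infinity>"
  shows "square_integrable f"
  using assms unfolding square_integrable_def by (auto intro!: integrableI_bounded)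

lemma l2_norm_nonneg [simp]: "0 \<le> l2_norm f"
  by (simp add: l2_norm_def)

lemma l2_norm_power2: "(l2_norm f)\<^sup>2 = (LINT x|lborel. (norm (f x))\<^sup>2)"
  by (simp add: l2_norm_def)

lemma nn_integral_l2_norm:
  assumes "square_integrable f"
  shows "(\<integral>\<^sup>+ x. ennreal ((norm (f x))\<^sup>2) \<partial>lborel) = ennreal ((l2_norm f)\<^sup>2)"
  using assms unfolding l2_norm_power2 by (intro nn_integral_eq_integral) (auto simp: square_integrable_def)

text \<open>A single domination principle gives closure under scaling, conjugation, restriction and
  modification on null sets, together with the corresponding norm bounds.\<close>

lemma square_integrable_dominated:
  fixes f :: "'a::euclidean_space \<Rightarrow> 'b::euclidean_space" and g :: "'a \<Rightarrow> 'c::euclidean_space"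
  assumes f: "square_integrable f" and [measurable]: "g \<in> borel_measurable borel"
    and K: "0 \<le> K" and le: "AE x in lborel. norm (g x) \<le> K * norm (f x)"
  shows "square_integrable g" "l2_norm g \<le> K * l2_norm f"
proof -
  have le2: "AE x in lborel. (norm (g x))\<^sup>2 \<le> K\<^sup>2 * (norm (f x))\<^sup>2"
    using le by eventually_elim (metis norm_ge_zero power_mono power_mult_distrib)
  have i: "integrable lborel (\<lambda>x. K\<^sup>2 * (norm (f x))\<^sup>2)"
    using f by (simp add: square_integrable_def)
  have ig: "integrable lborel (\<lambda>x. (norm (g x))\<^sup>2)"
  proof (rule Bochner_Integration.integrable_bound[OF i])
    show "AE x in lborel. norm ((norm (g x))\<^sup>2) \<le> norm (K\<^sup>2 * (norm (f x))\<^sup>2)"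
      using le2 by eventually_elim simp
  qed simp
  then show "square_integrable g"
    by (simp add: square_integrable_def)
  have "(LINT x|lborel. (norm (g x))\<^sup>2) \<le> (LINT x|lborel. K\<^sup>2 * (norm (f x))\<^sup>2)"
    by (rule integral_mono_AE[OF ig i le2])
  then have "(l2_norm g)\<^sup>2 \<le> (K * l2_norm f)\<^sup>2"
    by (simp add: l2_norm_power2 power_mult_distrib)
  then show "l2_norm g \<le> K * l2_norm f"
    by (rule power2_le_imp_le) (simp add: K)
qed

lemma l2_norm_cong_AE:
  fixes f :: "'a::euclidean_space \<Rightarrow> 'b::euclidean_space" and g :: "'a \<Rightarrow> 'c::euclidean_space"
  assumes [measurable]: "f \<in> borel_measurable borel" "g \<in> borel_measurable borel"
    and "AE x in lborel. norm (f x) = norm (g x)"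
  shows "l2_norm f = l2_norm g"
proof -
  have "AE x in lborel. (norm (f x))\<^sup>2 = (norm (g x))\<^sup>2"
    using assms(3) by eventually_elim simp
  then have "(LINT x|lborel. (norm (f x))\<^sup>2) = (LINT x|lborel. (norm (g x))\<^sup>2)"
    by (intro integral_cong_AE) auto
  then show ?thesis by (simp add: l2_norm_def)
qed

lemma l2_norm_cong: "(\<And>x. norm (f x) = norm (g x)) \<Longrightarrow> l2_norm f = l2_norm g"
  by (simp add: l2_norm_def)

lemma square_integrable_cong: 
  fixes f :: "'a::euclidean_space \<Rightarrow> 'b::euclidean_space" and g :: "'a \<Rightarrow> 'c::euclidean_space"
  assumes "square_integrable f" "g \<in> borel_measurable borel" "\<And>x. norm (f x) = norm (g x)"
  shows "square_integrable g"
  using square_integrable_dominated(1)[OF assms(1,2), of 1] assms(3) by simp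

lemma square_integrable_mult_integrable:
  assumes f: "square_integrable f" and g: "square_integrable g"
  shows "integrable lborel (\<lambda>x. norm (f x) * norm (g x))"
proof (rule Bochner_Integration.integrable_bound)
  show "integrable lborel (\<lambda>x. (norm (f x))\<^sup>2 + (norm (g x))\<^sup>2)"
    using f g by (intro Bochner_Integration.integrable_add square_integrable_integrable)
  show "(\<lambda>x. norm (f x) * norm (g x)) \<in> borel_measurable lborel"
    using square_integrable_measurable[OF f] square_integrable_measurable[OF g] by measurable
  have "norm (f x) * norm (g x) \<le> (norm (f x))\<^sup>2 + (norm (g x))\<^sup>2" for x
  proof -
    have "0 \<le> (norm (f x) - norm (g x))\<^sup>2" by simp
    moreover have "0 \<le> norm (f x) * norm (g x)" by simp
    ultimately show ?thesis unfolding power2_diff by linarith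
  qed
  then show "AE x in lborel. norm (norm (f x) * norm (g x)) \<le> norm ((norm (f x))\<^sup>2 + (norm (g x))\<^sup>2)"
    by auto
qed

lemma quadratic_nonneg_imp_discriminant:
  fixes A B C :: real
  assumes nn: "\<And>t. 0 \<le> A - 2 * t * C + t\<^sup>2 * B" and "0 \<le> B"
  shows "C\<^sup>2 \<le> A * B"
proof (cases "B = 0")
  case True
  have "C = 0"
  proof (rule ccontr)
    assume "C \<noteq> 0"
    then show False
      using nn[of "(A + 1) / (2 * C)"] True by simp
  qed
  then show ?thesis using True by simp
next
  case False
  then have "0 < B" using assms by simp
  have "0 \<le> A - C\<^sup>2 / B"
    using nn[of "C / B"] False by (simp add: power2_eq_square)
  then show ?thesis
    using \<open>0 < B\<close> by (simp add: field_simps)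
qed

text \<open>The quadratic polynomial \<open>t \<mapsto> \<parallel>|f| - t |g|\<parallel>\<^sup>2\<close> is nonnegative, so its discriminant is not positive.\<close>

lemma l2_norm_Cauchy_Schwarz:
  assumes f: "square_integrable f" and g: "square_integrable g"
  shows "(LINT x|lborel. norm (f x) * norm (g x)) \<le> l2_norm f * l2_norm g"
proof -
  let ?A = "LINT x|lborel. (norm (f x))\<^sup>2" and ?B = "LINT x|lborel. (norm (g x))\<^sup>2"
  let ?C = "LINT x|lborel. norm (f x) * norm (g x)"
  note i = square_integrable_integrable[OF f] square_integrable_integrable[OF g]
    square_integrable_mult_integrable[OF f g]
  have "0 \<le> ?A - 2 * t * ?C + t\<^sup>2 * ?B" for t
  proof -
    have "0 \<le> (LINT x|lborel. (norm (f x) - t * norm (g x))\<^sup>2)" by simp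
    also have "\<dots> = (LINT x|lborel. (norm (f x))\<^sup>2 - (2 * t) * (norm (f x) * norm (g x)) + t\<^sup>2 * (norm (g x))\<^sup>2)"
      by (simp add: power2_eq_square algebra_simps)
    also have "\<dots> = ?A - 2 * t * ?C + t\<^sup>2 * ?B"
      using i by (subst Bochner_Integration.integral_add) (auto simp: Bochner_Integration.integral_diff)
    finally show ?thesis .
  qed
  then have "?C\<^sup>2 \<le> ?A * ?B"
    by (rule quadratic_nonneg_imp_discriminant) simp
  then have "?C\<^sup>2 \<le> (l2_norm f * l2_norm g)\<^sup>2"
    by (simp add: power_mult_distrib l2_norm_power2)
  then show ?thesis
    by (rule power2_le_imp_le) simp
qed

lemma l2_pairing:
  fixes f g :: "'a::euclidean_space \<Rightarrow> 'b::{euclidean_space, real_normed_field}"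
  assumes f: "square_integrable f" and g: "square_integrable g"
  shows "integrable lborel (\<lambda>x. f x * g x)"
    and "norm (LINT x|lborel. f x * g x) \<le> l2_norm f * l2_norm g"
proof -
  have [measurable]: "f \<in> borel_measurable borel" "g \<in> borel_measurable borel"
    using f g by (auto simp: square_integrable_def)
  show "integrable lborel (\<lambda>x. f x * g x)"
    by (rule Bochner_Integration.integrable_bound[OF square_integrable_mult_integrable[OF f g]])
      (auto simp: norm_mult)
  have "norm (LINT x|lborel. f x * g x) \<le> (LINT x|lborel. norm (f x * g x))"
    by (rule integral_norm_bound)
  also have "\<dots> \<le> l2_norm f * l2_norm g"
    using l2_norm_Cauchy_Schwarz[OF f g] by (simp add: norm_mult)
  finally show "norm (LINT x|lborel. f x * g x) \<le> l2_norm f * l2_norm g" .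
qed

lemma square_integrable_add:
  fixes f g :: "'a::euclidean_space \<Rightarrow> 'b::euclidean_space"
  assumes f: "square_integrable f" and g: "square_integrable g"
  shows "square_integrable (\<lambda>x. f x + g x)" "l2_norm (\<lambda>x. f x + g x) \<le> l2_norm f + l2_norm g"
proof -
  have [measurable]: "f \<in> borel_measurable borel" "g \<in> borel_measurable borel"
    using f g by (auto simp: square_integrable_def)
  note i = square_integrable_integrable[OF f] square_integrable_integrable[OF g]
    square_integrable_mult_integrable[OF f g]
  let ?h = "\<lambda>x. (norm (f x))\<^sup>2 + 2 * (norm (f x) * norm (g x)) + (norm (g x))\<^sup>2"
  have ih: "integrable lborel ?h"
    using i by (auto intro!: Bochner_Integration.integrable_add)
  have le: "(norm (f x + g x))\<^sup>2 \<le> ?h x" for x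
  proof -
    have "(norm (f x + g x))\<^sup>2 \<le> (norm (f x) + norm (g x))\<^sup>2"
      by (intro power_mono norm_triangle_ineq) auto
    then show ?thesis by (simp add: power2_sum)
  qed
  have is': "integrable lborel (\<lambda>x. (norm (f x + g x))\<^sup>2)"
    by (rule Bochner_Integration.integrable_bound[OF ih])
      (auto intro!: AE_I2 order_trans[OF le])
  then show "square_integrable (\<lambda>x. f x + g x)"
    by (simp add: square_integrable_def)
  have "(l2_norm (\<lambda>x. f x + g x))\<^sup>2 \<le> (LINT x|lborel. ?h x)"
    unfolding l2_norm_power2 by (intro integral_mono is' ih le)
  also have "\<dots> = (l2_norm f)\<^sup>2 + 2 * (LINT x|lborel. norm (f x) * norm (g x)) + (l2_norm g)\<^sup>2"
    using i by (simp add: l2_norm_power2)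
  also have "\<dots> \<le> (l2_norm f + l2_norm g)\<^sup>2"
    using l2_norm_Cauchy_Schwarz[OF f g] by (simp add: power2_sum)
  finally show "l2_norm (\<lambda>x. f x + g x) \<le> l2_norm f + l2_norm g"
    by (rule power2_le_imp_le) simp
qed

lemma square_integrable_minus:
  assumes "square_integrable f"
  shows "square_integrable (\<lambda>x. - f x)" "l2_norm (\<lambda>x. - f x) = l2_norm f"
  using assms by (auto simp: square_integrable_def l2_norm_def)

lemma square_integrable_diff:
  fixes f g :: "'a::euclidean_space \<Rightarrow> 'b::euclidean_space"
  assumes f: "square_integrable f" and g: "square_integrable g"
  shows "square_integrable (\<lambda>x. f x - g x)" "l2_norm (\<lambda>x. f x - g x) \<le> l2_norm f + l2_norm g"
    "l2_norm f \<le> l2_norm (\<lambda>x. f x - g x) + l2_norm g"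
proof -
  show d: "square_integrable (\<lambda>x. f x - g x)" and "l2_norm (\<lambda>x. f x - g x) \<le> l2_norm f + l2_norm g"
    using square_integrable_add[OF f square_integrable_minus(1)[OF g]] square_integrable_minus(2)[OF g]
    by auto
  show "l2_norm f \<le> l2_norm (\<lambda>x. f x - g x) + l2_norm g"
    using square_integrable_add(2)[OF d g] by simp
qed

lemma square_integrable_mult_left:
  fixes f :: "'a::euclidean_space \<Rightarrow> 'b::{euclidean_space, real_normed_field}"
  assumes f: "square_integrable f"
  shows "square_integrable (\<lambda>x. c * f x)"
  by (rule square_integrable_dominated(1)[OF f, of _ "norm c"]) (use f in \<open>auto simp: norm_mult square_integrable_def\<close>)

lemma l2_norm_minus_commute: "l2_norm (\<lambda>x. f x - g x) = l2_norm (\<lambda>x. g x - f x)"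
  by (rule l2_norm_cong) (rule norm_minus_commute)

lemma l2_norm_triangle_diff:
  fixes f g h :: "'a::euclidean_space \<Rightarrow> 'b::euclidean_space"
  assumes f: "square_integrable f" and g: "square_integrable g" and h: "square_integrable h"
  shows "l2_norm (\<lambda>x. f x - h x) \<le> l2_norm (\<lambda>x. f x - g x) + l2_norm (\<lambda>x. g x - h x)"
  using square_integrable_add(2)[OF square_integrable_diff(1)[OF f g] square_integrable_diff(1)[OF g h]]
  by simp

lemma l2_norm_abs_diff:
  fixes f g :: "'a::euclidean_space \<Rightarrow> 'b::euclidean_space"
  assumes f: "square_integrable f" and g: "square_integrable g"
  shows "\<bar>l2_norm f - l2_norm g\<bar> \<le> l2_norm (\<lambda>x. f x - g x)"
  using square_integrable_diff(3)[OF f g] square_integrable_diff(3)[OF g f] l2_norm_minus_commute[of f g]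
  by simp

lemma l2_norm_eq_0_iff:
  assumes f: "square_integrable f"
  shows "l2_norm f = 0 \<longleftrightarrow> (AE x in lborel. f x = 0)"
proof -
  have "l2_norm f = 0 \<longleftrightarrow> (LINT x|lborel. (norm (f x))\<^sup>2) = 0"
    by (simp add: l2_norm_def)
  also have "\<dots> \<longleftrightarrow> (AE x in lborel. (norm (f x))\<^sup>2 = 0)"
    by (rule integral_nonneg_eq_0_iff_AE[OF square_integrable_integrable[OF f]]) simp
  finally show ?thesis by simp
qed

lemma l2_dominated_convergence:
  fixes f :: "'a::euclidean_space \<Rightarrow> 'b::euclidean_space" and g :: "'a \<Rightarrow> 'c::euclidean_space"
  assumes F: "\<And>n. F n \<in> borel_measurable borel" and f: "f \<in> borel_measurable borel"
    and g: "square_integrable g"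
    and lim: "AE x in lborel. (\<lambda>n. F n x) \<longlonglongrightarrow> f x"
    and bound: "\<And>n x. norm (F n x - f x) \<le> norm (g x)"
  shows "(\<lambda>n::nat. l2_norm (\<lambda>x. F n x - f x)) \<longlonglongrightarrow> 0"
proof -
  note [measurable] = F f
  have "(\<lambda>n. LINT x|lborel. (norm (F n x - f x))\<^sup>2) \<longlonglongrightarrow> integral\<^sup>L lborel (\<lambda>x::'a. (0::real))"
  proof (rule integral_dominated_convergence[where w="\<lambda>x. (norm (g x))\<^sup>2" and s="\<lambda>n x. (norm (F n x - f x))\<^sup>2"])
    show "integrable lborel (\<lambda>x. (norm (g x))\<^sup>2)" by (rule square_integrable_integrable[OF g])
    show "AE x in lborel. (\<lambda>n. (norm (F n x - f x))\<^sup>2) \<longlonglongrightarrow> 0"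
      using lim
    proof eventually_elim
      case (elim x)
      then have "(\<lambda>n. F n x - f x) \<longlonglongrightarrow> 0" by (simp add: LIM_zero_iff)
      then have "(\<lambda>n. (norm (F n x - f x))\<^sup>2) \<longlonglongrightarrow> (norm (0::'b))\<^sup>2" by (intro tendsto_intros)
      then show ?case by simp
    qed
    show "AE x in lborel. norm ((norm (F n x - f x))\<^sup>2) \<le> (norm (g x))\<^sup>2" for n
      using bound by (auto intro!: power_mono)
  qed auto
  then have "(\<lambda>n. sqrt (LINT x|lborel. (norm (F n x - f x))\<^sup>2)) \<longlonglongrightarrow> sqrt 0"
    by (intro tendsto_real_sqrt) simp
  then show ?thesis by (simp add: l2_norm_def)
qed

lemma square_integrable_restrict:
  fixes f :: "'a::euclidean_space \<Rightarrow> 'b::euclidean_space"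
  assumes f: "square_integrable f" and [measurable]: "A \<in> sets borel"
  shows "square_integrable (\<lambda>x. indicator A x *\<^sub>R f x)"
    and "l2_norm (\<lambda>x. indicator A x *\<^sub>R f x) \<le> l2_norm f"
proof -
  have m: "(\<lambda>x. indicator A x *\<^sub>R f x) \<in> borel_measurable borel"
    using square_integrable_measurable[OF f] by measurable
  have le: "AE x in lborel. norm (indicator A x *\<^sub>R f x) \<le> 1 * norm (f x)"
    by (auto simp: indicator_def)
  show "square_integrable (\<lambda>x. indicator A x *\<^sub>R f x)"
    by (rule square_integrable_dominated(1)[OF f m _ le]) simp
  show "l2_norm (\<lambda>x. indicator A x *\<^sub>R f x) \<le> l2_norm f"
    using square_integrable_dominated(2)[OF f m _ le] by simp
qed

lemma integrable_restrict_ball: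
  fixes f :: "'a::euclidean_space \<Rightarrow> 'b::euclidean_space"
  assumes f: "square_integrable f"
  shows "integrable lborel (\<lambda>x. indicator (ball c R) x *\<^sub>R f x)"
proof -
  let ?i = "\<lambda>x::'a. indicator (ball c R) x :: real"
  have [measurable]: "f \<in> borel_measurable borel"
    using f by (simp add: square_integrable_def)
  have "(\<integral>\<^sup>+ x. ennreal ((norm (?i x))\<^sup>2) \<partial>lborel) = emeasure lborel (ball c R)"
    by (subst nn_integral_indicator[symmetric])
      (auto intro!: nn_integral_cong simp del: nn_integral_indicator split: split_indicator)
  then have "square_integrable ?i"
    using emeasure_lborel_ball_finite[of c R]
    by (intro square_integrableI borel_measurable_indicator) simp_all
  then have "integrable lborel (\<lambda>x. norm (?i x) * norm (f x))"
    using f by (rule square_integrable_mult_integrable)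
  then show ?thesis
    by (rule Bochner_Integration.integrable_bound) (measurable, auto)
qed

lemma l2_truncation:
  fixes f :: "'a::euclidean_space \<Rightarrow> 'b::euclidean_space"
  assumes f: "square_integrable f"
  shows "((\<lambda>R. l2_norm (\<lambda>x. indicator (ball 0 R) x *\<^sub>R f x - f x)) \<longlongrightarrow> 0) at_top"
proof (rule tendsto_at_topI_sequentially)
  fix R :: "nat \<Rightarrow> real" assume R: "filterlim R at_top sequentially"
  have [measurable]: "f \<in> borel_measurable borel"
    using f by (simp add: square_integrable_def)
  show "(\<lambda>n. l2_norm (\<lambda>x. indicator (ball 0 (R n)) x *\<^sub>R f x - f x)) \<longlonglongrightarrow> 0"
  proof (rule l2_dominated_convergence[OF _ _ f])
    have "(\<lambda>n. indicator (ball 0 (R n)) x *\<^sub>R f x) \<longlonglongrightarrow> f x" for x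
    proof (rule tendsto_eventually)
      show "\<forall>\<^sub>F n in sequentially. indicator (ball 0 (R n)) x *\<^sub>R f x = f x"
        using filterlim_at_top_dense[THEN iffD1, OF R, rule_format, of "norm x"]
        by eventually_elim (simp add: indicator_def)
    qed
    then show "AE x in lborel. (\<lambda>n. indicator (ball 0 (R n)) x *\<^sub>R f x) \<longlonglongrightarrow> f x" by simp
  qed (auto simp: indicator_def)
qed

text \<open>The Riesz-Fischer theorem. Along a subsequence with increments below \<open>(1/2)\<^sup>k\<close> the weighted sum
  \<open>\<Sum> 2\<^sup>k |d\<^sub>k|\<^sup>2\<close> of the squared increments is integrable, hence finite almost everywhere, so the
  increments decay geometrically at almost every point. Fatou's lemma turns the pointwise limit into
  a mean square limit.\<close>

lemma l2_complete:
  fixes F :: "nat \<Rightarrow> 'a::euclidean_space \<Rightarrow> 'b::euclidean_space"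
  assumes F: "\<And>n. square_integrable (F n)"
    and cauchy: "\<And>e. 0 < e \<Longrightarrow> \<exists>N. \<forall>m\<ge>N. \<forall>n\<ge>N. l2_norm (\<lambda>x. F m x - F n x) < e"
  obtains f where "square_integrable f" "(\<lambda>n. l2_norm (\<lambda>x. F n x - f x)) \<longlonglongrightarrow> 0"
proof -
  have [measurable]: "F n \<in> borel_measurable borel" for n
    using F[of n] by (simp add: square_integrable_def)
  have "\<forall>k. \<exists>N. \<forall>m\<ge>N. \<forall>n\<ge>N. l2_norm (\<lambda>x. F m x - F n x) < (1/2)^k"
    using cauchy by simp
  then obtain N where N: "\<And>k m n. N k \<le> m \<Longrightarrow> N k \<le> n \<Longrightarrow> l2_norm (\<lambda>x. F m x - F n x) < (1/2)^k"
    by metis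
  \<comment> \<open>a strictly monotone choice of indices with \<open>N k \<le> r k\<close>\<close>
  define r where "r k = (\<Sum>j\<le>k. N j) + k" for k
  have rN: "N k \<le> r k" for k
    unfolding r_def by (simp add: member_le_sum trans_le_add1)
  have r_mono: "r k \<le> r (Suc k)" for k by (simp add: r_def)
  have r_ge: "k \<le> r k" for k by (simp add: r_def)
  let ?d = "\<lambda>k x. F (r (Suc k)) x - F (r k) x"
  have sd: "square_integrable (?d k)" for k
    by (rule square_integrable_diff(1)[OF F F])
  have dle: "l2_norm (?d k) \<le> (1/2)^k" for k
    using N[of k "r (Suc k)" "r k"] rN[of k] r_mono[of k] by simp
  have "(\<integral>\<^sup>+ x. (\<Sum>k. ennreal (2^k * (norm (?d k x))\<^sup>2)) \<partial>lborel)
      = (\<Sum>k. \<integral>\<^sup>+ x. ennreal (2^k * (norm (?d k x))\<^sup>2) \<partial>lborel)"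
    by (rule nn_integral_suminf) measurable
  also have "\<dots> \<le> (\<Sum>k. ennreal ((1/2)^k))"
  proof (intro suminf_le allI)
    fix k
    have "(\<integral>\<^sup>+ x. ennreal (2^k * (norm (?d k x))\<^sup>2) \<partial>lborel)
        = ennreal (2^k) * (\<integral>\<^sup>+ x. ennreal ((norm (?d k x))\<^sup>2) \<partial>lborel)"
      by (subst nn_integral_cmult[symmetric]) (auto simp: ennreal_mult)
    also have "\<dots> = ennreal (2^k * (l2_norm (?d k))\<^sup>2)"
      by (subst nn_integral_l2_norm[OF sd]) (simp add: ennreal_mult)
    also have "\<dots> \<le> ennreal ((1/2)^k)"
    proof (rule ennreal_leI)
      have "(l2_norm (?d k))\<^sup>2 \<le> ((1/2)^k)\<^sup>2"
        by (intro power_mono dle) simp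
      then have "2^k * (l2_norm (?d k))\<^sup>2 \<le> 2^k * ((1/2)^k)\<^sup>2" by simp
      also have "\<dots> = (1/2)^k" by (simp add: power2_eq_square power_one_over)
      finally show "2^k * (l2_norm (?d k))\<^sup>2 \<le> (1/2)^k" .
    qed
    finally show "(\<integral>\<^sup>+ x. ennreal (2^k * (norm (?d k x))\<^sup>2) \<partial>lborel) \<le> ennreal ((1/2)^k)" .
  qed auto
  also have "\<dots> < \<infinity>"
    by (subst suminf_ennreal2) (auto simp: summable_geometric)
  finally have "AE x in lborel. (\<Sum>k. ennreal (2^k * (norm (?d k x))\<^sup>2)) \<noteq> \<infinity>"
    by (intro nn_integral_PInf_AE) auto
  then have conv: "AE x in lborel. convergent (\<lambda>k. F (r k) x)"
  proof eventually_elim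
    case (elim x)
    then have "summable (\<lambda>k. 2^k * (norm (?d k x))\<^sup>2)"
      using summable_suminf_not_top[of "\<lambda>k. 2^k * (norm (?d k x))\<^sup>2"] by simp
    then have "Bseq (\<lambda>k. 2^k * (norm (?d k x))\<^sup>2)"
      using summable_LIMSEQ_zero convergent_imp_Bseq convergent_def by blast
    then obtain M where M: "0 < M" "\<And>k. norm (2^k * (norm (?d k x))\<^sup>2) \<le> M"
      by (auto elim: BseqE)
    have dM: "norm (?d k x) \<le> sqrt M * (sqrt (1/2))^k" for k
    proof (rule power2_le_imp_le)
      have "(norm (?d k x))\<^sup>2 \<le> M / 2^k"
        using M(2)[of k] by (simp add: field_simps)
      also have "\<dots> = (sqrt M)\<^sup>2 * ((sqrt (1/2))\<^sup>2)^k"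
        using M(1) by (simp add: power_one_over)
      also have "\<dots> = (sqrt M * sqrt (1/2)^k)\<^sup>2"
        by (metis mult.commute power_mult power_mult_distrib)
      finally show "(norm (?d k x))\<^sup>2 \<le> (sqrt M * sqrt (1/2)^k)\<^sup>2" .
    qed (use M in simp)
    have "summable (\<lambda>k. sqrt M * (sqrt (1/2))^k)"
      by (intro summable_mult summable_geometric) (simp add: real_sqrt_divide)
    then have "summable (\<lambda>k. ?d k x)"
      by (rule summable_comparison_test'[where N=0]) (use dM in simp)
    then have "convergent (\<lambda>n. \<Sum>k<n. ?d k x)"
      by (simp add: summable_iff_convergent)
    moreover have "(\<Sum>k<n. ?d k x) = F (r n) x - F (r 0) x" for n
      by (rule sum_lessThan_telescope)
    ultimately have "convergent (\<lambda>n. F (r n) x - F (r 0) x)" by simp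
    then show ?case
      using convergent_diff_const_right_iff by blast
  qed
  define f where "f x = lim (\<lambda>k. F (r k) x)" for x
  have [measurable]: "f \<in> borel_measurable borel"
    unfolding f_def by measurable
  have lim: "AE x in lborel. (\<lambda>k. F (r k) x) \<longlonglongrightarrow> f x"
    using conv by eventually_elim (simp add: f_def convergent_LIMSEQ_iff)
  have fatou: "(\<integral>\<^sup>+ x. ennreal ((norm (F m x - f x))\<^sup>2) \<partial>lborel) \<le> ennreal (e\<^sup>2)"
    if M: "\<And>k. M \<le> k \<Longrightarrow> l2_norm (\<lambda>x. F m x - F k x) < e" for m M e
  proof -
    have "(\<integral>\<^sup>+ x. ennreal ((norm (F m x - f x))\<^sup>2) \<partial>lborel)
        = (\<integral>\<^sup>+ x. liminf (\<lambda>k. ennreal ((norm (F m x - F (r k) x))\<^sup>2)) \<partial>lborel)"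
    proof (rule nn_integral_cong_AE, use lim in eventually_elim)
      case (elim x)
      then have "(\<lambda>k. ennreal ((norm (F m x - F (r k) x))\<^sup>2)) \<longlonglongrightarrow> ennreal ((norm (F m x - f x))\<^sup>2)"
        by (intro tendsto_intros)
      then show ?case
        using lim_imp_Liminf[OF sequentially_bot] by metis
    qed
    also have "\<dots> \<le> liminf (\<lambda>k. \<integral>\<^sup>+ x. ennreal ((norm (F m x - F (r k) x))\<^sup>2) \<partial>lborel)"
      by (rule nn_integral_liminf) measurable
    also have "\<dots> = liminf (\<lambda>k. ennreal ((l2_norm (\<lambda>x. F m x - F (r k) x))\<^sup>2))"
      by (simp add: nn_integral_l2_norm square_integrable_diff(1)[OF F F])
    also have "\<dots> \<le> liminf (\<lambda>k::nat. ennreal (e\<^sup>2))"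
    proof (rule Liminf_mono)
      show "\<forall>\<^sub>F k in sequentially. ennreal ((l2_norm (\<lambda>x. F m x - F (r k) x))\<^sup>2) \<le> ennreal (e\<^sup>2)"
        using eventually_ge_at_top[of M]
      proof eventually_elim
        case (elim k)
        then have "l2_norm (\<lambda>x. F m x - F (r k) x) < e"
          using M[of "r k"] r_ge[of k] by simp
        then show ?case
          by (intro ennreal_leI power_mono) auto
      qed
    qed
    also have "\<dots> = ennreal (e\<^sup>2)" by (rule Liminf_const) simp
    finally show ?thesis .
  qed
  have "square_integrable f"
  proof -
    obtain M where "\<forall>m\<ge>M. \<forall>n\<ge>M. l2_norm (\<lambda>x. F m x - F n x) < 1"
      using cauchy[of 1] by auto
    then have "(\<integral>\<^sup>+ x. ennreal ((norm (F M x - f x))\<^sup>2) \<partial>lborel) \<le> ennreal (1\<^sup>2)"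
      by (intro fatou[of M]) auto
    then have "square_integrable (\<lambda>x. F M x - f x)"
      by (intro square_integrableI) (auto intro: le_less_trans)
    then have "square_integrable (\<lambda>x. F M x - (F M x - f x))"
      by (rule square_integrable_diff(1)[OF F])
    then show ?thesis by simp
  qed
  moreover have "(\<lambda>n. l2_norm (\<lambda>x. F n x - f x)) \<longlonglongrightarrow> 0"
  proof (rule LIMSEQ_I)
    fix e :: real assume "0 < e"
    then obtain M where M: "\<forall>m\<ge>M. \<forall>n\<ge>M. l2_norm (\<lambda>x. F m x - F n x) < e / 2"
      using cauchy[of "e/2"] by auto
    have "norm (l2_norm (\<lambda>x. F m x - f x) - 0) < e" if "M \<le> m" for m
    proof -
      have "(\<integral>\<^sup>+ x. ennreal ((norm (F m x - f x))\<^sup>2) \<partial>lborel) \<le> ennreal ((e/2)\<^sup>2)"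
        using M that by (intro fatou[of M]) auto
      then have "ennreal ((l2_norm (\<lambda>x. F m x - f x))\<^sup>2) \<le> ennreal ((e/2)\<^sup>2)"
        by (subst (asm) nn_integral_l2_norm[OF square_integrable_diff(1)[OF F \<open>square_integrable f\<close>]])
      then have "(l2_norm (\<lambda>x. F m x - f x))\<^sup>2 \<le> (e/2)\<^sup>2"
        by (subst (asm) ennreal_le_iff) auto
      then have "l2_norm (\<lambda>x. F m x - f x) \<le> e/2"
        by (rule power2_le_imp_le) (use \<open>0 < e\<close> in simp)
      then show ?thesis using \<open>0 < e\<close> by simp
    qed
    then show "\<exists>M. \<forall>m\<ge>M. norm (l2_norm (\<lambda>x. F m x - f x) - 0) < e" by blast
  qed
  ultimately show ?thesis by (rule that)
qed

section \<open>Affine changes of variables\<close>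

lemma nn_integral_lborel_affine:
  fixes f :: "'a::euclidean_space \<Rightarrow> ennreal"
  assumes [measurable]: "f \<in> borel_measurable borel" and c: "c \<noteq> 0"
  shows "(\<integral>\<^sup>+ x. f x \<partial>lborel) = ennreal (\<bar>c\<bar> ^ DIM('a)) * (\<integral>\<^sup>+ x. f (t + c *\<^sub>R x) \<partial>lborel)"
  by (subst lborel_affine[OF c, of t])
     (simp add: nn_integral_density nn_integral_distr nn_integral_cmult)

lemma nn_integral_lborel_translate:
  fixes f :: "'a::euclidean_space \<Rightarrow> ennreal"
  assumes "f \<in> borel_measurable borel"
  shows "(\<integral>\<^sup>+ x. f (t + x) \<partial>lborel) = (\<integral>\<^sup>+ x. f x \<partial>lborel)"
  using nn_integral_lborel_affine[OF assms, of 1 t] by simp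

lemma nn_integral_lborel_reflect:
  fixes f :: "'a::euclidean_space \<Rightarrow> ennreal"
  assumes "f \<in> borel_measurable borel"
  shows "(\<integral>\<^sup>+ x. f (t - x) \<partial>lborel) = (\<integral>\<^sup>+ x. f x \<partial>lborel)"
  using nn_integral_lborel_affine[OF assms, of "-1" t] by simp

lemma AE_lborel_affine:
  fixes P :: "'a::euclidean_space \<Rightarrow> bool"
  assumes c: "c \<noteq> 0" and [measurable]: "Measurable.pred borel P" and "AE x in lborel. P x"
  shows "AE x in lborel. P (t + c *\<^sub>R x)"
  using assms(3)
  by (subst (asm) lborel_affine[OF c, of t]) (simp add: AE_density AE_distr_iff c)

lemma integral_lborel_affine:
  fixes f :: "'a::euclidean_space \<Rightarrow> 'b::{banach, second_countable_topology}"
  assumes [measurable]: "f \<in> borel_measurable borel" and c: "c \<noteq> 0"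
  shows "(LINT x|lborel. f x) = (\<bar>c\<bar> ^ DIM('a)) *\<^sub>R (LINT x|lborel. f (t + c *\<^sub>R x))"
  by (subst lborel_affine[OF c, of t]) (simp add: integral_density integral_distr)

lemma integrable_lborel_translate:
  fixes f :: "'a::euclidean_space \<Rightarrow> 'b::{banach, second_countable_topology}"
  assumes f: "integrable lborel f"
  shows "integrable lborel (\<lambda>x. f (t + x))"
proof -
  have [measurable]: "f \<in> borel_measurable borel" using f by auto
  have "integrable (distr lborel borel ((+) t)) f"
    using f by (simp add: lborel_distr_plus)
  then show ?thesis
    by (subst (asm) integrable_distr_eq) auto
qed

lemma square_integrable_translate:
  fixes f :: "'a::euclidean_space \<Rightarrow> 'b::euclidean_space"
  assumes f: "square_integrable f"
  shows "square_integrable (\<lambda>x. f (x + t))" "l2_norm (\<lambda>x. f (x + t)) = l2_norm f"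
proof -
  have [measurable]: "f \<in> borel_measurable borel"
    by (rule square_integrable_measurable[OF f])
  have eq: "(\<lambda>x. f (x + t)) = (\<lambda>x. f (t + x))" by (simp add: add.commute)
  have "integrable lborel (\<lambda>x. (norm (f (t + x)))\<^sup>2)"
    by (rule integrable_lborel_translate[OF square_integrable_integrable[OF f]])
  then show "square_integrable (\<lambda>x. f (x + t))"
    unfolding square_integrable_def eq by simp
  show "l2_norm (\<lambda>x. f (x + t)) = l2_norm f"
    unfolding l2_norm_def eq using integral_lborel_affine[of "\<lambda>x. (norm (f x))\<^sup>2" 1 t] by simp
qed

section \<open>Gaussian functions and their Fourier transforms\<close>

abbreviation iexp_neg :: "real \<Rightarrow> complex" where
  "iexp_neg t \<equiv> exp (- \<i> * complex_of_real t)"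

definition fourier_integral :: "('a::euclidean_space \<Rightarrow> complex) \<Rightarrow> 'a \<Rightarrow> complex" where
  "fourier_integral u \<xi> =
     complex_of_real ((2 * pi) powr (- real DIM('a) / 2)) *
     (LINT x|lborel. iexp_neg (\<xi> \<bullet> x) * u x)"

text \<open>Not normalised: the value at the origin is \<open>1\<close>, so that the functions increase to the constant
  \<open>1\<close> as \<open>\<epsilon>\<close> decreases to \<open>0\<close>, and they serve as integrable summation factors.\<close>

definition gauss :: "real \<Rightarrow> 'a::euclidean_space \<Rightarrow> real" where
  "gauss \<epsilon> x = exp (- (\<epsilon> * norm x)\<^sup>2 / 2)"

lemma measurable_gauss [measurable]: "gauss \<epsilon> \<in> borel_measurable borel"
  unfolding gauss_def by measurable

lemma gauss_pos [simp]: "0 < gauss \<epsilon> x"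
  by (simp add: gauss_def)

lemma integral_lborel_prod_Basis:
  fixes g :: "'a::euclidean_space \<Rightarrow> real \<Rightarrow> 'b::{real_normed_field, banach, second_countable_topology}"
  assumes "\<And>b. b \<in> Basis \<Longrightarrow> integrable lborel (g b)"
  shows "integrable lborel (\<lambda>x::'a. \<Prod>b\<in>Basis. g b (x \<bullet> b))"
    and "(LINT x|lborel. (\<Prod>b\<in>Basis. g b (x \<bullet> b))) = (\<Prod>b\<in>Basis. (LINT y|lborel. g b y))"
proof -
  interpret product_sigma_finite "\<lambda>_::'a. lborel :: real measure" ..
  have [measurable]: "\<And>b. b \<in> Basis \<Longrightarrow> g b \<in> borel_measurable borel"
    using assms by auto
  have eq: "(\<Prod>b\<in>Basis. g b ((\<Sum>b\<in>Basis. f b *\<^sub>R b) \<bullet> b)) = (\<Prod>b\<in>Basis. g b (f b))" for f :: "'a \<Rightarrow> real"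
    by (intro prod.cong) auto
  have m: "(\<lambda>x::'a. \<Prod>b\<in>Basis. g b (x \<bullet> b)) \<in> borel_measurable borel"
    by measurable
  have m2: "(\<lambda>f::'a \<Rightarrow> real. \<Sum>b\<in>Basis. f b *\<^sub>R b) \<in> (\<Pi>\<^sub>M b\<in>Basis. lborel) \<rightarrow>\<^sub>M borel"
    by measurable
  show "integrable lborel (\<lambda>x::'a. \<Prod>b\<in>Basis. g b (x \<bullet> b))"
    apply (subst lborel_eq)
    apply (subst integrable_distr_eq[OF m2 m])
    unfolding eq
    by (rule product_integrable_prod) (use assms in auto)
  show "(LINT x|lborel. (\<Prod>b\<in>Basis. g b (x \<bullet> b))) = (\<Prod>b\<in>Basis. (LINT y|lborel. g b y))"
    apply (subst lborel_eq)
    apply (subst integral_distr[OF m2 m])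
    unfolding eq
    by (rule product_integral_prod) (use assms in auto)
qed

text \<open>After rescaling this is the characteristic function of the standard normal distribution.\<close>

lemma gauss_transform_1d:
  fixes t \<epsilon> :: real
  assumes "0 < \<epsilon>"
  shows "integrable lborel (\<lambda>y. iexp_neg (t * y) * complex_of_real (exp (- (\<epsilon> * y)\<^sup>2 / 2)))"
    and "(LINT y|lborel. iexp_neg (t * y) * complex_of_real (exp (- (\<epsilon> * y)\<^sup>2 / 2)))
      = complex_of_real (sqrt (2 * pi) / \<epsilon> * exp (- (t / \<epsilon>)\<^sup>2 / 2))"
proof -
  let ?f = "\<lambda>y. std_normal_density y *\<^sub>R iexp ((- t / \<epsilon>) * y)"
  have i: "integrable lborel ?f"
  proof (rule Bochner_Integration.integrable_bound)
    show "integrable lborel std_normal_density"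
      using integrable_std_normal_moment[of 0] by simp
  qed (auto simp: normal_density_nonneg)
  have "(LINT y|lborel. ?f y) = char std_normal_distribution (- t / \<epsilon>)"
    unfolding char_def by (subst integral_density) (auto simp: normal_density_nonneg)
  also have "\<dots> = complex_of_real (exp (- (t / \<epsilon>)\<^sup>2 / 2))"
    by (subst char_std_normal_distribution) (simp add: power_divide)
  finally have val: "(LINT y|lborel. ?f y) = complex_of_real (exp (- (t / \<epsilon>)\<^sup>2 / 2))" .
  have eq: "iexp_neg (t * y) * complex_of_real (exp (- (\<epsilon> * y)\<^sup>2 / 2))
      = complex_of_real (sqrt (2 * pi)) * ?f (0 + \<epsilon> * y)" for y
    using assms by (simp add: std_normal_density_def scaleR_conv_of_real)
  show "integrable lborel (\<lambda>y. iexp_neg (t * y) * complex_of_real (exp (- (\<epsilon> * y)\<^sup>2 / 2)))"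
    unfolding eq using lborel_integrable_real_affine[OF i, of \<epsilon> 0] assms
    by (intro Bochner_Integration.integrable_mult_right) auto
  have "(LINT y|lborel. ?f y) = \<bar>\<epsilon>\<bar> *\<^sub>R (LINT y|lborel. ?f (0 + \<epsilon> * y))"
    by (rule lborel_integral_real_affine) (use assms in auto)
  then have s: "(LINT y|lborel. ?f (0 + \<epsilon> * y)) = complex_of_real (exp (- (t / \<epsilon>)\<^sup>2 / 2) / \<epsilon>)"
    unfolding val using assms by (simp add: scaleR_conv_of_real field_simps)
  show "(LINT y|lborel. iexp_neg (t * y) * complex_of_real (exp (- (\<epsilon> * y)\<^sup>2 / 2)))
      = complex_of_real (sqrt (2 * pi) / \<epsilon> * exp (- (t / \<epsilon>)\<^sup>2 / 2))"
    unfolding eq integral_mult_right_zero s by simp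
qed

lemma norm_power2_Basis: "(norm (x::'a::euclidean_space))\<^sup>2 = (\<Sum>b\<in>Basis. (x \<bullet> b)\<^sup>2)"
  unfolding power2_norm_eq_inner by (subst euclidean_inner) (simp add: power2_eq_square)

text \<open>The exponential and the Gaussian are both products over the coordinates, which reduces the claim
  to one dimension.\<close>

lemma gauss_transform:
  fixes \<xi> :: "'a::euclidean_space"
  assumes "0 < \<epsilon>"
  shows "integrable lborel (\<lambda>x. iexp_neg (\<xi> \<bullet> x) * complex_of_real (gauss \<epsilon> x))"
    and "(LINT x|lborel. iexp_neg (\<xi> \<bullet> x) * complex_of_real (gauss \<epsilon> x))
      = complex_of_real ((sqrt (2 * pi) / \<epsilon>) ^ DIM('a) * gauss (1 / \<epsilon>) \<xi>)"
proof -
  let ?g = "\<lambda>(b::'a) y. iexp_neg ((\<xi> \<bullet> b) * y) * complex_of_real (exp (- (\<epsilon> * y)\<^sup>2 / 2))"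
  have g: "gauss d x = (\<Prod>b\<in>Basis. exp (- (d * (x \<bullet> b))\<^sup>2 / 2))" for d and x :: 'a
    unfolding gauss_def power_mult_distrib norm_power2_Basis
    by (subst exp_sum[symmetric]) (auto simp: sum_distrib_left sum_negf sum_divide_distrib)
  have e: "iexp_neg (\<xi> \<bullet> x) = (\<Prod>b\<in>Basis. iexp_neg ((\<xi> \<bullet> b) * (x \<bullet> b)))" for x :: 'a
    by (subst exp_sum[symmetric], simp, subst euclidean_inner) (simp add: sum_distrib_left sum_negf)
  have eq: "iexp_neg (\<xi> \<bullet> x) * complex_of_real (gauss \<epsilon> x) = (\<Prod>b\<in>Basis. ?g b (x \<bullet> b))" for x :: 'a
    unfolding e g by (simp add: prod.distrib)
  show "integrable lborel (\<lambda>x. iexp_neg (\<xi> \<bullet> x) * complex_of_real (gauss \<epsilon> x))"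
    unfolding eq by (rule integral_lborel_prod_Basis(1)) (rule gauss_transform_1d[OF assms])
  have "(LINT x|lborel. iexp_neg (\<xi> \<bullet> x) * complex_of_real (gauss \<epsilon> x))
      = (\<Prod>b\<in>Basis. (LINT y|lborel. ?g b y))"
    unfolding eq by (rule integral_lborel_prod_Basis(2)) (rule gauss_transform_1d[OF assms])
  also have "\<dots> = (\<Prod>b\<in>Basis. complex_of_real (sqrt (2 * pi) / \<epsilon> * exp (- ((\<xi> \<bullet> b) / \<epsilon>)\<^sup>2 / 2)))"
    unfolding gauss_transform_1d(2)[OF assms] ..
  also have "\<dots> = complex_of_real ((sqrt (2 * pi) / \<epsilon>) ^ DIM('a) * gauss (1 / \<epsilon>) \<xi>)"
    unfolding of_real_prod[symmetric] prod.distrib g by simp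
  finally show "(LINT x|lborel. iexp_neg (\<xi> \<bullet> x) * complex_of_real (gauss \<epsilon> x))
      = complex_of_real ((sqrt (2 * pi) / \<epsilon>) ^ DIM('a) * gauss (1 / \<epsilon>) \<xi>)" .
qed

text \<open>This is why the constant in \<open>fourier_integral\<close> makes the transform an isometry.\<close>

lemma fourier_constant:
  "(2 * pi) powr (- real n / 2) * sqrt (2 * pi) ^ n = 1"
proof -
  have "sqrt (2 * pi) ^ n = (2 * pi) powr (real n / 2)"
    by (simp add: powr_half_sqrt[symmetric] powr_realpow[symmetric] powr_powr)
  then show ?thesis
    by (simp add: powr_add[symmetric])
qed

lemma gauss_integral:
  assumes "0 < \<epsilon>"
  shows "integrable lborel (\<lambda>x::'a::euclidean_space. gauss \<epsilon> x)"
    "(LINT x|lborel. gauss \<epsilon> (x::'a)) = (sqrt (2 * pi) / \<epsilon>) ^ DIM('a)"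
proof -
  have i: "integrable lborel (\<lambda>x::'a. complex_of_real (gauss \<epsilon> x))"
    using gauss_transform(1)[OF assms, of "0::'a"] by simp
  then show "integrable lborel (\<lambda>x::'a. gauss \<epsilon> x)"
    by (simp only: complex_of_real_integrable_eq)
  have "complex_of_real (LINT x|lborel. gauss \<epsilon> (x::'a)) = complex_of_real ((sqrt (2 * pi) / \<epsilon>) ^ DIM('a))"
    using gauss_transform(2)[OF assms, of "0::'a"] by (simp add: gauss_def)
  then show "(LINT x|lborel. gauss \<epsilon> (x::'a)) = (sqrt (2 * pi) / \<epsilon>) ^ DIM('a)"
    by (simp only: of_real_eq_iff)
qed

section \<open>The Fourier transform of integrable functions\<close>

lemma norm_exp_imaginary [simp]: "norm (iexp_neg t) = 1" "norm (iexp t) = 1"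
  by (simp_all add: norm_exp_eq_Re)

lemma integrable_modulated:
  fixes u :: "'a::euclidean_space \<Rightarrow> complex"
  assumes u: "integrable lborel u"
  shows "integrable lborel (\<lambda>x. iexp_neg (\<xi> \<bullet> x) * u x)"
proof -
  have [measurable]: "u \<in> borel_measurable borel" using u by auto
  show ?thesis
    by (rule Bochner_Integration.integrable_bound[OF u]) (measurable, auto simp: norm_mult)
qed

lemma measurable_fourier_integral [measurable]:
  assumes [measurable]: "u \<in> borel_measurable borel"
  shows "fourier_integral u \<in> borel_measurable borel"
  unfolding fourier_integral_def by measurable

lemma norm_fourier_integral_le:
  fixes u :: "'a::euclidean_space \<Rightarrow> complex"
  assumes u: "integrable lborel u"
  shows "norm (fourier_integral u \<xi>) \<le> (2 * pi) powr (- real DIM('a) / 2) * (LINT x|lborel. norm (u x))"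
proof -
  have "norm (LINT x|lborel. iexp_neg (\<xi> \<bullet> x) * u x)
      \<le> (LINT x|lborel. norm (iexp_neg (\<xi> \<bullet> x) * u x))"
    by (rule integral_norm_bound)
  then show ?thesis
    unfolding fourier_integral_def norm_mult norm_of_real norm_exp_imaginary
    by (intro mult_mono) auto
qed

lemma fourier_integral_diff:
  assumes "integrable lborel u" "integrable lborel v"
  shows "fourier_integral (\<lambda>x. u x - v x) \<xi> = fourier_integral u \<xi> - fourier_integral v \<xi>"
  unfolding fourier_integral_def right_diff_distrib
    Bochner_Integration.integral_diff[OF integrable_modulated[OF assms(1)] integrable_modulated[OF assms(2)]]
  by (rule refl)

text \<open>Both sides are the double integral of \<open>iexp_neg (\<xi> \<bullet> x) * v x * \<psi> \<xi>\<close>. This symmetry of the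
  transform is the source of the Plancherel theorem and of the inversion formula.\<close>

lemma fourier_integral_mult:
  fixes v \<psi> :: "'a::euclidean_space \<Rightarrow> complex"
  assumes v: "integrable lborel v" and \<psi>: "integrable lborel \<psi>"
  shows "(LINT \<xi>|lborel. fourier_integral v \<xi> * \<psi> \<xi>) = (LINT x|lborel. v x * fourier_integral \<psi> x)"
proof -
  have [measurable]: "v \<in> borel_measurable borel" "\<psi> \<in> borel_measurable borel" using v \<psi> by auto
  let ?k = "\<lambda>x \<xi>. iexp_neg (\<xi> \<bullet> x) * v x * \<psi> \<xi>"
  let ?c = "complex_of_real ((2 * pi) powr (- real DIM('a) / 2))"
  have "integrable (lborel \<Otimes>\<^sub>M lborel) (\<lambda>(x, \<xi>). ?k x \<xi>)"
  proof (rule lborel_pair.Fubini_integrable)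
    show "(\<lambda>(x, \<xi>). ?k x \<xi>) \<in> borel_measurable (lborel \<Otimes>\<^sub>M lborel)" by measurable
    show "integrable lborel (\<lambda>x. LINT \<xi>|lborel. norm (case (x, \<xi>) of (x, \<xi>) \<Rightarrow> ?k x \<xi>))"
      using v by (simp add: norm_mult)
    show "AE x in lborel. integrable lborel (\<lambda>\<xi>. case (x, \<xi>) of (x, \<xi>) \<Rightarrow> ?k x \<xi>)"
      using integrable_modulated[OF \<psi>] by (simp add: inner_commute mult.assoc mult.left_commute)
  qed
  from lborel_pair.Fubini_integral[OF this]
  have F: "(LINT \<xi>|lborel. (LINT x|lborel. ?k x \<xi>)) = (LINT x|lborel. (LINT \<xi>|lborel. ?k x \<xi>))" .
  have "(LINT \<xi>|lborel. fourier_integral v \<xi> * \<psi> \<xi>) = ?c * (LINT \<xi>|lborel. (LINT x|lborel. ?k x \<xi>))"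
    unfolding fourier_integral_def by (simp add: mult.assoc flip: integral_mult_left_zero)
  also have "\<dots> = (LINT x|lborel. v x * fourier_integral \<psi> x)"
    unfolding fourier_integral_def F
    by (simp flip: integral_mult_right_zero) (simp add: mult_ac inner_commute)
  finally show ?thesis .
qed

section \<open>The Plancherel theorem\<close>

lemma abs_gauss [simp]: "\<bar>gauss \<epsilon> x\<bar> = gauss \<epsilon> x"
  by (simp add: gauss_def)

lemma measurable_cnj [measurable]: "cnj \<in> borel_measurable borel"
  by (intro borel_measurable_continuous_onI continuous_intros)

lemma measurable_indicator_cball_times [measurable, simp]:
  fixes w :: "'a::euclidean_space \<Rightarrow> real"
  assumes "w \<in> borel_measurable borel"
  shows "(\<lambda>x. indicator (cball a r) x * w x) \<in> borel_measurable borel"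
  using assms by (intro borel_measurable_times borel_measurable_indicator) auto

text \<open>The Fourier transform of \<open>|F v|\<^sup>2\<close> up to normalisation; its value at the origin is the squared
  mean square norm of \<open>v\<close>.\<close>

definition autocorrelation :: "('a::euclidean_space \<Rightarrow> complex) \<Rightarrow> 'a \<Rightarrow> complex" where
  "autocorrelation v h = (LINT x|lborel. v x * cnj (v (x + h)))"

lemma integrable_bounded_support:
  fixes v :: "'a::euclidean_space \<Rightarrow> 'b::{banach, second_countable_topology}"
  assumes [measurable]: "v \<in> borel_measurable borel"
    and bdd: "\<And>x. norm (v x) \<le> M" and supp: "\<And>x. B < norm x \<Longrightarrow> v x = 0"
  shows "integrable lborel v"
proof (rule Bochner_Integration.integrable_bound)
  show "integrable lborel (\<lambda>x::'a. indicator (cball 0 B) x * M)"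
    by (intro integrable_mult_left integrable_real_indicator emeasure_bounded_finite) auto
  have "norm (v x) \<le> norm (indicator (cball 0 B) x * M)" for x
    using bdd[of x] supp[of x] by (cases "norm x \<le> B") (auto simp: indicator_def)
  then show "AE x in lborel. norm (v x) \<le> norm (indicator (cball 0 B) x * M)" by simp
qed simp

text \<open>A measurable function is almost everywhere a limit of continuous ones. Projecting these to the ball
  of radius \<open>M\<close> keeps the bound of \<open>v\<close> without destroying continuity or the limit, and dominated
  convergence applies on a bounded set.\<close>

lemma l1_approx_continuous:
  fixes v :: "'a::euclidean_space \<Rightarrow> 'b::euclidean_space"
  assumes [measurable]: "v \<in> borel_measurable borel"
    and bdd: "\<And>x. norm (v x) \<le> M" and "0 < e"
  obtains g where "continuous_on UNIV g" "\<And>x. norm (g x) \<le> M"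
    "(LINT x|lborel. indicator (cball 0 B) x * norm (v x - g x)) < e"
proof -
  have "0 \<le> M" using bdd norm_ge_zero order_trans by blast
  have "v measurable_on UNIV"
    by (rule lebesgue_measurable_imp_measurable_on) (auto intro!: measurable_completion)
  then obtain N g where N: "negligible N" and g: "\<And>n. continuous_on UNIV (g n)"
    and lim: "\<And>x. x \<notin> N \<Longrightarrow> (\<lambda>n. g n x) \<longlonglongrightarrow> v x"
    unfolding measurable_on_def by auto
  define k where "k n x = closest_point (cball 0 M) (g n x)" for n :: nat and x
  have cp: "continuous_on UNIV (closest_point (cball (0::'b) M))"
    using \<open>0 \<le> M\<close> by (intro continuous_on_closest_point) auto
  have k: "continuous_on UNIV (k n)" for n
    unfolding k_def using continuous_on_compose2[OF cp g] by auto
  then have [measurable]: "k n \<in> borel_measurable borel" for n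
    by (rule borel_measurable_continuous_onI)
  have kM: "norm (k n x) \<le> M" for n x
    unfolding k_def using closest_point_in_set[of "cball (0::'b) M" "g n x"] \<open>0 \<le> M\<close> by auto
  have limk: "(\<lambda>n. k n x) \<longlonglongrightarrow> v x" if "x \<notin> N" for x
  proof -
    have "(\<lambda>n. closest_point (cball 0 M) (g n x)) \<longlonglongrightarrow> closest_point (cball 0 M) (v x)"
      by (rule continuous_on_tendsto_compose[OF cp lim[OF that]]) auto
    then show ?thesis
      unfolding k_def using closest_point_self[of "v x" "cball 0 M"] bdd by simp
  qed
  have "AE x in lebesgue. x \<notin> N"
    using N by (simp add: negligible_iff_null_sets AE_not_in)
  then have "AE x in lebesgue. (\<lambda>n. k n x) \<longlonglongrightarrow> v x"
    by eventually_elim (rule limk)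
  then have AE: "AE x in lborel. (\<lambda>n. k n x) \<longlonglongrightarrow> v x"
    by (simp only: AE_completion_iff)
  have "(\<lambda>n. LINT x|lborel. indicator (cball 0 B) x * norm (v x - k n x)) \<longlonglongrightarrow> integral\<^sup>L lborel (\<lambda>x::'a. 0::real)"
  proof (rule integral_dominated_convergence[where w="\<lambda>x. indicator (cball 0 B) x * (2 * M)"])
    show "integrable lborel (\<lambda>x::'a. indicator (cball 0 B) x * (2 * M))"
      by (intro integrable_mult_left integrable_real_indicator emeasure_bounded_finite) auto
    show "AE x in lborel. (\<lambda>n. indicator (cball 0 B) x * norm (v x - k n x)) \<longlonglongrightarrow> 0"
      using AE
    proof eventually_elim
      case (elim x)
      then have "(\<lambda>n. indicator (cball 0 B) x * norm (v x - k n x)) \<longlonglongrightarrow> indicator (cball 0 B) x * norm (v x - v x)"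
        by (intro tendsto_intros)
      then show ?case by simp
    qed
    have "norm (v x - k n x) \<le> 2 * M" for n x
      using norm_triangle_ineq4[of "v x" "k n x"] bdd[of x] kM[of n x] by linarith
    then show "AE x in lborel. norm (indicator (cball 0 B) x * norm (v x - k n x)) \<le> indicator (cball 0 B) x * (2 * M)" for n
      by (auto simp: indicator_def)
    have "k n \<in> borel_measurable lborel" for n by simp
    then show "(\<lambda>x. indicator (cball 0 B) x * norm (v x - k n x)) \<in> borel_measurable lborel" for n
      using assms(1) by (intro borel_measurable_times borel_measurable_indicator borel_measurable_norm borel_measurable_diff) auto
  qed simp
  then have "\<forall>\<^sub>F n in sequentially. (LINT x|lborel. indicator (cball 0 B) x * norm (v x - k n x)) < e"
    using \<open>0 < e\<close> by (intro order_tendstoD) auto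
  then obtain n where "(LINT x|lborel. indicator (cball 0 B) x * norm (v x - k n x)) < e"
    using eventually_sequentially by auto
  then show ?thesis using that k kM by blast
qed

text \<open>Continuity at the origin is clear when the translated factor is continuous. In general, replace that
  factor by a continuous function that is close in mean on a ball slightly larger than the support
  of \<open>v\<close>; the error is uniform in translations of length at most \<open>1\<close>.\<close>

lemma autocorrelation_tendsto:
  fixes v :: "'a::euclidean_space \<Rightarrow> complex"
  assumes m[measurable]: "v \<in> borel_measurable borel"
    and bdd: "\<And>x. norm (v x) \<le> M" and supp: "\<And>x. B < norm x \<Longrightarrow> v x = 0"
    and h: "h \<longlonglongrightarrow> 0"
  shows "(\<lambda>n. autocorrelation v (h n)) \<longlonglongrightarrow> autocorrelation v 0"
proof (rule LIMSEQ_I)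
  fix e :: real assume "0 < e"
  have M0: "0 \<le> M" using bdd norm_ge_zero order_trans by blast
  have iv: "integrable lborel v"
    by (rule integrable_bounded_support[OF m bdd supp])
  \<comment> \<open>three errors, each multiplied by \<open>M\<close>, have to stay below \<open>e\<close>\<close>
  define \<delta> where "\<delta> = e / (4 * (M + 1))"
  have \<delta>: "0 < \<delta>" using \<open>0 < e\<close> M0 by (simp add: \<delta>_def)
  obtain g where g: "continuous_on UNIV g" "\<And>x. norm (g x) \<le> M"
    and vg: "(LINT x|lborel. indicator (cball 0 (B + 1)) x * norm (v x - g x)) < \<delta>"
    by (rule l1_approx_continuous[OF m bdd \<delta>, where B="B + 1"]) blast
  have [measurable]: "g \<in> borel_measurable borel"
    by (rule borel_measurable_continuous_onI[OF g(1)])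
  let ?I = "\<lambda>x. indicator (cball (0::'a) B) x :: real" and ?J = "\<lambda>x. indicator (cball (0::'a) (B + 1)) x :: real"
  have inti: "integrable lborel (\<lambda>x::'a. indicator (cball 0 r) x * w x)"
    if [measurable]: "w \<in> borel_measurable borel" and "\<And>x. norm (w x) \<le> K" for r K and w :: "'a \<Rightarrow> real"
  proof (rule Bochner_Integration.integrable_bound)
    show "integrable lborel (\<lambda>x::'a. indicator (cball 0 r) x * K)"
      by (intro integrable_mult_left integrable_real_indicator emeasure_bounded_finite) auto
    have "norm (indicator (cball 0 r) x * w x) \<le> norm (indicator (cball 0 r) x * K)" for x
      using that(2)[of x] by (auto simp: indicator_def)
    then show "AE x in lborel. norm (indicator (cball 0 r) x * w x) \<le> norm (indicator (cball 0 r) x * K)" by simp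
  qed simp
  have b2: "norm (norm (a - b)) \<le> 2 * M" if "norm a \<le> M" "norm b \<le> M" for a b :: complex
    using norm_triangle_ineq4[of a b] that by simp
  have i1: "integrable lborel (\<lambda>x. ?J x * norm (v x - g x))"
    by (rule inti[where K="2 * M"]) (auto intro!: b2[simplified] bdd g)
  have "(\<lambda>n. LINT x|lborel. ?I x * norm (g (x + h n) - g x)) \<longlonglongrightarrow> integral\<^sup>L lborel (\<lambda>x::'a. 0::real)"
  proof (rule integral_dominated_convergence[where w="\<lambda>x. ?I x * (2 * M)"])
    show "integrable lborel (\<lambda>x::'a. ?I x * (2 * M))"
      by (intro integrable_mult_left integrable_real_indicator emeasure_bounded_finite) auto
    have "(\<lambda>n. ?I x * norm (g (x + h n) - g x)) \<longlonglongrightarrow> ?I x * norm (g (x + 0) - g x)" for x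
      by (intro tendsto_intros h continuous_on_tendsto_compose[OF g(1)]) auto
    then show "AE x in lborel. (\<lambda>n. ?I x * norm (g (x + h n) - g x)) \<longlonglongrightarrow> 0" by simp
    show "AE x in lborel. norm (?I x * norm (g (x + h n) - g x)) \<le> ?I x * (2 * M)" for n
      using b2[OF g(2) g(2)] by (auto simp: indicator_def)
  qed auto
  then have ev1: "\<forall>\<^sub>F n in sequentially. (LINT x|lborel. ?I x * norm (g (x + h n) - g x)) < \<delta>"
    using \<delta> by (intro order_tendstoD) auto
  have ev2: "\<forall>\<^sub>F n in sequentially. norm (h n) < 1"
    using tendsto_norm[OF h] by (intro order_tendstoD) auto
  have "\<forall>\<^sub>F n in sequentially. norm (autocorrelation v (h n) - autocorrelation v 0) < e"
    using ev1 ev2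
  proof eventually_elim
    case (elim n)
    let ?h = "h n"
    have ic: "integrable lborel (\<lambda>x. v x * cnj (v (x + k)))" for k
    proof (rule Bochner_Integration.integrable_bound)
      show "integrable lborel (\<lambda>x. M * norm (v x))" using iv by auto
      have "norm (v x) * norm (v (x + k)) \<le> norm (v x) * M" for x
        by (intro mult_left_mono bdd) auto
      then show "AE x in lborel. norm (v x * cnj (v (x + k))) \<le> norm (M * norm (v x))"
        using M0 by (auto simp: norm_mult mult.commute)
    qed simp
    have i2: "integrable lborel (\<lambda>x. ?I x * norm (v (x + ?h) - g (x + ?h)))"
      by (rule inti[where K="2 * M"]) (auto intro!: b2[simplified] bdd g)
    have i3: "integrable lborel (\<lambda>x. ?I x * norm (g (x + ?h) - g x))"
      by (rule inti[where K="2 * M"]) (auto intro!: b2[simplified] bdd g)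
    have i4: "integrable lborel (\<lambda>x. ?I x * norm (v x - g x))"
      by (rule inti[where K="2 * M"]) (auto intro!: b2[simplified] bdd g)
    have shift: "(LINT x|lborel. ?I x * norm (v (x + ?h) - g (x + ?h))) \<le> (LINT x|lborel. ?J x * norm (v x - g x))"
    proof -
      have "(LINT x|lborel. ?J x * norm (v x - g x)) = (LINT x|lborel. ?J (x + ?h) * norm (v (x + ?h) - g (x + ?h)))"
        using integral_lborel_affine[of "\<lambda>x. ?J x * norm (v x - g x)" 1 ?h] by (simp add: add.commute)
      moreover have "(LINT x|lborel. ?I x * norm (v (x + ?h) - g (x + ?h))) \<le> (LINT x|lborel. ?J (x + ?h) * norm (v (x + ?h) - g (x + ?h)))"
      proof (rule integral_mono[OF i2])
        show "integrable lborel (\<lambda>x. ?J (x + ?h) * norm (v (x + ?h) - g (x + ?h)))"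
          using integrable_lborel_translate[OF i1, of ?h] by (simp add: add.commute)
        fix x
        have "norm (x + ?h) \<le> B + 1" if "norm x \<le> B"
          using norm_triangle_ineq[of x ?h] that elim by linarith
        then show "?I x * norm (v (x + ?h) - g (x + ?h)) \<le> ?J (x + ?h) * norm (v (x + ?h) - g (x + ?h))"
          by (auto simp: indicator_def)
      qed
      ultimately show ?thesis by simp
    qed
    have "norm (autocorrelation v ?h - autocorrelation v 0)
        = norm (LINT x|lborel. v x * cnj (v (x + ?h)) - v x * cnj (v (x + 0)))"
      unfolding autocorrelation_def by (subst Bochner_Integration.integral_diff[OF ic ic]) (rule refl)
    also have "\<dots> \<le> (LINT x|lborel. norm (v x * cnj (v (x + ?h)) - v x * cnj (v (x + 0))))"
      by (rule integral_norm_bound)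
    also have "\<dots> \<le> (LINT x|lborel. M * (?I x * norm (v (x + ?h) - g (x + ?h)) + ?I x * norm (g (x + ?h) - g x)
        + ?I x * norm (v x - g x)))"
    proof (rule integral_mono)
      show "integrable lborel (\<lambda>x. norm (v x * cnj (v (x + ?h)) - v x * cnj (v (x + 0))))"
        by (intro integrable_norm Bochner_Integration.integrable_diff ic)
      show "integrable lborel (\<lambda>x. M * (?I x * norm (v (x + ?h) - g (x + ?h)) + ?I x * norm (g (x + ?h) - g x)
        + ?I x * norm (v x - g x)))"
        by (intro integrable_mult_right Bochner_Integration.integrable_add i2 i3 i4)
      fix x
      have "norm (v x * cnj (v (x + ?h)) - v x * cnj (v (x + 0))) = norm (v x) * norm (v (x + ?h) - v x)"
        by (metis (no_types, opaque_lifting) add.right_neutral complex_cnj_diff complex_mod_cnj norm_mult right_diff_distrib)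
      also have "\<dots> \<le> (M * ?I x) * (norm (v (x + ?h) - g (x + ?h)) + norm (g (x + ?h) - g x) + norm (v x - g x))"
      proof (rule mult_mono)
        show "norm (v x) \<le> M * ?I x"
          using bdd[of x] supp[of x] by (cases "norm x \<le> B") (auto simp: indicator_def)
        have "norm (v (x + ?h) - v x) = norm ((v (x + ?h) - g (x + ?h)) + (g (x + ?h) - g x) - (v x - g x))" by simp
        also have "\<dots> \<le> norm ((v (x + ?h) - g (x + ?h)) + (g (x + ?h) - g x)) + norm (v x - g x)"
          by (rule norm_triangle_ineq4)
        also have "\<dots> \<le> norm (v (x + ?h) - g (x + ?h)) + norm (g (x + ?h) - g x) + norm (v x - g x)"
          by (intro add_right_mono norm_triangle_ineq)
        finally show "norm (v (x + ?h) - v x) \<le> norm (v (x + ?h) - g (x + ?h)) + norm (g (x + ?h) - g x) + norm (v x - g x)" .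
      qed (use M0 in auto)
      finally show "norm (v x * cnj (v (x + ?h)) - v x * cnj (v (x + 0)))
        \<le> M * (?I x * norm (v (x + ?h) - g (x + ?h)) + ?I x * norm (g (x + ?h) - g x) + ?I x * norm (v x - g x))"
        by (simp add: algebra_simps)
    qed
    also have "\<dots> = M * ((LINT x|lborel. ?I x * norm (v (x + ?h) - g (x + ?h)))
        + (LINT x|lborel. ?I x * norm (g (x + ?h) - g x)) + (LINT x|lborel. ?I x * norm (v x - g x)))"
      using i2 i3 i4 by simp
    also have "\<dots> \<le> M * (\<delta> + \<delta> + \<delta>)"
    proof (intro mult_left_mono add_mono M0)
      show "(LINT x|lborel. ?I x * norm (v (x + ?h) - g (x + ?h))) \<le> \<delta>" using shift vg by simp
      show "(LINT x|lborel. ?I x * norm (g (x + ?h) - g x)) \<le> \<delta>" using elim by simp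
      have "(LINT x|lborel. ?I x * norm (v x - g x)) \<le> (LINT x|lborel. ?J x * norm (v x - g x))"
        by (rule integral_mono[OF i4 i1]) (auto simp: indicator_def)
      then show "(LINT x|lborel. ?I x * norm (v x - g x)) \<le> \<delta>" using vg by simp
    qed
    also have "\<dots> \<le> 3 * ((M + 1) * \<delta>)"
      using \<delta> by (simp add: algebra_simps)
    also have "\<dots> < e"
    proof -
      have "(M + 1) * \<delta> = e / 4"
        unfolding \<delta>_def using M0 by (simp add: field_simps)
      then show ?thesis using \<open>0 < e\<close> by simp
    qed
    finally show ?case .
  qed
  then show "\<exists>N. \<forall>n\<ge>N. norm (autocorrelation v (h n) - autocorrelation v 0) < e"
    by (simp add: eventually_sequentially)
qed

text \<open>Two applications of the multiplication formula move both transforms in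
  \<open>\<integral> F v * cnj (F v) * gauss \<epsilon>\<close> onto the Gaussian, whose transform is explicit; a rescaling by
  \<open>\<epsilon>\<close> and Fubini's theorem then produce an average of the autocorrelation.\<close>

lemma fourier_integral_gauss_weighted:
  fixes v :: "'a::euclidean_space \<Rightarrow> complex"
  assumes m[measurable]: "v \<in> borel_measurable borel"
    and bdd: "\<And>x. norm (v x) \<le> M" and supp: "\<And>x. B < norm x \<Longrightarrow> v x = 0"
    and "0 < \<epsilon>"
  shows "complex_of_real (LINT \<xi>|lborel. (norm (fourier_integral v \<xi>))\<^sup>2 * gauss \<epsilon> \<xi>)
    = (LINT z|lborel. complex_of_real ((2 * pi) powr (- real DIM('a) / 2) * gauss 1 z) * autocorrelation v (\<epsilon> *\<^sub>R z))"
proof -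
  have iv: "integrable lborel v"
    by (rule integrable_bounded_support[OF m bdd supp])
  let ?F = "fourier_integral v"
  define c where "c = (2 * pi) powr (- real DIM('a) / 2)"
  define K where "K = c * (LINT x|lborel. norm (v x))"
  have K: "norm (?F \<xi>) \<le> K" for \<xi>
    unfolding K_def c_def by (rule norm_fourier_integral_le[OF iv])
  have M0: "0 \<le> M" using bdd norm_ge_zero order_trans by blast
  have K0: "0 \<le> K" using K norm_ge_zero order_trans by blast
  note ig = gauss_integral(1)[OF \<open>0 < \<epsilon>\<close>, where 'a='a]
  let ?\<psi> = "\<lambda>\<xi>. complex_of_real (gauss \<epsilon> \<xi>) * cnj (?F \<xi>)"
  let ?\<chi> = "\<lambda>(x::'a) \<xi>. iexp (x \<bullet> \<xi>) * complex_of_real (gauss \<epsilon> \<xi>)"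
  have i\<psi>: "integrable lborel ?\<psi>"
  proof (rule Bochner_Integration.integrable_bound)
    show "integrable lborel (\<lambda>\<xi>::'a. K * gauss \<epsilon> \<xi>)" using ig by auto
    show "AE \<xi> in lborel. norm (?\<psi> \<xi>) \<le> norm (K * gauss \<epsilon> \<xi>)"
      using K K0 by (auto simp: norm_mult abs_mult mult.commute[of K] intro!: mult_left_mono less_imp_le)
  qed measurable
  have i\<chi>: "integrable lborel (?\<chi> x)" for x
    by (rule Bochner_Integration.integrable_bound[OF ig]) (auto simp: norm_mult)
  have F\<chi>: "fourier_integral (?\<chi> x) y = complex_of_real ((1 / \<epsilon>) ^ DIM('a) * gauss (1 / \<epsilon>) (y - x))" for x y
  proof -
    have "(LINT \<xi>|lborel. iexp_neg (y \<bullet> \<xi>) * ?\<chi> x \<xi>)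
        = (LINT \<xi>|lborel. iexp_neg ((y - x) \<bullet> \<xi>) * complex_of_real (gauss \<epsilon> \<xi>))"
    proof (intro Bochner_Integration.integral_cong refl)
      fix \<xi>
      have "iexp_neg (y \<bullet> \<xi>) * iexp (x \<bullet> \<xi>) = iexp_neg ((y - x) \<bullet> \<xi>)"
        by (subst exp_add[symmetric]) (simp add: inner_diff_left right_diff_distrib)
      then show "iexp_neg (y \<bullet> \<xi>) * ?\<chi> x \<xi> = iexp_neg ((y - x) \<bullet> \<xi>) * complex_of_real (gauss \<epsilon> \<xi>)"
        by (metis mult.assoc)
    qed
    also have "\<dots> = complex_of_real ((sqrt (2 * pi) / \<epsilon>) ^ DIM('a) * gauss (1 / \<epsilon>) (y - x))"
      by (rule gauss_transform(2)[OF \<open>0 < \<epsilon>\<close>])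
    finally have "fourier_integral (?\<chi> x) y
      = complex_of_real (((2 * pi) powr (- real DIM('a) / 2) * sqrt (2 * pi) ^ DIM('a)) * (1 / \<epsilon>) ^ DIM('a) * gauss (1 / \<epsilon>) (y - x))"
      unfolding fourier_integral_def by (simp add: power_divide)
    then show ?thesis by (simp only: fourier_constant mult_1_left)
  qed
  have conv: "fourier_integral ?\<psi> x = cnj (complex_of_real c * (LINT z|lborel. v (x + \<epsilon> *\<^sub>R z) * complex_of_real (gauss 1 z)))" for x
  proof -
    have "fourier_integral ?\<psi> x = complex_of_real c * (LINT \<xi>|lborel. cnj (?F \<xi> * ?\<chi> x \<xi>))"
    proof -
      have "cnj (iexp t) = iexp_neg t" for t
        using exp_cnj[of "\<i> * complex_of_real t"] by simp
      then have "iexp_neg (x \<bullet> \<xi>) * ?\<psi> \<xi> = cnj (?F \<xi> * ?\<chi> x \<xi>)" for \<xi>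
        by (simp only: complex_cnj_mult complex_cnj_complex_of_real mult_ac)
      then show ?thesis unfolding fourier_integral_def[of ?\<psi>] c_def by presburger
    qed
    also have "\<dots> = cnj (complex_of_real c * (LINT \<xi>|lborel. ?F \<xi> * ?\<chi> x \<xi>))"
      by (subst Bochner_Integration.integral_cnj) (simp only: complex_cnj_mult complex_cnj_complex_of_real)
    also have "(LINT \<xi>|lborel. ?F \<xi> * ?\<chi> x \<xi>) = (LINT y|lborel. v y * fourier_integral (?\<chi> x) y)"
      by (rule fourier_integral_mult[OF iv i\<chi>])
    also have "\<dots> = (LINT y|lborel. v y * complex_of_real ((1 / \<epsilon>) ^ DIM('a) * gauss (1 / \<epsilon>) (y - x)))"
      unfolding F\<chi> ..
    also have "\<dots> = (\<bar>\<epsilon>\<bar> ^ DIM('a)) *\<^sub>R (LINT z|lborel. v (x + \<epsilon> *\<^sub>R z) * complex_of_real ((1 / \<epsilon>) ^ DIM('a) * gauss (1 / \<epsilon>) (x + \<epsilon> *\<^sub>R z - x)))"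
      by (rule integral_lborel_affine) (use \<open>0 < \<epsilon>\<close> in auto)
    also have "\<dots> = (LINT z|lborel. (\<bar>\<epsilon>\<bar> ^ DIM('a)) *\<^sub>R (v (x + \<epsilon> *\<^sub>R z) * complex_of_real ((1 / \<epsilon>) ^ DIM('a) * gauss (1 / \<epsilon>) (x + \<epsilon> *\<^sub>R z - x))))"
      by simp
    also have "\<dots> = (LINT z|lborel. v (x + \<epsilon> *\<^sub>R z) * complex_of_real (gauss 1 z))"
      using \<open>0 < \<epsilon>\<close> by (intro Bochner_Integration.integral_cong) (auto simp: gauss_def scaleR_conv_of_real power_divide)
    finally show ?thesis .
  qed
  let ?k = "\<lambda>x z. complex_of_real (c * gauss 1 z) * (v x * cnj (v (x + \<epsilon> *\<^sub>R z)))"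
  have "complex_of_real (LINT \<xi>|lborel. (norm (?F \<xi>))\<^sup>2 * gauss \<epsilon> \<xi>) = (LINT \<xi>|lborel. ?F \<xi> * ?\<psi> \<xi>)"
    unfolding integral_complex_of_real[symmetric]
    by (intro Bochner_Integration.integral_cong) (auto simp: complex_norm_square mult_ac simp flip: of_real_power)
  also have "\<dots> = (LINT x|lborel. v x * fourier_integral ?\<psi> x)"
    by (rule fourier_integral_mult[OF iv i\<psi>])
  also have "\<dots> = (LINT x|lborel. (LINT z|lborel. ?k x z))"
  proof (intro Bochner_Integration.integral_cong refl)
    fix x
    have "v x * fourier_integral ?\<psi> x = complex_of_real c * (v x * (LINT z|lborel. cnj (v (x + \<epsilon> *\<^sub>R z) * complex_of_real (gauss 1 z))))"
      unfolding conv Bochner_Integration.integral_cnj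
      by (simp only: complex_cnj_mult[of "complex_of_real c"] complex_cnj_complex_of_real mult.left_commute)
    then show "v x * fourier_integral ?\<psi> x = (LINT z|lborel. ?k x z)"
      by (simp flip: integral_mult_right_zero) (simp add: mult_ac)
  qed
  also have "\<dots> = (LINT z|lborel. (LINT x|lborel. ?k x z))"
  proof (rule lborel_pair.Fubini_integral[symmetric], rule lborel_pair.Fubini_integrable)
    have bd: "norm (?k x z) \<le> norm (v x) * (c * M * gauss 1 z)" for x z
    proof -
      have "norm (v x) * (c * gauss 1 z * norm (v (x + \<epsilon> *\<^sub>R z))) \<le> norm (v x) * (c * gauss 1 z * M)"
        by (intro mult_left_mono bdd) (auto simp: c_def less_imp_le)
      then show ?thesis by (simp add: norm_mult mult_ac c_def)
    qed
    have c0: "0 \<le> c" by (simp add: c_def)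
    have ig1: "integrable lborel (\<lambda>z::'a. c * M * gauss 1 z)"
      using gauss_integral(1)[of 1, where 'a='a] by auto
    have ik: "integrable lborel (?k x)" for x
    proof (rule Bochner_Integration.integrable_bound)
      show "integrable lborel (\<lambda>z::'a. norm (v x) * (c * M * gauss 1 z))" using ig1 by (rule integrable_mult_right)
      show "AE z in lborel. norm (?k x z) \<le> norm (norm (v x) * (c * M * gauss 1 z))"
        using bd c0 M0 by (auto simp: abs_mult less_imp_le)
    qed simp
    show "(\<lambda>(x, z). ?k x z) \<in> borel_measurable (lborel \<Otimes>\<^sub>M lborel)" by measurable
    show "AE x in lborel. integrable lborel (\<lambda>z. case (x, z) of (x, z) \<Rightarrow> ?k x z)"
      using ik by simp
    show "integrable lborel (\<lambda>x. LINT z|lborel. norm (case (x, z) of (x, z) \<Rightarrow> ?k x z))"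
    proof (rule Bochner_Integration.integrable_bound[OF _ _ AE_I2])
      show "integrable lborel (\<lambda>x. norm (v x) * (LINT z|lborel. c * M * gauss 1 (z::'a)))"
        using iv by auto
      fix x
      have "norm (LINT z|lborel. norm (?k x z)) = (LINT z|lborel. norm (?k x z))"
        by (simp only: real_norm_def, rule abs_of_nonneg) simp
      also have "\<dots> \<le> (LINT z|lborel. norm (v x) * (c * M * gauss 1 (z::'a)))"
        by (intro integral_mono integrable_norm ik integrable_mult_right ig1 bd)
      also have "\<dots> = norm (v x) * (LINT z|lborel. c * M * gauss 1 (z::'a))"
        by (rule integral_mult_right_zero)
      also have "\<dots> \<le> norm (norm (v x) * (LINT z|lborel. c * M * gauss 1 (z::'a)))"
        unfolding real_norm_def by (rule abs_ge_self)
      finally show "norm (LINT z|lborel. norm (case (x, z) of (x, z) \<Rightarrow> ?k x z))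
          \<le> norm (norm (v x) * (LINT z|lborel. c * M * gauss 1 (z::'a)))"
        by (simp only: prod.case)
    qed (measurable)
  qed
  also have "\<dots> = (LINT z|lborel. complex_of_real (c * gauss 1 z) * autocorrelation v (\<epsilon> *\<^sub>R z))"
    unfolding autocorrelation_def by (simp only: integral_mult_right_zero)
  finally show ?thesis unfolding c_def .
qed

lemma gauss_nonneg [simp]: "0 \<le> gauss \<epsilon> x"
  by (rule less_imp_le) simp

lemma gauss_tendsto_1: "(\<lambda>n. gauss (1 / real (Suc n)) x) \<longlonglongrightarrow> 1"
proof -
  have "(\<lambda>n. exp (- (1 / real (Suc n) * norm x)\<^sup>2 / 2)) \<longlonglongrightarrow> exp (- (0 * norm x)\<^sup>2 / 2)"
    by (intro tendsto_intros LIMSEQ_Suc[OF lim_const_over_n[where a=1, simplified]]) auto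
  then show ?thesis by (simp add: gauss_def)
qed

lemma gauss_mono: "0 \<le> a \<Longrightarrow> a \<le> b \<Longrightarrow> gauss b x \<le> gauss a x"
  unfolding gauss_def by (auto intro!: power_mono mult_right_mono)

text \<open>As \<open>\<epsilon>\<close> decreases to \<open>0\<close> the left side of the weighted identity increases to \<open>\<integral> |F v|\<^sup>2\<close>, while the
  right side tends to the autocorrelation at the origin, because the Gaussian average has total
  mass \<open>1\<close>.\<close>

lemma plancherel_bounded_support:
  fixes v :: "'a::euclidean_space \<Rightarrow> complex"
  assumes m[measurable]: "v \<in> borel_measurable borel"
    and bdd: "\<And>x. norm (v x) \<le> M" and supp: "\<And>x. B < norm x \<Longrightarrow> v x = 0"
  shows "(\<integral>\<^sup>+ \<xi>. ennreal ((norm (fourier_integral v \<xi>))\<^sup>2) \<partial>lborel) = (\<integral>\<^sup>+ x. ennreal ((norm (v x))\<^sup>2) \<partial>lborel)"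
proof -
  have iv: "integrable lborel v"
    by (rule integrable_bounded_support[OF m bdd supp])
  have M0: "0 \<le> M" using bdd norm_ge_zero order_trans by blast
  define c where "c = (2 * pi) powr (- real DIM('a) / 2)"
  have c0: "0 \<le> c" by (simp add: c_def)
  let ?F = "fourier_integral v"
  let ?e = "\<lambda>n. 1 / real (Suc n)"
  have R: "(\<lambda>n. autocorrelation v (?e n *\<^sub>R z)) \<longlonglongrightarrow> autocorrelation v 0" for z
  proof (rule autocorrelation_tendsto[OF m bdd supp])
    have "(\<lambda>n. ?e n *\<^sub>R z) \<longlonglongrightarrow> 0 *\<^sub>R z"
      by (intro tendsto_intros LIMSEQ_Suc[OF lim_const_over_n[where a=1, simplified]])
    then show "(\<lambda>n. ?e n *\<^sub>R z) \<longlonglongrightarrow> 0" by simp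
  qed
  define K where "K = M * (LINT x|lborel. norm (v x))"
  have RK: "norm (autocorrelation v h) \<le> K" for h
  proof -
    have le: "norm (v x * cnj (v (x + h))) \<le> M * norm (v x)" for x
      using mult_left_mono[OF bdd[of "x + h"], of "norm (v x)"] by (simp add: norm_mult mult.commute)
    have "norm (autocorrelation v h) \<le> (LINT x|lborel. norm (v x * cnj (v (x + h))))"
      unfolding autocorrelation_def by (rule integral_norm_bound)
    also have "\<dots> \<le> (LINT x|lborel. M * norm (v x))"
    proof (rule integral_mono[OF _ _ le])
      show "integrable lborel (\<lambda>x. norm (v x * cnj (v (x + h))))"
      proof (rule Bochner_Integration.integrable_bound)
        show "integrable lborel (\<lambda>x. M * norm (v x))" using iv by auto
        show "AE x in lborel. norm (norm (v x * cnj (v (x + h)))) \<le> norm (M * norm (v x))"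
          using le M0 by (auto simp: norm_mult abs_mult)
      qed measurable
    qed (use iv in auto)
    finally show ?thesis by (simp add: K_def)
  qed
  have mR[measurable]: "autocorrelation v \<in> borel_measurable borel"
    unfolding autocorrelation_def by measurable
  note ig = gauss_integral[of 1, where 'a='a, simplified]
  have "(\<lambda>n. LINT z|lborel. complex_of_real (c * gauss 1 z) * autocorrelation v (?e n *\<^sub>R z))
      \<longlonglongrightarrow> (LINT z|lborel. complex_of_real (c * gauss 1 (z::'a)) * autocorrelation v 0)"
  proof (rule integral_dominated_convergence[where w="\<lambda>z. c * gauss 1 z * K"])
    show "integrable lborel (\<lambda>z::'a. c * gauss 1 z * K)"
      using ig by auto
    show "AE z in lborel. (\<lambda>n. complex_of_real (c * gauss 1 z) * autocorrelation v (?e n *\<^sub>R z)) \<longlonglongrightarrow> complex_of_real (c * gauss 1 z) * autocorrelation v 0"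
      by (intro AE_I2 tendsto_intros R)
    show "AE z in lborel. norm (complex_of_real (c * gauss 1 z) * autocorrelation v (?e n *\<^sub>R z)) \<le> c * gauss 1 z * K" for n
      using RK c0 by (intro AE_I2) (auto simp: norm_mult intro!: mult_left_mono)
  qed measurable
  also have "(LINT z|lborel. complex_of_real (c * gauss 1 (z::'a)) * autocorrelation v 0) = autocorrelation v 0"
  proof -
    have "c * (LINT z|lborel. gauss 1 (z::'a)) = 1"
      using ig(2) fourier_constant[of "DIM('a)"] by (simp add: c_def)
    then have "(LINT z|lborel. complex_of_real (c * gauss 1 (z::'a))) = 1"
      unfolding integral_complex_of_real by simp
    then show ?thesis by simp
  qed
  also have "autocorrelation v 0 = complex_of_real (LINT x|lborel. (norm (v x))\<^sup>2)"
    unfolding autocorrelation_def integral_complex_of_real[symmetric]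
    by (simp add: complex_norm_square del: of_real_power integral_complex_of_real)
  finally have "(\<lambda>n. complex_of_real (LINT \<xi>|lborel. (norm (?F \<xi>))\<^sup>2 * gauss (?e n) \<xi>)) \<longlonglongrightarrow> complex_of_real (LINT x|lborel. (norm (v x))\<^sup>2)"
    using fourier_integral_gauss_weighted[OF m bdd supp] by (simp add: c_def)
  then have "(\<lambda>n. LINT \<xi>|lborel. (norm (?F \<xi>))\<^sup>2 * gauss (?e n) \<xi>) \<longlonglongrightarrow> (LINT x|lborel. (norm (v x))\<^sup>2)"
    by (simp only: tendsto_of_real_iff)
  then have lim1: "(\<lambda>n. ennreal (LINT \<xi>|lborel. (norm (?F \<xi>))\<^sup>2 * gauss (?e n) \<xi>)) \<longlonglongrightarrow> ennreal (LINT x|lborel. (norm (v x))\<^sup>2)"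
    by (rule tendsto_ennrealI)
  have eq1: "ennreal (LINT \<xi>|lborel. (norm (?F \<xi>))\<^sup>2 * gauss (?e n) \<xi>) = (\<integral>\<^sup>+ \<xi>. ennreal ((norm (?F \<xi>))\<^sup>2 * gauss (?e n) \<xi>) \<partial>lborel)" for n
  proof (rule nn_integral_eq_integral[symmetric])
    let ?L = "c * (LINT x|lborel. norm (v x))"
    have L: "norm (?F \<xi>) \<le> ?L" for \<xi>
      unfolding c_def by (rule norm_fourier_integral_le[OF iv])
    show "integrable lborel (\<lambda>\<xi>. (norm (?F \<xi>))\<^sup>2 * gauss (?e n) \<xi>)"
    proof (rule Bochner_Integration.integrable_bound)
      show "integrable lborel (\<lambda>\<xi>::'a. ?L\<^sup>2 * gauss (?e n) \<xi>)"
        using gauss_integral(1)[of "?e n", where 'a='a] by auto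
      have "(norm (?F \<xi>))\<^sup>2 * gauss (?e n) \<xi> \<le> ?L\<^sup>2 * gauss (?e n) \<xi>" for \<xi>
        by (intro mult_right_mono power_mono L) (auto intro: less_imp_le)
      then show "AE \<xi> in lborel. norm ((norm (?F \<xi>))\<^sup>2 * gauss (?e n) \<xi>) \<le> norm (?L\<^sup>2 * gauss (?e n) \<xi>)"
        by (intro AE_I2) (simp add: abs_mult)
    qed measurable
  qed (auto intro: less_imp_le)
  have lim2: "(\<lambda>n. \<integral>\<^sup>+ \<xi>. ennreal ((norm (?F \<xi>))\<^sup>2 * gauss (?e n) \<xi>) \<partial>lborel) \<longlonglongrightarrow> (\<integral>\<^sup>+ \<xi>. ennreal ((norm (?F \<xi>))\<^sup>2) \<partial>lborel)"
  proof (rule nn_integral_LIMSEQ)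
    show "incseq (\<lambda>n \<xi>. ennreal ((norm (?F \<xi>))\<^sup>2 * gauss (?e n) \<xi>))"
      by (intro incseq_SucI le_funI ennreal_leI mult_left_mono gauss_mono) (auto simp: frac_le)
    have "(\<lambda>n. ennreal ((norm (?F \<xi>))\<^sup>2 * gauss (?e n) \<xi>)) \<longlonglongrightarrow> ennreal ((norm (?F \<xi>))\<^sup>2 * 1)" for \<xi>
      by (intro tendsto_ennrealI tendsto_intros gauss_tendsto_1)
    then show "(\<lambda>n. ennreal ((norm (?F \<xi>))\<^sup>2 * gauss (?e n) \<xi>)) \<longlonglongrightarrow> ennreal ((norm (?F \<xi>))\<^sup>2)" for \<xi>
      by simp
  qed measurable
  have "(\<integral>\<^sup>+ \<xi>. ennreal ((norm (?F \<xi>))\<^sup>2) \<partial>lborel) = ennreal (LINT x|lborel. (norm (v x))\<^sup>2)"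
    using LIMSEQ_unique[OF lim2 lim1[unfolded eq1]] .
  also have "\<dots> = (\<integral>\<^sup>+ x. ennreal ((norm (v x))\<^sup>2) \<partial>lborel)"
  proof (rule nn_integral_eq_integral[symmetric])
    show "integrable lborel (\<lambda>x. (norm (v x))\<^sup>2)"
    proof (rule integrable_bounded_support[of _ "M\<^sup>2" B])
      show "norm ((norm (v x))\<^sup>2) \<le> M\<^sup>2" for x using power_mono[OF bdd[of x], of 2] by simp
      show "(norm (v x))\<^sup>2 = 0" if "B < norm x" for x using supp that by simp
    qed measurable
  qed auto
  finally show ?thesis .
qed

text \<open>Cutting both the domain and the range gives bounded functions with bounded support, to which
  \<open>plancherel_bounded_support\<close> applies.\<close>

definition cutoff :: "nat \<Rightarrow> ('a::euclidean_space \<Rightarrow> complex) \<Rightarrow> 'a \<Rightarrow> complex" where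
  "cutoff n v x = (if norm x \<le> real n \<and> norm (v x) \<le> real n then v x else 0)"

lemma measurable_cutoff [measurable]:
  assumes [measurable]: "v \<in> borel_measurable borel"
  shows "cutoff n v \<in> borel_measurable borel"
  unfolding cutoff_def[abs_def] by measurable

lemma norm_cutoff_le: "norm (cutoff n v x) \<le> norm (v x)"
  by (simp add: cutoff_def)

lemma norm_diff_cutoff_le: "norm (cutoff n v x - v x) \<le> norm (v x)"
  by (simp add: cutoff_def)

lemma cutoff_tendsto: "(\<lambda>n. cutoff n v x) \<longlonglongrightarrow> v x"
proof (rule tendsto_eventually)
  obtain N where N: "norm x \<le> real N" "norm (v x) \<le> real N"
    by (metis linorder_linear max.bounded_iff real_arch_simple)
  show "\<forall>\<^sub>F n in sequentially. cutoff n v x = v x"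
    using eventually_ge_at_top[of N]
  proof eventually_elim
    case (elim n)
    then have "real N \<le> real n" by simp
    then show ?case using N by (simp add: cutoff_def)
  qed
qed

lemma plancherel_cutoff:
  assumes [measurable]: "v \<in> borel_measurable borel"
  shows "(\<integral>\<^sup>+ \<xi>. ennreal ((norm (fourier_integral (cutoff n v) \<xi>))\<^sup>2) \<partial>lborel) = (\<integral>\<^sup>+ x. ennreal ((norm (cutoff n v x))\<^sup>2) \<partial>lborel)"
  by (rule plancherel_bounded_support[where M="real n" and B="real n"]) (auto simp: cutoff_def)

text \<open>The transforms of the cutoffs converge pointwise by integrability of \<open>v\<close>, so Fatou's lemma gives the
  inequality. Equality follows in \<open>plancherel_integrable\<close>, since by the inequality the transforms of
  the cutoffs also converge in mean square.\<close>

lemma fourier_integral_L2_bound: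
  fixes v :: "'a::euclidean_space \<Rightarrow> complex"
  assumes iv: "integrable lborel v" and sv: "square_integrable v"
  shows "square_integrable (fourier_integral v)" "l2_norm (fourier_integral v) \<le> l2_norm v"
proof -
  have [measurable]: "v \<in> borel_measurable borel" using iv by auto
  have lim: "(\<lambda>n. fourier_integral (cutoff n v) \<xi>) \<longlonglongrightarrow> fourier_integral v \<xi>" for \<xi>
    unfolding fourier_integral_def
  proof (intro tendsto_intros integral_dominated_convergence[where w="\<lambda>x. norm (v x)"] AE_I2 cutoff_tendsto)
    show "integrable lborel (\<lambda>x. norm (v x))" using iv by auto
    show "norm (iexp_neg (\<xi> \<bullet> x) * cutoff n v x) \<le> norm (v x)" for n x
      using norm_cutoff_le[of n v x] by (simp only: norm_mult norm_exp_imaginary mult_1_left)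
  qed measurable
  have "(\<integral>\<^sup>+ \<xi>. ennreal ((norm (fourier_integral v \<xi>))\<^sup>2) \<partial>lborel)
      = (\<integral>\<^sup>+ \<xi>. liminf (\<lambda>n. ennreal ((norm (fourier_integral (cutoff n v) \<xi>))\<^sup>2)) \<partial>lborel)"
  proof (intro nn_integral_cong)
    fix \<xi>
    have "(\<lambda>n. ennreal ((norm (fourier_integral (cutoff n v) \<xi>))\<^sup>2)) \<longlonglongrightarrow> ennreal ((norm (fourier_integral v \<xi>))\<^sup>2)"
      by (intro tendsto_intros lim)
    then show "ennreal ((norm (fourier_integral v \<xi>))\<^sup>2) = liminf (\<lambda>n. ennreal ((norm (fourier_integral (cutoff n v) \<xi>))\<^sup>2))"
      using lim_imp_Liminf[OF sequentially_bot] by metis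
  qed
  also have "\<dots> \<le> liminf (\<lambda>n. \<integral>\<^sup>+ \<xi>. ennreal ((norm (fourier_integral (cutoff n v) \<xi>))\<^sup>2) \<partial>lborel)"
    by (rule nn_integral_liminf) measurable
  also have "\<dots> \<le> liminf (\<lambda>n::nat. ennreal ((l2_norm v)\<^sup>2))"
  proof (intro Liminf_mono always_eventually allI)
    fix n
    have "(\<integral>\<^sup>+ \<xi>. ennreal ((norm (fourier_integral (cutoff n v) \<xi>))\<^sup>2) \<partial>lborel) \<le> (\<integral>\<^sup>+ x. ennreal ((norm (v x))\<^sup>2) \<partial>lborel)"
      unfolding plancherel_cutoff[OF \<open>v \<in> borel_measurable borel\<close>]
      by (intro nn_integral_mono ennreal_leI power_mono norm_cutoff_le) auto
    then show "(\<integral>\<^sup>+ \<xi>. ennreal ((norm (fourier_integral (cutoff n v) \<xi>))\<^sup>2) \<partial>lborel) \<le> ennreal ((l2_norm v)\<^sup>2)"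
      by (simp only: nn_integral_l2_norm[OF sv])
  qed
  also have "\<dots> = ennreal ((l2_norm v)\<^sup>2)" by (rule Liminf_const) simp
  finally have le: "(\<integral>\<^sup>+ \<xi>. ennreal ((norm (fourier_integral v \<xi>))\<^sup>2) \<partial>lborel) \<le> ennreal ((l2_norm v)\<^sup>2)" .
  then show s: "square_integrable (fourier_integral v)"
    by (intro square_integrableI) (auto intro: le_less_trans)
  have "(l2_norm (fourier_integral v))\<^sup>2 \<le> (l2_norm v)\<^sup>2"
    using le unfolding nn_integral_l2_norm[OF s] by (subst (asm) ennreal_le_iff) auto
  then show "l2_norm (fourier_integral v) \<le> l2_norm v"
    by (rule power2_le_imp_le) simp
qed

lemma fourier_integral_diff_ext:
  assumes "integrable lborel u" "integrable lborel v"
  shows "fourier_integral (\<lambda>x. u x - v x) = (\<lambda>\<xi>. fourier_integral u \<xi> - fourier_integral v \<xi>)"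
  using fourier_integral_diff[OF assms] by (simp add: fun_eq_iff)

lemma l2_norm_tendsto:
  fixes f :: "'a::euclidean_space \<Rightarrow> 'b::euclidean_space"
  assumes "\<And>n. square_integrable (F n)" "square_integrable f" "((\<lambda>n. l2_norm (\<lambda>x. F n x - f x)) \<longlongrightarrow> 0) A"
  shows "((\<lambda>n. l2_norm (F n)) \<longlongrightarrow> l2_norm f) A"
proof (rule Lim_transform2[OF tendsto_const])
  show "((\<lambda>n. l2_norm f - l2_norm (F n)) \<longlongrightarrow> 0) A"
    by (rule Lim_null_comparison[OF always_eventually assms(3)])
      (use l2_norm_abs_diff[OF assms(1,2)] in \<open>simp add: abs_minus_commute\<close>)
qed

lemma plancherel_integrable:
  fixes v :: "'a::euclidean_space \<Rightarrow> complex"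
  assumes iv: "integrable lborel v" and sv: "square_integrable v"
  shows "l2_norm (fourier_integral v) = l2_norm v"
proof -
  have [measurable]: "v \<in> borel_measurable borel" using iv by auto
  have ic: "integrable lborel (cutoff n v)" for n
    by (rule Bochner_Integration.integrable_bound[OF iv]) (auto simp: norm_cutoff_le)
  have sc: "square_integrable (cutoff n v)" for n
    by (rule square_integrable_dominated(1)[OF sv, of _ 1]) (auto simp: norm_cutoff_le)
  have c: "(\<lambda>n. l2_norm (\<lambda>x. cutoff n v x - v x)) \<longlonglongrightarrow> 0"
    by (rule l2_dominated_convergence[OF _ _ sv]) (auto simp: norm_diff_cutoff_le cutoff_tendsto)
  have "l2_norm (\<lambda>\<xi>. fourier_integral (cutoff n v) \<xi> - fourier_integral v \<xi>) \<le> l2_norm (\<lambda>x. cutoff n v x - v x)" for n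
    using fourier_integral_L2_bound(2)[OF Bochner_Integration.integrable_diff[OF ic iv] square_integrable_diff(1)[OF sc sv]]
    by (simp only: fourier_integral_diff_ext[OF ic iv])
  then have "(\<lambda>n. l2_norm (\<lambda>\<xi>. fourier_integral (cutoff n v) \<xi> - fourier_integral v \<xi>)) \<longlonglongrightarrow> 0"
    by (intro Lim_null_comparison[OF always_eventually c]) simp
  then have "(\<lambda>n. l2_norm (fourier_integral (cutoff n v))) \<longlonglongrightarrow> l2_norm (fourier_integral v)"
    by (intro l2_norm_tendsto fourier_integral_L2_bound(1) ic sc iv sv)
  moreover have "l2_norm (fourier_integral (cutoff n v)) = l2_norm (cutoff n v)" for n
  proof -
    have "ennreal ((l2_norm (fourier_integral (cutoff n v)))\<^sup>2) = ennreal ((l2_norm (cutoff n v))\<^sup>2)"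
      using plancherel_cutoff[OF \<open>v \<in> borel_measurable borel\<close>, of n]
      unfolding nn_integral_l2_norm[OF sc, of n] nn_integral_l2_norm[OF fourier_integral_L2_bound(1)[OF ic sc], of n] .
    then have "(l2_norm (fourier_integral (cutoff n v)))\<^sup>2 = (l2_norm (cutoff n v))\<^sup>2"
      by (subst (asm) ennreal_inj) auto
    then show ?thesis by (rule power2_eq_imp_eq) auto
  qed
  moreover have "(\<lambda>n. l2_norm (cutoff n v)) \<longlonglongrightarrow> l2_norm v"
    by (rule l2_norm_tendsto[OF sc sv c])
  ultimately have "(\<lambda>n. l2_norm (cutoff n v)) \<longlonglongrightarrow> l2_norm (fourier_integral v)" "(\<lambda>n. l2_norm (cutoff n v)) \<longlonglongrightarrow> l2_norm v"
    by simp_all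
  then show ?thesis by (rule LIMSEQ_unique)
qed

section \<open>The Fourier transform of square integrable functions\<close>

abbreviation restrict_ball :: "real \<Rightarrow> ('a::euclidean_space \<Rightarrow> complex) \<Rightarrow> 'a \<Rightarrow> complex" where
  "restrict_ball R u x \<equiv> indicator (ball 0 R) x *\<^sub>R u x"

lemma fourier_truncated_eq: "fourier_truncated R u = fourier_integral (restrict_ball R u)"
  by (auto simp: fun_eq_iff fourier_truncated_def fourier_integral_def set_lebesgue_integral_def
      intro!: Bochner_Integration.integral_cong)

lemma fourier_truncated_L2:
  assumes u: "square_integrable u"
  shows "square_integrable (fourier_truncated R u)"
    "l2_norm (fourier_truncated R u) = l2_norm (restrict_ball R u)"
  unfolding fourier_truncated_eq
  by (intro fourier_integral_L2_bound(1) plancherel_integrable integrable_restrict_ball square_integrable_restrict u; simp)+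

lemma fourier_truncated_diff:
  assumes u: "square_integrable u" and v: "square_integrable v"
  shows "l2_norm (\<lambda>\<xi>. fourier_truncated R u \<xi> - fourier_truncated S v \<xi>)
    = l2_norm (\<lambda>x. restrict_ball R u x - restrict_ball S v x)"
proof -
  note i = integrable_restrict_ball[OF u, of 0 R] integrable_restrict_ball[OF v, of 0 S]
  have s: "square_integrable (restrict_ball R u)" "square_integrable (restrict_ball S v)"
    by (intro square_integrable_restrict u v; simp)+
  show ?thesis
    using plancherel_integrable[OF Bochner_Integration.integrable_diff[OF i] square_integrable_diff(1)[OF s]]
    by (simp only: fourier_integral_diff_ext[OF i] fourier_truncated_eq)
qed

lemma is_fourier_transform_iff:
  "is_fourier_transform u g \<longleftrightarrow> square_integrable u \<and> square_integrable g \<and>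
     ((\<lambda>R. l2_norm (\<lambda>\<xi>. fourier_truncated R u \<xi> - g \<xi>)) \<longlongrightarrow> 0) at_top"
proof -
  have "((\<lambda>R. \<integral>\<^sup>+ \<xi>. ennreal ((cmod (fourier_truncated R u \<xi> - g \<xi>))\<^sup>2) \<partial>lborel) \<longlongrightarrow> 0) at_top \<longleftrightarrow>
     ((\<lambda>R. l2_norm (\<lambda>\<xi>. fourier_truncated R u \<xi> - g \<xi>)) \<longlongrightarrow> 0) at_top" (is "?A \<longleftrightarrow> ?B")
    if u: "square_integrable u" and g: "square_integrable g"
  proof -
    have "?A \<longleftrightarrow> ((\<lambda>R. ennreal ((l2_norm (\<lambda>\<xi>. fourier_truncated R u \<xi> - g \<xi>))\<^sup>2)) \<longlongrightarrow> ennreal 0) at_top"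
      by (simp add: nn_integral_l2_norm square_integrable_diff(1) fourier_truncated_L2 u g)
    also have "\<dots> \<longleftrightarrow> ((\<lambda>R. (l2_norm (\<lambda>\<xi>. fourier_truncated R u \<xi> - g \<xi>))\<^sup>2) \<longlongrightarrow> 0) at_top"
      by (rule tendsto_ennreal_iff) auto
    also have "\<dots> \<longleftrightarrow> ?B"
    proof
      assume "((\<lambda>R. (l2_norm (\<lambda>\<xi>. fourier_truncated R u \<xi> - g \<xi>))\<^sup>2) \<longlongrightarrow> 0) at_top"
      from tendsto_real_sqrt[OF this] show ?B by simp
    next
      assume ?B
      from tendsto_power[OF this, of 2] show "((\<lambda>R. (l2_norm (\<lambda>\<xi>. fourier_truncated R u \<xi> - g \<xi>))\<^sup>2) \<longlongrightarrow> 0) at_top" by simp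
    qed
    finally show ?thesis .
  qed
  then show ?thesis
    unfolding is_fourier_transform_def by blast
qed

text \<open>By Plancherel the transforms of the truncations differ from each other as much as the truncations
  themselves; they form a Cauchy family, whose limit exists by completeness along integer radii.\<close>

lemma fourier_transform_exists:
  fixes u :: "'a::euclidean_space \<Rightarrow> complex"
  assumes u: "square_integrable u"
  obtains g where "is_fourier_transform u g"
proof -
  let ?r = "\<lambda>R. l2_norm (\<lambda>x. restrict_ball R u x - u x)"
  have rs: "square_integrable (restrict_ball R u)" for R
    by (intro square_integrable_restrict u) simp
  have r: "(?r \<longlongrightarrow> 0) at_top" by (rule l2_truncation[OF u])
  have d: "l2_norm (\<lambda>\<xi>. fourier_truncated R u \<xi> - fourier_truncated S u \<xi>) \<le> ?r R + ?r S" for R S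
    using l2_norm_triangle_diff[OF rs u rs, of R S] l2_norm_minus_commute[of u "restrict_ball S u"]
    by (simp add: fourier_truncated_diff[OF u u])
  have rn: "(\<lambda>n. ?r (real n)) \<longlonglongrightarrow> 0"
    by (rule filterlim_compose[OF r filterlim_real_sequentially])
  obtain g where g: "square_integrable g" "(\<lambda>n. l2_norm (\<lambda>\<xi>. fourier_truncated (real n) u \<xi> - g \<xi>)) \<longlonglongrightarrow> 0"
  proof (rule l2_complete[of "\<lambda>n. fourier_truncated (real n) u"])
    show "square_integrable (fourier_truncated (real n) u)" for n
      by (rule fourier_truncated_L2[OF u])
    fix e :: real assume "0 < e"
    then have "\<forall>\<^sub>F n in sequentially. ?r (real n) < e / 2"
      using rn by (intro order_tendstoD) auto
    then obtain N where N: "\<And>n. N \<le> n \<Longrightarrow> ?r (real n) < e / 2"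
      by (auto simp: eventually_sequentially)
    have "l2_norm (\<lambda>x. fourier_truncated (real m) u x - fourier_truncated (real n) u x) < e" if "N \<le> m" "N \<le> n" for m n
      using d[of "real m" "real n"] N[OF that(1)] N[OF that(2)] by linarith
    then show "\<exists>N. \<forall>m\<ge>N. \<forall>n\<ge>N. l2_norm (\<lambda>x. fourier_truncated (real m) u x - fourier_truncated (real n) u x) < e"
      by blast
  qed blast
  have "((\<lambda>R. l2_norm (\<lambda>\<xi>. fourier_truncated R u \<xi> - g \<xi>)) \<longlongrightarrow> 0) at_top"
  proof (rule tendstoI)
    fix e :: real assume "0 < e"
    have "\<forall>\<^sub>F n in sequentially. ?r (real n) < e / 3"
      using \<open>0 < e\<close> rn by (intro order_tendstoD) auto
    moreover have "\<forall>\<^sub>F n in sequentially. l2_norm (\<lambda>\<xi>. fourier_truncated (real n) u \<xi> - g \<xi>) < e / 3"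
      using \<open>0 < e\<close> g(2) by (intro order_tendstoD) auto
    ultimately have "\<forall>\<^sub>F n in sequentially. ?r (real n) < e / 3 \<and> l2_norm (\<lambda>\<xi>. fourier_truncated (real n) u \<xi> - g \<xi>) < e / 3"
      by (rule eventually_conj)
    then obtain n where n: "?r (real n) < e / 3" "l2_norm (\<lambda>\<xi>. fourier_truncated (real n) u \<xi> - g \<xi>) < e / 3"
      using eventually_sequentially by auto
    have "\<forall>\<^sub>F R in at_top. ?r R < e / 3"
      using \<open>0 < e\<close> r by (intro order_tendstoD) auto
    then show "\<forall>\<^sub>F R in at_top. dist (l2_norm (\<lambda>\<xi>. fourier_truncated R u \<xi> - g \<xi>)) 0 < e"
    proof eventually_elim
      case (elim R)
      then show ?case
        using l2_norm_triangle_diff[OF fourier_truncated_L2(1)[OF u, of R] fourier_truncated_L2(1)[OF u, of "real n"] g(1)]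
          d[of R "real n"] n by (simp add: dist_real_def)
    qed
  qed
  then show ?thesis
    using that u g(1) by (simp add: is_fourier_transform_iff)
qed

lemma is_fourier_transformD:
  assumes "is_fourier_transform u g"
  shows "square_integrable u" "square_integrable g"
    "((\<lambda>R. l2_norm (\<lambda>\<xi>. fourier_truncated R u \<xi> - g \<xi>)) \<longlongrightarrow> 0) at_top"
  using assms by (auto simp: is_fourier_transform_iff)

theorem plancherel:
  assumes "is_fourier_transform u g"
  shows "l2_norm g = l2_norm u"
proof -
  note u = is_fourier_transformD[OF assms]
  have rs: "square_integrable (restrict_ball R u)" for R
    by (intro square_integrable_restrict u) simp
  have "((\<lambda>R. l2_norm (fourier_truncated R u)) \<longlongrightarrow> l2_norm g) at_top"
    by (rule l2_norm_tendsto[OF fourier_truncated_L2(1)[OF u(1)] u(2,3)])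
  moreover have "((\<lambda>R. l2_norm (fourier_truncated R u)) \<longlongrightarrow> l2_norm u) at_top"
    unfolding fourier_truncated_L2(2)[OF u(1)]
    by (rule l2_norm_tendsto[OF rs u(1) l2_truncation[OF u(1)]])
  ultimately show ?thesis
    by (rule tendsto_unique[OF trivial_limit_at_top_linorder])
qed

lemma l2_pairing_tendsto:
  fixes f g :: "'a::euclidean_space \<Rightarrow> complex"
  assumes F: "\<And>n. square_integrable (F n)" and G: "\<And>n. square_integrable (G n)"
    and f: "square_integrable f" and g: "square_integrable g"
    and Ff: "((\<lambda>n. l2_norm (\<lambda>x. F n x - f x)) \<longlongrightarrow> 0) A" and Gg: "((\<lambda>n. l2_norm (\<lambda>x. G n x - g x)) \<longlongrightarrow> 0) A"
  shows "((\<lambda>n. LINT x|lborel. F n x * G n x) \<longlongrightarrow> (LINT x|lborel. f x * g x)) A"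
proof (rule Lim_transform2[OF tendsto_const], rule Lim_null_comparison)
  show "((\<lambda>n. l2_norm (\<lambda>x. F n x - f x) * l2_norm (G n) + l2_norm f * l2_norm (\<lambda>x. G n x - g x)) \<longlongrightarrow> 0) A"
    using tendsto_add[OF tendsto_mult[OF Ff l2_norm_tendsto[OF G g Gg]] tendsto_mult[OF tendsto_const[of "l2_norm f"] Gg]] by simp
  show "\<forall>\<^sub>F n in A. norm ((LINT x|lborel. f x * g x) - (LINT x|lborel. F n x * G n x))
      \<le> l2_norm (\<lambda>x. F n x - f x) * l2_norm (G n) + l2_norm f * l2_norm (\<lambda>x. G n x - g x)"
  proof (intro always_eventually allI)
    fix n
    note dF = square_integrable_diff(1)[OF F[of n] f] and dG = square_integrable_diff(1)[OF G[of n] g]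
    have "(LINT x|lborel. F n x * G n x) - (LINT x|lborel. f x * g x) = (LINT x|lborel. F n x * G n x - f x * g x)"
      by (intro Bochner_Integration.integral_diff[symmetric] l2_pairing(1) F G f g)
    also have "\<dots> = (LINT x|lborel. (F n x - f x) * G n x + f x * (G n x - g x))"
      by (simp add: algebra_simps)
    also have "\<dots> = (LINT x|lborel. (F n x - f x) * G n x) + (LINT x|lborel. f x * (G n x - g x))"
      by (intro Bochner_Integration.integral_add l2_pairing(1) dF dG G f)
    finally have "norm ((LINT x|lborel. F n x * G n x) - (LINT x|lborel. f x * g x))
        \<le> norm (LINT x|lborel. (F n x - f x) * G n x) + norm (LINT x|lborel. f x * (G n x - g x))"
      by (simp only: norm_triangle_ineq)
    also have "\<dots> \<le> l2_norm (\<lambda>x. F n x - f x) * l2_norm (G n) + l2_norm f * l2_norm (\<lambda>x. G n x - g x)"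
      by (intro add_mono l2_pairing(2) dF dG G f)
    finally show "norm ((LINT x|lborel. f x * g x) - (LINT x|lborel. F n x * G n x))
      \<le> l2_norm (\<lambda>x. F n x - f x) * l2_norm (G n) + l2_norm f * l2_norm (\<lambda>x. G n x - g x)"
      by (subst norm_minus_commute)
  qed
qed

lemma fourier_transform_diff:
  assumes u: "is_fourier_transform u g" and v: "is_fourier_transform v h"
  shows "is_fourier_transform (\<lambda>x. u x - v x) (\<lambda>\<xi>. g \<xi> - h \<xi>)"
  unfolding is_fourier_transform_iff
proof (intro conjI square_integrable_diff(1))
  note U = is_fourier_transformD[OF u] and V = is_fourier_transformD[OF v]
  show "square_integrable u" "square_integrable v" "square_integrable g" "square_integrable h"
    using U V by auto
  have eq: "fourier_truncated R (\<lambda>x. u x - v x) = (\<lambda>\<xi>. fourier_truncated R u \<xi> - fourier_truncated R v \<xi>)" for R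
    unfolding fourier_truncated_eq scaleR_diff_right
    by (rule fourier_integral_diff_ext[OF integrable_restrict_ball[OF U(1)] integrable_restrict_ball[OF V(1)]])
  show "((\<lambda>R. l2_norm (\<lambda>\<xi>. fourier_truncated R (\<lambda>x. u x - v x) \<xi> - (g \<xi> - h \<xi>))) \<longlongrightarrow> 0) at_top"
  proof (rule Lim_null_comparison[OF always_eventually])
    show "((\<lambda>R. l2_norm (\<lambda>\<xi>. fourier_truncated R u \<xi> - g \<xi>) + l2_norm (\<lambda>\<xi>. fourier_truncated R v \<xi> - h \<xi>)) \<longlongrightarrow> 0) at_top"
      using tendsto_add[OF U(3) V(3)] by simp
    show "\<forall>R. norm (l2_norm (\<lambda>\<xi>. fourier_truncated R (\<lambda>x. u x - v x) \<xi> - (g \<xi> - h \<xi>)))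
        \<le> l2_norm (\<lambda>\<xi>. fourier_truncated R u \<xi> - g \<xi>) + l2_norm (\<lambda>\<xi>. fourier_truncated R v \<xi> - h \<xi>)"
    proof
      fix R
      have "l2_norm (\<lambda>\<xi>. (fourier_truncated R u \<xi> - g \<xi>) - (fourier_truncated R v \<xi> - h \<xi>))
          \<le> l2_norm (\<lambda>\<xi>. fourier_truncated R u \<xi> - g \<xi>) + l2_norm (\<lambda>\<xi>. fourier_truncated R v \<xi> - h \<xi>)"
        by (intro square_integrable_diff(2) square_integrable_diff(1) fourier_truncated_L2(1) U V)
      then show "norm (l2_norm (\<lambda>\<xi>. fourier_truncated R (\<lambda>x. u x - v x) \<xi> - (g \<xi> - h \<xi>)))
        \<le> l2_norm (\<lambda>\<xi>. fourier_truncated R u \<xi> - g \<xi>) + l2_norm (\<lambda>\<xi>. fourier_truncated R v \<xi> - h \<xi>)"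
        unfolding eq by (simp add: algebra_simps)
    qed
  qed
qed

lemma fourier_transform_uminus:
  assumes v: "is_fourier_transform v h"
  shows "is_fourier_transform (\<lambda>x. - v x) (\<lambda>\<xi>. - h \<xi>)"
  using fourier_transform_diff[OF fourier_transform_diff[OF v v] v] by simp

lemma fourier_transform_add:
  assumes u: "is_fourier_transform u g" and v: "is_fourier_transform v h"
  shows "is_fourier_transform (\<lambda>x. u x + v x) (\<lambda>\<xi>. g \<xi> + h \<xi>)"
  using fourier_transform_diff[OF u fourier_transform_uminus[OF v]] by simp

text \<open>One equivalence contains both facts that are needed: the transform determines the function, and the
  function determines the transform, up to null sets.\<close>

lemma fourier_transform_unique:
  assumes "is_fourier_transform u g" and "is_fourier_transform v h"
  shows "(AE x in lborel. u x = v x) \<longleftrightarrow> (AE \<xi> in lborel. g \<xi> = h \<xi>)"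
proof -
  note d = fourier_transform_diff[OF assms]
  have "l2_norm (\<lambda>\<xi>. g \<xi> - h \<xi>) = l2_norm (\<lambda>x. u x - v x)"
    by (rule plancherel[OF d])
  then show ?thesis
    using l2_norm_eq_0_iff[OF is_fourier_transformD(1)[OF d]] l2_norm_eq_0_iff[OF is_fourier_transformD(2)[OF d]]
    by simp
qed

lemma fourier_transform_cong_AE:
  assumes ug: "is_fourier_transform u g"
    and [measurable]: "v \<in> borel_measurable borel" "h \<in> borel_measurable borel"
    and uv: "AE x in lborel. u x = v x" and gh: "AE \<xi> in lborel. g \<xi> = h \<xi>"
  shows "is_fourier_transform v (h :: 'a::euclidean_space \<Rightarrow> complex)"
proof -
  note U = is_fourier_transformD[OF ug]
  have [measurable]: "u \<in> borel_measurable borel" "g \<in> borel_measurable borel"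
    using U(1,2) by (auto simp: square_integrable_measurable)
  have v: "square_integrable v"
    by (rule square_integrable_dominated(1)[OF U(1), of _ 1], simp_all)
      (use uv in eventually_elim, simp)
  have h: "square_integrable h"
    by (rule square_integrable_dominated(1)[OF U(2), of _ 1], simp_all)
      (use gh in eventually_elim, simp)
  have eq: "fourier_truncated R v = fourier_truncated R u" for R
    unfolding fourier_truncated_eq fourier_integral_def
  proof (intro ext arg_cong[where f="(*) _"] integral_cong_AE)
    fix \<xi>
    show "AE x in lborel. iexp_neg (\<xi> \<bullet> x) * restrict_ball R v x = iexp_neg (\<xi> \<bullet> x) * restrict_ball R u x"
      using uv by eventually_elim simp
    have m: "restrict_ball R w \<in> borel_measurable borel" if "w \<in> borel_measurable borel" for w :: "'a \<Rightarrow> complex"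
      using that by (intro borel_measurable_scaleR borel_measurable_indicator) auto
    have e: "(\<lambda>x. iexp_neg (\<xi> \<bullet> x)) \<in> borel_measurable borel"
      by measurable
    show "(\<lambda>x. iexp_neg (\<xi> \<bullet> x) * restrict_ball R v x) \<in> borel_measurable lborel"
      "(\<lambda>x. iexp_neg (\<xi> \<bullet> x) * restrict_ball R u x) \<in> borel_measurable lborel"
      unfolding measurable_lborel2 by (intro borel_measurable_times e m; measurable)+
  qed
  have "l2_norm (\<lambda>\<xi>. fourier_truncated R v \<xi> - h \<xi>) = l2_norm (\<lambda>\<xi>. fourier_truncated R u \<xi> - g \<xi>)" for R
    unfolding eq
  proof (rule l2_norm_cong_AE)
    have [measurable]: "fourier_truncated R u \<in> borel_measurable borel"
      by (rule square_integrable_measurable[OF fourier_truncated_L2(1)[OF U(1)]])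
    show "(\<lambda>\<xi>. fourier_truncated R u \<xi> - h \<xi>) \<in> borel_measurable borel"
      "(\<lambda>\<xi>. fourier_truncated R u \<xi> - g \<xi>) \<in> borel_measurable borel"
      by measurable
    show "AE \<xi> in lborel. norm (fourier_truncated R u \<xi> - h \<xi>) = norm (fourier_truncated R u \<xi> - g \<xi>)"
      using gh by eventually_elim simp
  qed
  then show ?thesis
    using U(3) v h by (simp add: is_fourier_transform_iff)
qed

lemma fourier_transform_mult:
  assumes u: "is_fourier_transform u g" and v: "is_fourier_transform v h"
  shows "(LINT \<xi>|lborel. g \<xi> * v \<xi>) = (LINT x|lborel. u x * h x)"
proof -
  note U = is_fourier_transformD[OF u] and V = is_fourier_transformD[OF v]
  have s: "square_integrable (restrict_ball R u)" "square_integrable (restrict_ball R v)" for R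
    by (intro square_integrable_restrict U V; simp)+
  have eq: "(LINT \<xi>|lborel. fourier_truncated R u \<xi> * restrict_ball R v \<xi>) = (LINT x|lborel. restrict_ball R u x * fourier_truncated R v x)" for R
    unfolding fourier_truncated_eq
    by (rule fourier_integral_mult[OF integrable_restrict_ball[OF U(1)] integrable_restrict_ball[OF V(1)]])
  have "((\<lambda>R. LINT \<xi>|lborel. fourier_truncated R u \<xi> * restrict_ball R v \<xi>) \<longlongrightarrow> (LINT \<xi>|lborel. g \<xi> * v \<xi>)) at_top"
    by (intro l2_pairing_tendsto fourier_truncated_L2(1) U V s l2_truncation)
  moreover have "((\<lambda>R. LINT x|lborel. restrict_ball R u x * fourier_truncated R v x) \<longlongrightarrow> (LINT x|lborel. u x * h x)) at_top"
    by (intro l2_pairing_tendsto fourier_truncated_L2(1) U V s l2_truncation)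
  ultimately show ?thesis
    unfolding eq by (rule tendsto_unique[OF trivial_limit_at_top_linorder])
qed

lemma square_integrable_cnj:
  assumes "square_integrable u"
  shows "square_integrable (\<lambda>x. cnj (u x))" "l2_norm (\<lambda>x. cnj (u x)) = l2_norm u"
  using square_integrable_cong[OF assms, of "\<lambda>x. cnj (u x)"] square_integrable_measurable[OF assms]
  by (auto intro: l2_norm_cong)

text \<open>Let \<open>k\<close> be the transform of \<open>cnj \<circ> g\<close>. By the multiplication formula \<open>\<integral> k * u = \<integral> cnj g * g\<close>, and
  \<open>k\<close>, \<open>u\<close>, \<open>g\<close> have the same norm. Expanding the square, \<open>\<parallel>k - cnj u\<parallel>\<^sup>2 = \<parallel>k\<parallel>\<^sup>2 + \<parallel>u\<parallel>\<^sup>2 - 2 Re \<integral> k * u = 0\<close>.\<close>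

theorem fourier_inversion:
  assumes u: "is_fourier_transform u g"
  shows "is_fourier_transform (\<lambda>x. cnj (g x)) (\<lambda>x. cnj (u x))"
proof -
  note U = is_fourier_transformD[OF u]
  obtain k where k: "is_fourier_transform (\<lambda>x. cnj (g x)) k"
    by (rule fourier_transform_exists[OF square_integrable_cnj(1)[OF U(2)]])
  note K = is_fourier_transformD[OF k]
  have nk: "l2_norm k = l2_norm u"
    using plancherel[OF k] plancherel[OF u] square_integrable_cnj(2)[OF U(2)] by simp
  have "(LINT x|lborel. k x * u x) = (LINT x|lborel. cnj (g x) * g x)"
    by (rule fourier_transform_mult[OF k u])
  also have "\<dots> = (LINT x|lborel. complex_of_real ((norm (g x))\<^sup>2))"
    by (intro Bochner_Integration.integral_cong refl) (subst complex_norm_square, simp)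
  also have "\<dots> = complex_of_real ((l2_norm u)\<^sup>2)"
    by (simp only: integral_complex_of_real l2_norm_power2[symmetric] plancherel[OF u])
  finally have ku: "(LINT x|lborel. k x * u x) = complex_of_real ((l2_norm u)\<^sup>2)" .
  have iku: "integrable lborel (\<lambda>x. k x * u x)"
    by (rule l2_pairing(1)[OF K(2) U(1)])
  have eq: "(norm (a - cnj b))\<^sup>2 = (norm a)\<^sup>2 + (norm b)\<^sup>2 - 2 * Re (a * b)" for a b
    unfolding cmod_power2 by (simp add: power2_eq_square algebra_simps)
  have "(l2_norm (\<lambda>x. k x - cnj (u x)))\<^sup>2 = (LINT x|lborel. (norm (k x))\<^sup>2 + (norm (u x))\<^sup>2 - 2 * Re (k x * u x))"
    unfolding l2_norm_power2 eq ..
  also have "\<dots> = (l2_norm k)\<^sup>2 + (l2_norm u)\<^sup>2 - 2 * (LINT x|lborel. Re (k x * u x))"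
    unfolding l2_norm_power2
    using square_integrable_integrable[OF K(2)] square_integrable_integrable[OF U(1)] integrable_Re[OF iku]
    by (simp del: times_complex.sel)
  also have "(LINT x|lborel. Re (k x * u x)) = (l2_norm u)\<^sup>2"
    using ku iku by (subst integral_Re[OF iku]) simp
  also have "(l2_norm k)\<^sup>2 + (l2_norm u)\<^sup>2 - 2 * (l2_norm u)\<^sup>2 = 0"
    by (simp add: nk)
  finally have "l2_norm (\<lambda>x. k x - cnj (u x)) = 0" by simp
  then have "AE x in lborel. k x = cnj (u x)"
    by (subst (asm) l2_norm_eq_0_iff) (auto intro!: square_integrable_diff(1) K square_integrable_cnj U)
  then show ?thesis
    using square_integrable_measurable[OF K(1)] square_integrable_measurable[OF square_integrable_cnj(1)[OF U(1)]]
    by (intro fourier_transform_cong_AE[OF k]) auto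
qed

lemma fourier_transform_surj:
  assumes "square_integrable g"
  obtains w where "is_fourier_transform w g"
proof -
  obtain k where "is_fourier_transform (\<lambda>x. cnj (g x)) k"
    by (rule fourier_transform_exists[OF square_integrable_cnj(1)[OF assms]])
  from fourier_inversion[OF this] show ?thesis
    by (intro that[of "\<lambda>x. cnj (k x)"]) simp
qed

text \<open>Modulation is compatible with truncation to balls, so the rule holds for every truncation exactly.\<close>

lemma fourier_transform_modulate:
  assumes u: "is_fourier_transform u g"
  shows "is_fourier_transform (\<lambda>x. iexp (h \<bullet> x) * u x) (\<lambda>\<xi>. g (\<xi> - h))"
  unfolding is_fourier_transform_iff
proof (intro conjI)
  note U = is_fourier_transformD[OF u]
  have [measurable]: "u \<in> borel_measurable borel" by (rule square_integrable_measurable[OF U(1)])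
  show "square_integrable (\<lambda>x. iexp (h \<bullet> x) * u x)"
  proof (rule square_integrable_cong[OF U(1)])
    show "norm (u x) = norm (iexp (h \<bullet> x) * u x)" for x
      by (simp add: norm_mult)
  qed measurable
  show "square_integrable (\<lambda>\<xi>. g (\<xi> - h))"
    using square_integrable_translate(1)[OF U(2), of "- h"] by simp
  have eq: "fourier_truncated R (\<lambda>x. iexp (h \<bullet> x) * u x) \<xi> = fourier_truncated R u (\<xi> - h)" for R \<xi>
  proof -
    have "iexp_neg (\<xi> \<bullet> x) * iexp (h \<bullet> x) = iexp_neg ((\<xi> - h) \<bullet> x)" for x
      by (subst exp_add[symmetric]) (simp add: inner_diff_left right_diff_distrib)
    then show ?thesis
      unfolding fourier_truncated_def by (simp only: mult.assoc[symmetric])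
  qed
  have "l2_norm (\<lambda>\<xi>. fourier_truncated R u (\<xi> - h) - g (\<xi> - h)) = l2_norm (\<lambda>\<xi>. fourier_truncated R u \<xi> - g \<xi>)" for R
    using square_integrable_translate(2)[OF square_integrable_diff(1)[OF fourier_truncated_L2(1)[OF U(1)] U(2)], of R "- h"]
    by simp
  then show "((\<lambda>R. l2_norm (\<lambda>\<xi>. fourier_truncated R (\<lambda>x. iexp (h \<bullet> x) * u x) \<xi> - g (\<xi> - h))) \<longlongrightarrow> 0) at_top"
    using U(3) by (simp add: eq)
qed

text \<open>A translated ball is no longer centred at the origin, so translation does not commute with
  truncation. Inverting twice reduces the claim to modulation.\<close>

lemma fourier_transform_translate:
  assumes u: "is_fourier_transform u g"
  shows "is_fourier_transform (\<lambda>x. u (x + h)) (\<lambda>\<xi>. iexp (h \<bullet> \<xi>) * g \<xi>)"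
proof -
  have e: "cnj (iexp t) = iexp (- t)" for t
    using exp_cnj[of "\<i> * complex_of_real t"] by simp
  show ?thesis
    using fourier_inversion[OF fourier_transform_modulate[OF fourier_inversion[OF u], of "- h"]]
    by (simp only: complex_cnj_mult complex_cnj_cnj e inner_minus_left minus_minus diff_minus_eq_add)
qed

lemma l2_norm_reflect:
  fixes f :: "'a::euclidean_space \<Rightarrow> complex"
  assumes f: "square_integrable f"
  shows "square_integrable (\<lambda>x. f (- x))" "l2_norm (\<lambda>x. f (- x)) = l2_norm f"
proof -
  have [measurable]: "f \<in> borel_measurable borel" by (rule square_integrable_measurable[OF f])
  have eq: "(\<integral>\<^sup>+ x. ennreal ((norm (f (- x)))\<^sup>2) \<partial>lborel) = ennreal ((l2_norm f)\<^sup>2)"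
    using nn_integral_lborel_reflect[of "\<lambda>x. ennreal ((norm (f x))\<^sup>2)" 0] by (simp add: nn_integral_l2_norm[OF f])
  then show s: "square_integrable (\<lambda>x. f (- x))"
    by (intro square_integrableI) auto
  show "l2_norm (\<lambda>x. f (- x)) = l2_norm f"
    using eq unfolding nn_integral_l2_norm[OF s] by (subst (asm) ennreal_inj) (auto intro: power2_eq_imp_eq)
qed

lemma fourier_transform_cnj:
  assumes u: "is_fourier_transform u g"
  shows "is_fourier_transform (\<lambda>x. cnj (u x)) (\<lambda>\<xi>. cnj (g (- \<xi>)))"
  unfolding is_fourier_transform_iff
proof (intro conjI)
  note U = is_fourier_transformD[OF u]
  show "square_integrable (\<lambda>x. cnj (u x))" "square_integrable (\<lambda>\<xi>. cnj (g (- \<xi>)))"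
    by (intro square_integrable_cnj l2_norm_reflect U)+
  have eq: "fourier_truncated R (\<lambda>x. cnj (u x)) \<xi> = cnj (fourier_truncated R u (- \<xi>))" for R \<xi>
  proof -
    have "cnj (iexp_neg ((- \<xi>) \<bullet> x)) = iexp_neg (\<xi> \<bullet> x)" for x
      using exp_cnj[of "- \<i> * complex_of_real ((- \<xi>) \<bullet> x)"] by simp
    then show ?thesis
      unfolding fourier_truncated_def set_lebesgue_integral_def
      by (simp only: complex_cnj_mult complex_cnj_complex_of_real Bochner_Integration.integral_cnj[symmetric] complex_cnj_scaleR)
  qed
  have "l2_norm (\<lambda>\<xi>. cnj (fourier_truncated R u (- \<xi>)) - cnj (g (- \<xi>))) = l2_norm (\<lambda>\<xi>. fourier_truncated R u \<xi> - g \<xi>)" for R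
    using l2_norm_reflect[OF square_integrable_diff(1)[OF fourier_truncated_L2(1)[OF U(1)] U(2)], of R]
      square_integrable_cnj(2)[OF l2_norm_reflect(1)[OF square_integrable_diff(1)[OF fourier_truncated_L2(1)[OF U(1)] U(2)]], of R]
    by simp
  then show "((\<lambda>R. l2_norm (\<lambda>\<xi>. fourier_truncated R (\<lambda>x. cnj (u x)) \<xi> - cnj (g (- \<xi>)))) \<longlongrightarrow> 0) at_top"
    using U(3) by (simp add: eq)
qed

section \<open>Radial symmetry of the Gagliardo kernel\<close>

text \<open>The argument for uniqueness of Haar measure: with \<open>f\<close> the indicator of the unit ball, which \<open>T\<close>
  preserves, evaluate the double integral of \<open>f (T x) * g y\<close> after the substitutions
  \<open>y \<mapsto> T x + y\<close> and \<open>x \<mapsto> x - T y\<close>. Both sides carry the volume of the ball as a factor.\<close>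

lemma nn_integral_lborel_isometry:
  fixes T :: "'a::euclidean_space \<Rightarrow> 'a"
  assumes T: "linear T" "\<And>x. norm (T x) = norm x" "\<And>x. T (T x) = x"
    and g[measurable]: "g \<in> borel_measurable borel"
  shows "(\<integral>\<^sup>+ x. g (T x) \<partial>lborel) = (\<integral>\<^sup>+ x. g x \<partial>lborel)"
proof -
  have [measurable]: "T \<in> borel_measurable borel"
    by (intro borel_measurable_continuous_onI linear_continuous_on) (simp add: T(1) linear_conv_bounded_linear[symmetric])
  define f :: "'a \<Rightarrow> ennreal" where "f = indicator (ball 0 1)"
  have [measurable]: "f \<in> borel_measurable borel" by (auto simp: f_def intro!: borel_measurable_indicator)
  define V where "V = (\<integral>\<^sup>+ x. f x \<partial>lborel)"
  have V: "V = emeasure lborel (ball (0::'a) 1)" by (simp add: V_def f_def)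
  have fT: "f (T x) = f x" for x by (simp add: f_def indicator_def T(2))
  have "V * (\<integral>\<^sup>+ y. g y \<partial>lborel) = (\<integral>\<^sup>+ x. f (T x) * (\<integral>\<^sup>+ y. g y \<partial>lborel) \<partial>lborel)"
    by (simp add: V_def fT nn_integral_multc)
  also have "\<dots> = (\<integral>\<^sup>+ x. (\<integral>\<^sup>+ y. f (T x) * g (T x + y) \<partial>lborel) \<partial>lborel)"
    by (simp add: nn_integral_cmult nn_integral_lborel_translate)
  also have "\<dots> = (\<integral>\<^sup>+ y. (\<integral>\<^sup>+ x. f (T x) * g (T x + y) \<partial>lborel) \<partial>lborel)"
    by (rule lborel_pair.Fubini') measurable
  also have "\<dots> = (\<integral>\<^sup>+ y. (\<integral>\<^sup>+ x. f (T x - y) * g (T x) \<partial>lborel) \<partial>lborel)"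
  proof (rule nn_integral_cong)
    fix y
    have "(\<integral>\<^sup>+ x. f (T (- T y + x)) * g (T (- T y + x) + y) \<partial>lborel) = (\<integral>\<^sup>+ x. f (T x) * g (T x + y) \<partial>lborel)"
      by (rule nn_integral_lborel_translate) measurable
    moreover have "T (- T y + x) = T x - y" for x
      using T by (simp add: linear_add linear_neg linear_diff)
    ultimately show "(\<integral>\<^sup>+ x. f (T x) * g (T x + y) \<partial>lborel) = (\<integral>\<^sup>+ x. f (T x - y) * g (T x) \<partial>lborel)" by simp
  qed
  also have "\<dots> = (\<integral>\<^sup>+ x. (\<integral>\<^sup>+ y. f (T x - y) * g (T x) \<partial>lborel) \<partial>lborel)"
    by (rule lborel_pair.Fubini') measurable
  also have "\<dots> = (\<integral>\<^sup>+ x. V * g (T x) \<partial>lborel)"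
    by (simp add: nn_integral_multc nn_integral_lborel_reflect V_def)
  also have "\<dots> = V * (\<integral>\<^sup>+ x. g (T x) \<partial>lborel)"
    by (simp add: nn_integral_cmult)
  finally have "V * (\<integral>\<^sup>+ y. g y \<partial>lborel) = V * (\<integral>\<^sup>+ x. g (T x) \<partial>lborel)" .
  moreover have "V \<noteq> 0" "V \<noteq> top"
  proof -
    have "unit_ball_vol (real DIM('a)) \<noteq> 0"
      using unit_ball_vol_pos[of "real DIM('a)"] by linarith
    then show "V \<noteq> 0" "V \<noteq> top" unfolding V by (simp_all add: emeasure_ball)
  qed
  ultimately show ?thesis
    by (simp add: ennreal_mult_cancel_left)
qed

text \<open>Reflection in the hyperplane orthogonal to \<open>w\<close> (the identity for \<open>w = 0\<close>). Such reflections
  act transitively on spheres, which turns isometry invariance into radial symmetry.\<close>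

definition householder :: "'a::euclidean_space \<Rightarrow> 'a \<Rightarrow> 'a" where
  "householder w x = x - (2 * (x \<bullet> w) / (w \<bullet> w)) *\<^sub>R w"

lemma linear_householder: "linear (householder w)"
  by (rule linearI) (auto simp: householder_def inner_add_left algebra_simps add_divide_distrib)

lemma householder_inner: "householder w x \<bullet> y = x \<bullet> householder w y"
  by (simp add: householder_def inner_diff_left inner_diff_right inner_commute)

lemma householder_involution: "householder w (householder w x) = x"
  by (cases "w = 0") (auto simp: householder_def inner_diff_left algebra_simps diff_divide_distrib simp flip: scaleR_add_left)

lemma norm_householder: "norm (householder w x) = norm x"
  by (simp add: norm_eq_sqrt_inner householder_inner householder_involution)

lemma householder_swap:
  assumes "norm a = norm b"
  shows "householder (a - b) a = b"
proof (cases "a = b")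
  case False
  have "a \<bullet> a = b \<bullet> b" using assms by (simp add: norm_eq_sqrt_inner)
  then have "2 * (a \<bullet> (a - b)) = (a - b) \<bullet> (a - b)"
    by (simp add: inner_diff_left inner_diff_right inner_commute)
  then show ?thesis using False by (simp add: householder_def)
qed (simp add: householder_def)

text \<open>The Fourier symbol of the Gagliardo energy: translation by \<open>h\<close> multiplies the transform by
  \<open>iexp (h \<bullet> \<xi>)\<close>, and the kernel integrates the squared differences over all \<open>h\<close>.\<close>

definition gagliardo_symbol :: "real \<Rightarrow> 'a::euclidean_space \<Rightarrow> ennreal" where
  "gagliardo_symbol s \<xi> = (\<integral>\<^sup>+ h. ennreal ((norm (iexp (h \<bullet> \<xi>) - 1))\<^sup>2 / norm h powr (real DIM('a) + 2 * s)) \<partial>lborel)"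

lemma gagliardo_symbol_radial:
  fixes \<xi> \<eta> :: "'a::euclidean_space"
  assumes "norm \<xi> = norm \<eta>"
  shows "gagliardo_symbol s \<xi> = gagliardo_symbol s \<eta>"
proof -
  let ?T = "householder (\<xi> - \<eta>)"
  let ?g = "\<lambda>h::'a. ennreal ((norm (iexp (h \<bullet> \<xi>) - 1))\<^sup>2 / norm h powr (real DIM('a) + 2 * s))"
  have "gagliardo_symbol s \<xi> = (\<integral>\<^sup>+ h. ?g (?T h) \<partial>lborel)"
    unfolding gagliardo_symbol_def
    by (rule nn_integral_lborel_isometry[symmetric]) (auto simp: linear_householder norm_householder householder_involution)
  also have "\<dots> = gagliardo_symbol s \<eta>"
    unfolding gagliardo_symbol_def norm_householder householder_inner householder_swap[OF assms] ..
  finally show ?thesis .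
qed

lemma gagliardo_symbol_scale:
  fixes \<xi> :: "'a::euclidean_space"
  assumes "0 < t"
  shows "gagliardo_symbol s (t *\<^sub>R \<xi>) = ennreal (t powr (2 * s)) * gagliardo_symbol s \<xi>"
proof -
  let ?a = "real DIM('a) + 2 * s"
  let ?n = "\<lambda>h. (norm (iexp (h \<bullet> \<xi>) - 1))\<^sup>2"
  let ?f = "\<lambda>h::'a. ennreal ((norm (iexp (h \<bullet> (t *\<^sub>R \<xi>)) - 1))\<^sup>2 / norm h powr ?a)"
  have "gagliardo_symbol s (t *\<^sub>R \<xi>) = ennreal (\<bar>1 / t\<bar> ^ DIM('a)) * (\<integral>\<^sup>+ h. ?f (0 + (1 / t) *\<^sub>R h) \<partial>lborel)"
    unfolding gagliardo_symbol_def by (rule nn_integral_lborel_affine) (use assms in auto)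
  also have "\<dots> = (\<integral>\<^sup>+ h. ennreal (\<bar>1 / t\<bar> ^ DIM('a)) * ?f (0 + (1 / t) *\<^sub>R h) \<partial>lborel)"
    by (rule nn_integral_cmult[symmetric]) measurable
  also have "\<dots> = (\<integral>\<^sup>+ h. ennreal (t powr (2 * s)) * ennreal (?n h / norm h powr ?a) \<partial>lborel)"
  proof (intro nn_integral_cong)
    fix h :: 'a
    have cancel: "(1 / T) * (n / (H / (T * S))) = S * (n / H)" if "0 < T" "0 < S" for T S n H :: real
      using that by (cases "H = 0") (simp_all add: field_simps)
    have "\<bar>1 / t\<bar> ^ DIM('a) = 1 / t powr real DIM('a)"
      using assms by (simp add: powr_realpow power_one_over)
    moreover have "norm ((1 / t) *\<^sub>R h) powr ?a = norm h powr ?a / (t powr real DIM('a) * t powr (2 * s))"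
    proof -
      have "norm ((1 / t) *\<^sub>R h) = norm h / t" using assms by simp
      then have "norm ((1 / t) *\<^sub>R h) powr ?a = norm h powr ?a / t powr ?a"
        using assms by (simp only: powr_divide norm_ge_zero less_imp_le)
      then show ?thesis by (simp only: powr_add)
    qed
    ultimately have "\<bar>1 / t\<bar> ^ DIM('a) * (?n h / norm ((1 / t) *\<^sub>R h) powr ?a) = t powr (2 * s) * (?n h / norm h powr ?a)"
      using assms by (simp only: cancel powr_gt_zero)
    then show "ennreal (\<bar>1 / t\<bar> ^ DIM('a)) * ?f (0 + (1 / t) *\<^sub>R h) = ennreal (t powr (2 * s)) * ennreal (?n h / norm h powr ?a)"
      using assms by (simp add: ennreal_mult'[symmetric] flip: ennreal_mult'')
  qed
  also have "\<dots> = ennreal (t powr (2 * s)) * gagliardo_symbol s \<xi>"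
    unfolding gagliardo_symbol_def by (rule nn_integral_cmult) measurable
  finally show ?thesis .
qed

section \<open>Integrability of the truncated Gagliardo kernel\<close>

lemma powr_frac_of_pow2_le:
  fixes r a :: real
  assumes "r > 0" "0 < a" "(1/2) ^ Suc k \<le> r"
  shows "1 / r powr a \<le> (2 powr a) ^ Suc k"
proof -
  have "(2 powr a) ^ Suc k = 2 powr (a * real (Suc k))"
    by (subst powr_realpow[symmetric]) (auto simp only: powr_powr powr_gt_zero)
  also have "\<dots> = (2 ^ Suc k) powr a"
    by (subst powr_realpow[symmetric]) (simp_all add: powr_powr mult.commute)
  finally have eq: "(2 powr a) ^ Suc k = (2 ^ Suc k) powr a" .
  have "1 / r \<le> 2 ^ Suc k"
    using assms by (simp add: field_simps power_one_over)
  then have "(1 / r) powr a \<le> (2 ^ Suc k) powr a"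
    using assms by (intro powr_mono2) auto
  then show ?thesis
    unfolding eq using assms by (simp add: powr_divide)
qed

lemma nn_integral_weighted_balls_finite:
  fixes c r :: "nat \<Rightarrow> real"
  assumes "\<And>k. 0 \<le> c k" "\<And>k. 0 \<le> r k"
    and "summable (\<lambda>k. c k * r k ^ DIM('a::euclidean_space))"
  shows "(\<integral>\<^sup>+ h. (\<Sum>k. ennreal (c k) * indicator (ball 0 (r k)) h) \<partial>(lborel :: 'a measure)) < \<infinity>"
proof -
  let ?V = "unit_ball_vol (real DIM('a))"
  have "(\<integral>\<^sup>+ h. (\<Sum>k. ennreal (c k) * indicator (ball 0 (r k)) h) \<partial>(lborel :: 'a measure))
      = (\<Sum>k. \<integral>\<^sup>+ h. ennreal (c k) * indicator (ball 0 (r k)) h \<partial>(lborel :: 'a measure))"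
    by (rule nn_integral_suminf) (auto intro!: borel_measurable_times_ennreal borel_measurable_indicator)
  also have "\<dots> = (\<Sum>k. ennreal (?V * (c k * r k ^ DIM('a))))"
    using assms(1,2)
    by (intro suminf_cong) (simp add: nn_integral_cmult_indicator emeasure_ball ennreal_mult'[symmetric] mult_ac)
  also have "\<dots> < \<infinity>"
    using assms by (subst suminf_ennreal2) (auto intro!: summable_mult mult_nonneg_nonneg)
  finally show ?thesis .
qed

text \<open>At a point of the shell \<open>2\<^sup>k \<le> |h| < 2\<^bsup>k+1\<^esup>\<close> the kernel is bounded by its size on the inner sphere,
  hence by a multiple of the indicator of the ball of radius \<open>2\<^bsup>k+1\<^esup>\<close>. Summing over all shells gives two
  geometric series, with ratios \<open>2\<^bsup>-2s\<^esup>\<close> for the shells outside the unit ball and \<open>2\<^bsup>2s-2\<^esup>\<close> for those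
  inside; this is where \<open>0 < s < 1\<close> enters.\<close>

lemma truncated_kernel_integrable:
  fixes s :: real
  assumes "0 < s" "s < 1"
  shows "(\<integral>\<^sup>+ h. ennreal (min 1 ((norm h)\<^sup>2) / norm h powr (real DIM('a) + 2 * s)) \<partial>(lborel :: 'a::euclidean_space measure)) < \<infinity>"
proof -
  let ?N = "DIM('a)"
  let ?a = "real ?N + 2 * s"
  define c1 r1 c2 r2 where "c1 k = (2 powr (- ?a)) ^ k" and "r1 k = (2::real) ^ Suc k"
    and "c2 k = ((1/4)::real) ^ k * (2 powr ?a) ^ Suc k" and "r2 k = ((1/2)::real) ^ k" for k :: nat
  let ?S = "\<lambda>c r h. (\<Sum>k. ennreal (c k) * indicator (ball (0::'a) (r k)) h)"
  have a0: "0 < ?a" using assms by simp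
  have le_S: "ennreal (c k) \<le> ?S c r h" if "h \<in> ball 0 (r k)" for c r :: "nat \<Rightarrow> real" and h :: 'a and k
  proof -
    have "ennreal (c k) = (\<Sum>j\<in>{k}. ennreal (c j) * indicator (ball 0 (r j)) h)" using that by simp
    also have "\<dots> \<le> ?S c r h" by (rule sum_le_suminf) auto
    finally show ?thesis .
  qed
  have le: "ennreal (min 1 ((norm h)\<^sup>2) / norm h powr ?a) \<le> ?S c1 r1 h + ?S c2 r2 h" for h :: 'a
  proof (cases "h = 0")
    case True then show ?thesis by simp
  next
    case False
    then have n0: "0 < norm h" by simp
    show ?thesis
    proof (cases "1 \<le> norm h")
      case True
      \<comment> \<open>the least exponent with \<open>norm h < 2 ^ Suc k\<close> satisfies \<open>2 ^ k \<le> norm h\<close>\<close>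
      define k where "k = (LEAST k. norm h < 2 ^ Suc k)"
      obtain m where "norm h < 2 ^ m" using real_arch_pow[of 2 "norm h"] by auto
      also have "(2::real) ^ m \<le> 2 ^ Suc m" by simp
      finally have "norm h < 2 ^ Suc m" .
      then have k1: "norm h < 2 ^ Suc k" unfolding k_def by (rule LeastI)
      have k2: "2 ^ k \<le> norm h"
      proof (cases k)
        case (Suc j)
        then have "\<not> norm h < 2 ^ Suc j" unfolding k_def by (intro not_less_Least) auto
        then show ?thesis using Suc by simp
      qed (use True in simp)
      have "min 1 ((norm h)\<^sup>2) / norm h powr ?a \<le> 1 / norm h powr ?a"
        by (intro divide_right_mono) auto
      also have "\<dots> \<le> 1 / (2 ^ k) powr ?a"
        using k2 a0 n0 by (intro divide_left_mono powr_mono2) auto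
      also have "\<dots> = c1 k"
        unfolding c1_def by (simp add: powr_realpow[symmetric] powr_powr powr_minus_divide[symmetric] algebra_simps)
      finally have "ennreal (min 1 ((norm h)\<^sup>2) / norm h powr ?a) \<le> ennreal (c1 k)" by (rule ennreal_leI)
      also have "\<dots> \<le> ?S c1 r1 h" by (rule le_S) (use k1 in \<open>simp add: r1_def\<close>)
      finally show ?thesis by (simp add: add_increasing2)
    next
      case False
      define k where "k = (LEAST k. (1/2) ^ Suc k \<le> norm h)"
      obtain m where "(1/2) ^ m < norm h" using real_arch_pow_inv[of "norm h" "1/2"] n0 by auto
      moreover have "(1/2::real) ^ Suc m \<le> (1/2) ^ m" by simp
      ultimately have "(1/2) ^ Suc m \<le> norm h" by linarith
      then have k1: "(1/2) ^ Suc k \<le> norm h" unfolding k_def by (rule LeastI)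
      have k2: "norm h < (1/2) ^ k"
      proof (cases k)
        case (Suc j)
        then have "\<not> (1/2) ^ Suc j \<le> norm h" unfolding k_def by (intro not_less_Least) auto
        then show ?thesis using Suc by simp
      qed (use False in simp)
      have "min 1 ((norm h)\<^sup>2) / norm h powr ?a \<le> (norm h)\<^sup>2 * (1 / norm h powr ?a)"
        by (simp add: divide_right_mono)
      also have "\<dots> \<le> ((1/2) ^ k)\<^sup>2 * (2 powr ?a) ^ Suc k"
        using k2 by (intro mult_mono power_mono powr_frac_of_pow2_le n0 a0 k1) auto
      also have "\<dots> = c2 k"
        unfolding c2_def by (simp add: power2_eq_square flip: power_mult_distrib)
      finally have "ennreal (min 1 ((norm h)\<^sup>2) / norm h powr ?a) \<le> ennreal (c2 k)" by (rule ennreal_leI)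
      also have "\<dots> \<le> ?S c2 r2 h" by (rule le_S) (use k2 in \<open>simp add: r2_def\<close>)
      finally show ?thesis by (simp add: add_increasing)
    qed
  qed
  have N2: "(2::real) ^ ?N = 2 powr real ?N" by (simp add: powr_realpow)
  have p1: "c1 k * r1 k ^ ?N = 2 powr real ?N * (2 powr (- 2 * s)) ^ k" for k
  proof -
    have "r1 k ^ ?N = (2 ^ ?N) ^ Suc k"
      unfolding r1_def by (simp only: power_mult[symmetric] mult.commute)
    then have "c1 k * r1 k ^ ?N = 2 powr real ?N * ((2 powr (- ?a)) ^ k * (2 powr real ?N) ^ k)"
      unfolding c1_def N2 by simp
    also have "(2 powr (- ?a)) ^ k * (2 powr real ?N) ^ k = (2 powr (- ?a) * 2 powr real ?N) ^ k"
      by (rule power_mult_distrib[symmetric])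
    also have "2 powr (- ?a) * 2 powr real ?N = 2 powr (- 2 * s)"
      by (subst powr_add[symmetric]) simp
    finally show ?thesis .
  qed
  have p2: "c2 k * r2 k ^ ?N = 2 powr ?a * (2 powr (2 * s - 2)) ^ k" for k
  proof -
    have "r2 k ^ ?N = ((1/2) ^ ?N) ^ k"
      unfolding r2_def by (simp only: power_mult[symmetric] mult.commute)
    then have "c2 k * r2 k ^ ?N = 2 powr ?a * ((1/4) ^ k * (2 powr ?a) ^ k * ((1/2) ^ ?N) ^ k)"
      unfolding c2_def by simp
    also have "(1/4) ^ k * (2 powr ?a) ^ k * ((1/2) ^ ?N) ^ k = ((1/4) * 2 powr ?a * (1/2) ^ ?N) ^ k"
      by (simp only: power_mult_distrib)
    also have "(1/4) * 2 powr ?a * (1/2) ^ ?N = 2 powr (2 * s - 2)"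
      by (simp add: power_one_over N2 powr_add powr_diff)
    finally show ?thesis .
  qed
  have "(\<integral>\<^sup>+ h. ?S c1 r1 h \<partial>(lborel :: 'a measure)) < \<infinity>"
  proof (rule nn_integral_weighted_balls_finite)
    have "(2::real) powr (- 2 * s) < 2 powr 0" using assms by (intro powr_less_mono) auto
    then show "summable (\<lambda>k. c1 k * r1 k ^ DIM('a))"
      unfolding p1 by (intro summable_mult summable_geometric) auto
  qed (auto simp: c1_def r1_def)
  moreover have "(\<integral>\<^sup>+ h. ?S c2 r2 h \<partial>(lborel :: 'a measure)) < \<infinity>"
  proof (rule nn_integral_weighted_balls_finite)
    have "(2::real) powr (2 * s - 2) < 2 powr 0" using assms by (intro powr_less_mono) auto
    then show "summable (\<lambda>k. c2 k * r2 k ^ DIM('a))"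
      unfolding p2 by (intro summable_mult summable_geometric) auto
  qed (auto simp: c2_def r2_def)
  moreover have "(\<integral>\<^sup>+ h. ennreal (min 1 ((norm h)\<^sup>2) / norm h powr ?a) \<partial>(lborel :: 'a measure))
      \<le> (\<integral>\<^sup>+ h. ?S c1 r1 h + ?S c2 r2 h \<partial>(lborel :: 'a measure))"
    by (intro nn_integral_mono le)
  moreover have "(\<integral>\<^sup>+ h. ?S c1 r1 h + ?S c2 r2 h \<partial>(lborel :: 'a measure)) = (\<integral>\<^sup>+ h. ?S c1 r1 h \<partial>(lborel :: 'a measure)) + (\<integral>\<^sup>+ h. ?S c2 r2 h \<partial>(lborel :: 'a measure))"
    by (intro nn_integral_add) (auto intro!: borel_measurable_suminf_order borel_measurable_times_ennreal borel_measurable_indicator)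
  ultimately show ?thesis by (auto simp: less_top[symmetric] top_unique)
qed

lemma norm_iexp_minus_one_le: "norm (iexp t - 1) \<le> 2" "norm (iexp t - 1) \<le> \<bar>t\<bar>"
proof -
  show "norm (iexp t - 1) \<le> 2"
    using norm_triangle_ineq4[of "iexp t" 1] by simp
  show "norm (iexp t - 1) \<le> \<bar>t\<bar>"
    using iexp_approx1[of t 0] by simp
qed

text \<open>Interpolation between the bounds \<open>2\<close> and \<open>|t|\<close>. The first form gives the translation estimate, the
  second one the finiteness of the symbol.\<close>

lemma norm_iexp_minus_one_power2_le:
  assumes "0 \<le> s" "s \<le> 1"
  shows "(norm (iexp t - 1))\<^sup>2 \<le> 4 * \<bar>t\<bar> powr (2 * s)"
    and "(norm (iexp t - 1))\<^sup>2 \<le> 4 * min 1 (t\<^sup>2)"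
proof -
  have 4: "(norm (iexp t - 1))\<^sup>2 \<le> 2\<^sup>2"
    by (intro power_mono norm_iexp_minus_one_le) auto
  have t2: "(norm (iexp t - 1))\<^sup>2 \<le> \<bar>t\<bar>\<^sup>2"
    by (intro power_mono norm_iexp_minus_one_le) auto
  show "(norm (iexp t - 1))\<^sup>2 \<le> 4 * min 1 (t\<^sup>2)"
  proof (cases "t\<^sup>2 \<le> 1")
    case True
    then have "min 1 (t\<^sup>2) = t\<^sup>2" by simp
    then show ?thesis using t2 zero_le_power2[of t] unfolding power2_abs by linarith
  qed (use 4 in \<open>simp add: min_def\<close>)
  show "(norm (iexp t - 1))\<^sup>2 \<le> 4 * \<bar>t\<bar> powr (2 * s)"
  proof (cases "1 \<le> \<bar>t\<bar>")
    case True
    have "1 \<le> \<bar>t\<bar> powr (2 * s)" using True assms by (intro ge_one_powr_ge_zero) auto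
    then show ?thesis using 4 by simp
  next
    case False
    show ?thesis
    proof (cases "t = 0")
      case False
      have "\<bar>t\<bar>\<^sup>2 = \<bar>t\<bar> powr 2" using False by (simp add: powr_realpow[of _ 2, symmetric])
      also have "\<dots> \<le> \<bar>t\<bar> powr (2 * s)"
        using assms \<open>\<not> 1 \<le> \<bar>t\<bar>\<close> by (intro powr_mono') auto
      finally show ?thesis using t2 powr_ge_zero[of "\<bar>t\<bar>" "2 * s"] by linarith
    qed simp
  qed
qed

text \<open>By radial symmetry and scaling the value of the symbol at one unit vector determines it.\<close>

definition gagliardo_constant :: "'a::euclidean_space itself \<Rightarrow> real \<Rightarrow> real" where
  "gagliardo_constant _ s = enn2real (gagliardo_symbol s (SOME b. b \<in> (Basis :: 'a set)))"

lemma gagliardo_symbol_eq: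
  assumes s: "0 < s" "s < 1"
  shows "gagliardo_symbol s (\<xi>::'a::euclidean_space) = ennreal (gagliardo_constant TYPE('a) s * norm \<xi> powr (2 * s))"
    and "0 < gagliardo_constant TYPE('a) s"
proof -
  define e where "e = (SOME b. b \<in> (Basis :: 'a set))"
  have e: "norm e = 1" using SOME_Basis by (simp add: e_def)
  let ?a = "real DIM('a) + 2 * s"
  have "gagliardo_symbol s e \<le> (\<integral>\<^sup>+ h. ennreal 4 * ennreal (min 1 ((norm h)\<^sup>2) / norm h powr ?a) \<partial>(lborel :: 'a measure))"
    unfolding gagliardo_symbol_def
  proof (rule nn_integral_mono)
    fix h :: 'a
    have "(h \<bullet> e)\<^sup>2 \<le> (norm h)\<^sup>2"
      using Cauchy_Schwarz_ineq2[of h e] e by (simp add: abs_le_square_iff[symmetric])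
    then have "(norm (iexp (h \<bullet> e) - 1))\<^sup>2 \<le> 4 * min 1 ((norm h)\<^sup>2)"
      using norm_iexp_minus_one_power2_le(2)[of 0 "h \<bullet> e"] by (auto simp: min_def split: if_splits)
    then show "ennreal ((norm (iexp (h \<bullet> e) - 1))\<^sup>2 / norm h powr ?a) \<le> ennreal 4 * ennreal (min 1 ((norm h)\<^sup>2) / norm h powr ?a)"
      by (subst ennreal_mult[symmetric]) (auto intro!: ennreal_leI divide_right_mono)
  qed
  also have "\<dots> = ennreal 4 * (\<integral>\<^sup>+ h. ennreal (min 1 ((norm h)\<^sup>2) / norm h powr ?a) \<partial>(lborel :: 'a measure))"
    by (rule nn_integral_cmult) measurable
  also have "\<dots> < \<infinity>"
    using truncated_kernel_integrable[OF s, where 'a='a] by (simp add: ennreal_mult_less_top)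
  finally have "gagliardo_symbol s e < \<infinity>" .
  then have K: "gagliardo_symbol s e = ennreal (gagliardo_constant TYPE('a) s)"
    by (simp add: gagliardo_constant_def e_def)
  have K0: "0 \<le> gagliardo_constant TYPE('a) s" by (simp add: gagliardo_constant_def)
  show "gagliardo_symbol s \<xi> = ennreal (gagliardo_constant TYPE('a) s * norm \<xi> powr (2 * s))"
  proof (cases "\<xi> = 0")
    case False
    have "gagliardo_symbol s \<xi> = gagliardo_symbol s (norm \<xi> *\<^sub>R e)"
      by (rule gagliardo_symbol_radial) (simp add: e)
    also have "\<dots> = ennreal (norm \<xi> powr (2 * s)) * gagliardo_symbol s e"
      by (rule gagliardo_symbol_scale) (use False in simp)
    finally show ?thesis unfolding K using K0 by (simp add: ennreal_mult'[symmetric] mult.commute flip: ennreal_mult'')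
  qed (simp add: gagliardo_symbol_def)
  have "gagliardo_symbol s e \<noteq> 0"
  proof
    assume 0: "gagliardo_symbol s e = 0"
    have "AE h in lborel. ennreal ((norm (iexp (h \<bullet> e) - 1))\<^sup>2 / norm h powr ?a) = 0"
      using 0 unfolding gagliardo_symbol_def by (subst (asm) nn_integral_0_iff_AE) measurable
    then have ae: "AE h in lborel. h \<notin> {h. 0 < h \<bullet> e \<and> h \<bullet> e < 1}"
    proof eventually_elim
      case (elim h)
      show ?case
      proof
        assume h: "h \<in> {h. 0 < h \<bullet> e \<and> h \<bullet> e < 1}"
        then have "h \<noteq> 0" by auto
        then have "iexp (h \<bullet> e) = 1"
          using elim by (auto simp: ennreal_eq_0_iff divide_le_0_iff)
        then have "sin (h \<bullet> e) = 0"
          by (metis cis_conv_exp cis.sel(2) one_complex.sel(2))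
        then show False using h sin_gt_zero[of "h \<bullet> e"] pi_gt3 by auto
      qed
    qed
    have "open {h. 0 < h \<bullet> e \<and> h \<bullet> e < 1}"
      by (intro open_Collect_conj open_Collect_less continuous_intros)
    moreover have "(1/2) *\<^sub>R e \<in> {h. 0 < h \<bullet> e \<and> h \<bullet> e < 1}"
      using e by (simp add: dot_square_norm)
    ultimately obtain r where r: "0 < r" "ball ((1/2) *\<^sub>R e) r \<subseteq> {h. 0 < h \<bullet> e \<and> h \<bullet> e < 1}"
      using openE by blast
    have "AE h in lborel. h \<notin> ball ((1/2) *\<^sub>R e) r"
      using ae by eventually_elim (use r in auto)
    then have "emeasure lborel (ball ((1/2) *\<^sub>R e) r) = 0"
      using AE_iff_null_sets[of "ball ((1/2) *\<^sub>R e) r" lborel] by auto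
    moreover have "unit_ball_vol (real DIM('a)) \<noteq> 0"
      using unit_ball_vol_pos[of "real DIM('a)"] by linarith
    ultimately show False using r by (simp add: emeasure_ball)
  qed
  then show "0 < gagliardo_constant TYPE('a) s"
    using K K0 by (cases "gagliardo_constant TYPE('a) s = 0") auto
qed

section \<open>The Gagliardo energy as a Fourier integral\<close>

lemma measurable_gagliardo_integrand [measurable]:
  assumes [measurable]: "u \<in> borel_measurable borel"
  shows "gagliardo_integrand s u \<in> borel_measurable (lborel \<Otimes>\<^sub>M lborel)"
  unfolding gagliardo_integrand_def by measurable

lemma gagliardo_integrand_nonneg: "0 \<le> gagliardo_integrand s u z"
  by (auto simp: gagliardo_integrand_def split: prod.split)

text \<open>Substituting \<open>y = x + h\<close> separates the difference \<open>h\<close>, on which the Gagliardo kernel depends, from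
  the base point \<open>x\<close>, in which everything is translation invariant.\<close>

lemma nn_integral_shear:
  fixes f :: "'a::euclidean_space \<Rightarrow> 'a \<Rightarrow> ennreal"
  assumes [measurable]: "(\<lambda>(x, y). f x y) \<in> borel_measurable (borel \<Otimes>\<^sub>M borel)"
  shows "(\<integral>\<^sup>+ z. f (fst z) (snd z) \<partial>(lborel \<Otimes>\<^sub>M lborel)) = (\<integral>\<^sup>+ h. (\<integral>\<^sup>+ x. f x (x + h) \<partial>lborel) \<partial>lborel)"
proof -
  have "(\<integral>\<^sup>+ z. f (fst z) (snd z) \<partial>(lborel \<Otimes>\<^sub>M lborel)) = (\<integral>\<^sup>+ x. (\<integral>\<^sup>+ y. f x y \<partial>lborel) \<partial>lborel)"
    by (subst lborel.nn_integral_fst[symmetric]) (simp_all add: split_beta')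
  also have "\<dots> = (\<integral>\<^sup>+ x. (\<integral>\<^sup>+ h. f x (x + h) \<partial>lborel) \<partial>lborel)"
    by (rule nn_integral_cong, rule nn_integral_lborel_translate[symmetric]) measurable
  also have "\<dots> = (\<integral>\<^sup>+ h. (\<integral>\<^sup>+ x. f x (x + h) \<partial>lborel) \<partial>lborel)"
    by (rule lborel_pair.Fubini'[symmetric]) measurable
  finally show ?thesis .
qed

lemma nn_integral_translation_difference:
  fixes u :: "'a::euclidean_space \<Rightarrow> real"
  assumes u: "is_fourier_transform (\<lambda>x. complex_of_real (u x)) g"
  shows "(\<integral>\<^sup>+ x. ennreal ((u (x + h) - u x)\<^sup>2) \<partial>lborel)
    = (\<integral>\<^sup>+ \<xi>. ennreal ((norm (iexp (h \<bullet> \<xi>) - 1))\<^sup>2 * (norm (g \<xi>))\<^sup>2) \<partial>lborel)"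
proof -
  note d = fourier_transform_diff[OF fourier_transform_translate[OF u, of h] u]
  have "ennreal ((l2_norm (\<lambda>x. complex_of_real (u (x + h)) - complex_of_real (u x)))\<^sup>2)
      = ennreal ((l2_norm (\<lambda>\<xi>. iexp (h \<bullet> \<xi>) * g \<xi> - g \<xi>))\<^sup>2)"
    by (simp only: plancherel[OF d])
  then have "(\<integral>\<^sup>+ x. ennreal ((norm (complex_of_real (u (x + h)) - complex_of_real (u x)))\<^sup>2) \<partial>lborel)
      = (\<integral>\<^sup>+ \<xi>. ennreal ((norm (iexp (h \<bullet> \<xi>) * g \<xi> - g \<xi>))\<^sup>2) \<partial>lborel)"
    by (simp only: nn_integral_l2_norm[OF is_fourier_transformD(1)[OF d]] nn_integral_l2_norm[OF is_fourier_transformD(2)[OF d]])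
  moreover have "(norm (complex_of_real (u (x + h)) - complex_of_real (u x)))\<^sup>2 = (u (x + h) - u x)\<^sup>2" for x
    by (simp flip: of_real_diff)
  moreover have "(norm (iexp (h \<bullet> \<xi>) * g \<xi> - g \<xi>))\<^sup>2
      = (norm (iexp (h \<bullet> \<xi>) - 1))\<^sup>2 * (norm (g \<xi>))\<^sup>2" for \<xi>
  proof -
    have "iexp (h \<bullet> \<xi>) * g \<xi> - g \<xi> = (iexp (h \<bullet> \<xi>) - 1) * g \<xi>"
      by (simp add: left_diff_distrib)
    then show ?thesis by (simp only: norm_mult power_mult_distrib)
  qed
  ultimately show ?thesis by simp
qed

text \<open>For each \<open>h\<close> the squared norm of \<open>u (\<cdot> + h) - u\<close> is computed by Plancherel. Integrating against the kernel
  and exchanging the order of integration leaves the symbol, which is a multiple of \<open>|\<xi>|\<^bsup>2s\<^esup>\<close>.\<close>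

theorem gagliardo_energy_fourier:
  fixes u :: "'a::euclidean_space \<Rightarrow> real"
  assumes s: "0 < s" "s < 1" and u: "is_fourier_transform (\<lambda>x. complex_of_real (u x)) g"
    and [measurable]: "u \<in> borel_measurable borel"
  shows "(\<integral>\<^sup>+ z. ennreal (gagliardo_integrand s u z) \<partial>(lborel \<Otimes>\<^sub>M lborel))
    = ennreal (gagliardo_constant TYPE('a) s) * (\<integral>\<^sup>+ \<xi>. ennreal ((norm \<xi> powr s * norm (g \<xi>))\<^sup>2) \<partial>lborel)"
proof -
  let ?a = "real DIM('a) + 2 * s"
  let ?e = "\<lambda>h \<xi>. (norm (iexp (h \<bullet> \<xi>) - 1))\<^sup>2"
  have [measurable]: "g \<in> borel_measurable borel"
    by (rule square_integrable_measurable[OF is_fourier_transformD(2)[OF u]])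
  have "(\<integral>\<^sup>+ z. ennreal (gagliardo_integrand s u z) \<partial>(lborel \<Otimes>\<^sub>M lborel))
      = (\<integral>\<^sup>+ z. ennreal (\<bar>u (fst z) - u (snd z)\<bar>\<^sup>2 / norm (fst z - snd z) powr ?a) \<partial>(lborel \<Otimes>\<^sub>M lborel))"
    by (simp add: gagliardo_integrand_def split_beta')
  also have "\<dots> = (\<integral>\<^sup>+ h. (\<integral>\<^sup>+ x. ennreal (\<bar>u x - u (x + h)\<bar>\<^sup>2 / norm (x - (x + h)) powr ?a) \<partial>lborel) \<partial>lborel)"
    by (rule nn_integral_shear) measurable
  also have "\<dots> = (\<integral>\<^sup>+ h. (\<integral>\<^sup>+ x. ennreal ((u (x + h) - u x)\<^sup>2) * ennreal (1 / norm h powr ?a) \<partial>lborel) \<partial>lborel)"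
  proof (rule nn_integral_cong, rule nn_integral_cong)
    fix h x
    show "ennreal (\<bar>u x - u (x + h)\<bar>\<^sup>2 / norm (x - (x + h)) powr ?a) = ennreal ((u (x + h) - u x)\<^sup>2) * ennreal (1 / norm h powr ?a)"
      by (subst ennreal_mult[symmetric]) (auto simp: power2_commute)
  qed
  also have "\<dots> = (\<integral>\<^sup>+ h. (\<integral>\<^sup>+ x. ennreal ((u (x + h) - u x)\<^sup>2) \<partial>lborel) * ennreal (1 / norm h powr ?a) \<partial>lborel)"
    by (rule nn_integral_cong, rule nn_integral_multc) measurable
  also have "\<dots> = (\<integral>\<^sup>+ h. (\<integral>\<^sup>+ \<xi>. ennreal (?e h \<xi> * (norm (g \<xi>))\<^sup>2) \<partial>lborel) * ennreal (1 / norm h powr ?a) \<partial>lborel)"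
    unfolding nn_integral_translation_difference[OF u] ..
  also have "\<dots> = (\<integral>\<^sup>+ h. (\<integral>\<^sup>+ \<xi>. ennreal (?e h \<xi> * (norm (g \<xi>))\<^sup>2) * ennreal (1 / norm h powr ?a) \<partial>lborel) \<partial>lborel)"
    by (rule nn_integral_cong, rule nn_integral_multc[symmetric]) measurable
  also have "\<dots> = (\<integral>\<^sup>+ \<xi>. (\<integral>\<^sup>+ h. ennreal (?e h \<xi> * (norm (g \<xi>))\<^sup>2) * ennreal (1 / norm h powr ?a) \<partial>lborel) \<partial>lborel)"
    by (rule lborel_pair.Fubini'[symmetric]) measurable
  also have "\<dots> = (\<integral>\<^sup>+ \<xi>. (\<integral>\<^sup>+ h. ennreal (?e h \<xi> / norm h powr ?a) * ennreal ((norm (g \<xi>))\<^sup>2) \<partial>lborel) \<partial>lborel)"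
    by (rule nn_integral_cong, rule nn_integral_cong) (simp add: ennreal_mult[symmetric])
  also have "\<dots> = (\<integral>\<^sup>+ \<xi>. gagliardo_symbol s \<xi> * ennreal ((norm (g \<xi>))\<^sup>2) \<partial>lborel)"
    unfolding gagliardo_symbol_def by (rule nn_integral_cong, rule nn_integral_multc) measurable
  also have "\<dots> = (\<integral>\<^sup>+ \<xi>. ennreal (gagliardo_constant TYPE('a) s) * ennreal ((norm \<xi> powr s * norm (g \<xi>))\<^sup>2) \<partial>lborel)"
  proof (rule nn_integral_cong)
    fix \<xi> :: 'a
    have "norm \<xi> powr (2 * s) = (norm \<xi> powr s)\<^sup>2"
      by (simp add: power2_eq_square flip: powr_add)
    then show "gagliardo_symbol s \<xi> * ennreal ((norm (g \<xi>))\<^sup>2) = ennreal (gagliardo_constant TYPE('a) s) * ennreal ((norm \<xi> powr s * norm (g \<xi>))\<^sup>2)"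
      using gagliardo_symbol_eq(2)[OF s, where 'a='a]
      unfolding gagliardo_symbol_eq(1)[OF s]
      by (simp add: ennreal_mult[symmetric] power_mult_distrib mult.assoc)
  qed
  also have "\<dots> = ennreal (gagliardo_constant TYPE('a) s) * (\<integral>\<^sup>+ \<xi>. ennreal ((norm \<xi> powr s * norm (g \<xi>))\<^sup>2) \<partial>lborel)"
    by (rule nn_integral_cmult) measurable
  finally show ?thesis .
qed

section \<open>Fractional Sobolev functions\<close>

abbreviation energy :: "real \<Rightarrow> ('a::euclidean_space \<Rightarrow> real) \<Rightarrow> real" where
  "energy s u \<equiv> (gagliardo_seminorm s u)\<^sup>2"

lemma gagliardo_seminorm_nonneg [simp]: "0 \<le> gagliardo_seminorm s u"
  by (simp add: gagliardo_seminorm_def gagliardo_integrand_nonneg)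

lemma energy_eq: "energy s u = (LINT z|(lborel \<Otimes>\<^sub>M lborel). gagliardo_integrand s u z)"
  by (simp add: gagliardo_seminorm_def gagliardo_integrand_nonneg)

lemma sobolevD:
  assumes "u \<in> sobolev s"
  shows "square_integrable u" "integrable (lborel \<Otimes>\<^sub>M lborel) (gagliardo_integrand s u)"
    "u \<in> borel_measurable borel"
  using assms by (auto simp: sobolev_def square_integrable_def)

lemma nn_integral_energy:
  assumes "u \<in> sobolev s"
  shows "(\<integral>\<^sup>+ z. ennreal (gagliardo_integrand s u z) \<partial>(lborel \<Otimes>\<^sub>M lborel)) = ennreal (energy s u)"
  unfolding energy_eq
  by (rule nn_integral_eq_integral[OF sobolevD(2)[OF assms]]) (simp add: gagliardo_integrand_nonneg)

lemma sobolevI: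
  assumes u: "square_integrable u"
    and fin: "(\<integral>\<^sup>+ z. ennreal (gagliardo_integrand s u z) \<partial>(lborel \<Otimes>\<^sub>M lborel)) < \<infinity>"
  shows "u \<in> sobolev s"
  using assms square_integrable_measurable[OF u]
  by (auto simp: sobolev_def gagliardo_integrand_nonneg intro!: integrableI_bounded)

lemma gagliardo_integrand_lincomb:
  "gagliardo_integrand s (\<lambda>x. a * u x + b * v x) z
    \<le> 2 * a\<^sup>2 * gagliardo_integrand s u z + 2 * b\<^sup>2 * gagliardo_integrand s v z"
proof -
  obtain x y where z: "z = (x, y)" by (cases z)
  let ?K = "norm (x - y) powr (real DIM('a) + 2 * s)"
  have "0 \<le> (a * (u x - u y) - b * (v x - v y))\<^sup>2" by simp
  then have "(a * (u x - u y) + b * (v x - v y))\<^sup>2 \<le> 2 * a\<^sup>2 * (u x - u y)\<^sup>2 + 2 * b\<^sup>2 * (v x - v y)\<^sup>2"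
    by (simp add: power2_eq_square algebra_simps)
  then have "(a * (u x - u y) + b * (v x - v y))\<^sup>2 / ?K \<le> (2 * a\<^sup>2 * (u x - u y)\<^sup>2 + 2 * b\<^sup>2 * (v x - v y)\<^sup>2) / ?K"
    by (rule divide_right_mono) simp
  then show ?thesis
    by (simp add: z gagliardo_integrand_def add_divide_distrib algebra_simps)
qed

lemma sobolev_lincomb:
  assumes u: "u \<in> sobolev s" and v: "v \<in> sobolev s"
  shows "(\<lambda>x. a * u x + b * v x) \<in> sobolev s"
proof -
  note U = sobolevD[OF u] and V = sobolevD[OF v]
  have [measurable]: "u \<in> borel_measurable borel" "v \<in> borel_measurable borel" by (rule U V)+
  have "square_integrable (\<lambda>x. a * u x + b * v x)"
    by (intro square_integrable_add(1) square_integrable_mult_left U V)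
  moreover have "integrable (lborel \<Otimes>\<^sub>M lborel) (gagliardo_integrand s (\<lambda>x. a * u x + b * v x))"
  proof (rule Bochner_Integration.integrable_bound)
    show "integrable (lborel \<Otimes>\<^sub>M lborel) (\<lambda>z. 2 * a\<^sup>2 * gagliardo_integrand s u z + 2 * b\<^sup>2 * gagliardo_integrand s v z)"
      by (intro Bochner_Integration.integrable_add integrable_mult_right U V)
    have "norm (gagliardo_integrand s (\<lambda>x. a * u x + b * v x) z)
        \<le> norm (2 * a\<^sup>2 * gagliardo_integrand s u z + 2 * b\<^sup>2 * gagliardo_integrand s v z)" for z
      using order_trans[OF gagliardo_integrand_lincomb abs_ge_self] gagliardo_integrand_nonneg[of s "\<lambda>x. a * u x + b * v x" z]
      by simp
    then show "AE z in lborel \<Otimes>\<^sub>M lborel. norm (gagliardo_integrand s (\<lambda>x. a * u x + b * v x) z)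
        \<le> norm (2 * a\<^sup>2 * gagliardo_integrand s u z + 2 * b\<^sup>2 * gagliardo_integrand s v z)" by simp
  qed measurable
  ultimately show ?thesis by (simp add: sobolev_def)
qed

lemma sobolev_add: "u \<in> sobolev s \<Longrightarrow> v \<in> sobolev s \<Longrightarrow> (\<lambda>x. u x + v x) \<in> sobolev s"
  and sobolev_diff: "u \<in> sobolev s \<Longrightarrow> v \<in> sobolev s \<Longrightarrow> (\<lambda>x. u x - v x) \<in> sobolev s"
  using sobolev_lincomb[of u s v 1 1] sobolev_lincomb[of u s v 1 "-1"] by simp_all

lemma energy_scale: "energy s (\<lambda>x. c * u x) = c\<^sup>2 * energy s u"
proof -
  have "gagliardo_integrand s (\<lambda>x. c * u x) z = c\<^sup>2 * gagliardo_integrand s u z" for z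
    by (simp add: gagliardo_integrand_def split_beta' power_mult_distrib flip: right_diff_distrib)
  then show ?thesis by (simp add: energy_eq)
qed

lemma energy_parallelogram:
  assumes u: "u \<in> sobolev s" and v: "v \<in> sobolev s"
  shows "energy s (\<lambda>x. u x + v x) + energy s (\<lambda>x. u x - v x) = 2 * energy s u + 2 * energy s v"
proof -
  have "gagliardo_integrand s (\<lambda>x. u x + v x) z + gagliardo_integrand s (\<lambda>x. u x - v x) z
      = 2 * gagliardo_integrand s u z + 2 * gagliardo_integrand s v z" for z
  proof -
    have "(\<bar>u x + v x - (u y + v y)\<bar>)\<^sup>2 + (\<bar>u x - v x - (u y - v y)\<bar>)\<^sup>2 = 2 * \<bar>u x - u y\<bar>\<^sup>2 + 2 * \<bar>v x - v y\<bar>\<^sup>2" for x y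
      by (simp add: power2_eq_square algebra_simps)
    then show ?thesis
      by (simp add: gagliardo_integrand_def split_beta' flip: add_divide_distrib)
  qed
  then have "(LINT z|(lborel \<Otimes>\<^sub>M lborel). gagliardo_integrand s (\<lambda>x. u x + v x) z + gagliardo_integrand s (\<lambda>x. u x - v x) z)
      = (LINT z|(lborel \<Otimes>\<^sub>M lborel). 2 * gagliardo_integrand s u z + 2 * gagliardo_integrand s v z)" by simp
  then show ?thesis
    using sobolevD(2)[OF u] sobolevD(2)[OF v] sobolevD(2)[OF sobolev_add[OF u v]] sobolevD(2)[OF sobolev_diff[OF u v]]
    by (simp add: energy_eq)
qed

lemma square_integrable_complex_of_real:
  assumes "square_integrable u"
  shows "square_integrable (\<lambda>x. complex_of_real (u x))"
proof (rule square_integrable_cong[OF assms])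
  have [measurable]: "u \<in> borel_measurable borel" by (rule square_integrable_measurable[OF assms])
  show "(\<lambda>x. complex_of_real (u x)) \<in> borel_measurable borel" by measurable
qed simp

lemma energy_multiplier:
  fixes u :: "'a::euclidean_space \<Rightarrow> real"
  assumes s: "0 < s" "s < 1" and u: "u \<in> sobolev s"
    and g: "is_fourier_transform (\<lambda>x. complex_of_real (u x)) g"
  shows "square_integrable (\<lambda>\<xi>. complex_of_real (norm \<xi> powr s) * g \<xi>)"
    and "energy s u = gagliardo_constant TYPE('a) s * (l2_norm (\<lambda>\<xi>. complex_of_real (norm \<xi> powr s) * g \<xi>))\<^sup>2"
proof -
  note k0 = gagliardo_symbol_eq(2)[OF s, where 'a='a]
  have [measurable]: "g \<in> borel_measurable borel"
    by (rule square_integrable_measurable[OF is_fourier_transformD(2)[OF g]])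
  have eq: "ennreal (energy s u) = ennreal (gagliardo_constant TYPE('a) s)
      * (\<integral>\<^sup>+ \<xi>. ennreal ((norm (complex_of_real (norm \<xi> powr s) * g \<xi>))\<^sup>2) \<partial>lborel)"
    using gagliardo_energy_fourier[OF s g sobolevD(3)[OF u]] nn_integral_energy[OF u] by (simp add: norm_mult)
  show sq: "square_integrable (\<lambda>\<xi>. complex_of_real (norm \<xi> powr s) * g \<xi>)"
  proof (rule square_integrableI)
    show "(\<integral>\<^sup>+ \<xi>. ennreal ((norm (complex_of_real (norm \<xi> powr s) * g \<xi>))\<^sup>2) \<partial>lborel) < \<infinity>"
    proof (rule ccontr)
      assume "\<not> ?thesis"
      then have "(\<integral>\<^sup>+ \<xi>. ennreal ((norm (complex_of_real (norm \<xi> powr s) * g \<xi>))\<^sup>2) \<partial>lborel) = \<infinity>"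
        by (simp add: less_top[symmetric])
      then show False using eq k0 by (simp add: ennreal_mult_top)
    qed
  qed measurable
  show "energy s u = gagliardo_constant TYPE('a) s * (l2_norm (\<lambda>\<xi>. complex_of_real (norm \<xi> powr s) * g \<xi>))\<^sup>2"
    using eq k0 unfolding nn_integral_l2_norm[OF sq]
    by (simp add: ennreal_mult[symmetric])
qed

text \<open>The choice in the definition of a Fourier multiplier is from a nonempty set: finite energy makes
  \<open>|\<xi>|\<^sup>s F u\<close> square integrable, and every square integrable function is a Fourier transform.\<close>

lemma half_frac_laplacian_transform:
  fixes u :: "'a::euclidean_space \<Rightarrow> real"
  assumes s: "0 < s" "s < 1" and u: "u \<in> sobolev s"
  obtains g h where "is_fourier_transform (\<lambda>x. complex_of_real (u x)) g"
    "is_fourier_transform (half_frac_laplacian s u) h"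
    "AE \<xi> in lborel. h \<xi> = complex_of_real (norm \<xi> powr s) * g \<xi>"
proof -
  obtain g where g: "is_fourier_transform (\<lambda>x. complex_of_real (u x)) g"
    by (rule fourier_transform_exists[OF square_integrable_complex_of_real[OF sobolevD(1)[OF u]]])
  obtain w where w: "is_fourier_transform w (\<lambda>\<xi>. complex_of_real (norm \<xi> powr s) * g \<xi>)"
    by (rule fourier_transform_surj[OF energy_multiplier(1)[OF s u g]])
  have "\<exists>w u' w'. is_fourier_transform (\<lambda>x. complex_of_real (u x)) u' \<and> is_fourier_transform w w' \<and>
      (AE \<xi> in lborel. w' \<xi> = complex_of_real (norm \<xi> powr s) * u' \<xi>)"
    using g w by auto
  from someI_ex[OF this] show ?thesis
    unfolding half_frac_laplacian_def[symmetric] fourier_multiplier_def[symmetric] using that by blast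
qed

text \<open>The transform of a real function is Hermitian, and this is preserved by multiplication with the even
  real function \<open>|\<xi>|\<^sup>s\<close>; a function with Hermitian transform agrees with its conjugate.\<close>

lemma half_frac_laplacian_real:
  fixes u :: "'a::euclidean_space \<Rightarrow> real"
  assumes s: "0 < s" "s < 1" and u: "u \<in> sobolev s"
  shows "AE x in lborel. Im (half_frac_laplacian s u x) = 0"
proof -
  obtain g h where g: "is_fourier_transform (\<lambda>x. complex_of_real (u x)) g"
    and h: "is_fourier_transform (half_frac_laplacian s u) h"
    and gh: "AE \<xi> in lborel. h \<xi> = complex_of_real (norm \<xi> powr s) * g \<xi>"
    by (rule half_frac_laplacian_transform[OF s u])
  have [measurable]: "g \<in> borel_measurable borel" "h \<in> borel_measurable borel"
    using is_fourier_transformD(2)[OF g] is_fourier_transformD(2)[OF h] by (auto simp: square_integrable_measurable)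
  have herm: "AE \<xi> in lborel. g \<xi> = cnj (g (- \<xi>))"
    using fourier_transform_unique[OF g fourier_transform_cnj[OF g]] by simp
  have "AE \<xi> in lborel. h (0 + (- 1) *\<^sub>R \<xi>) = complex_of_real (norm (0 + (- 1) *\<^sub>R \<xi>) powr s) * g (0 + (- 1) *\<^sub>R \<xi>)"
    by (rule AE_lborel_affine[OF _ _ gh]) (simp, measurable)
  then have "AE \<xi> in lborel. h \<xi> = cnj (h (- \<xi>))"
    using herm gh
  proof eventually_elim
    case (elim \<xi>)
    have "cnj (h (- \<xi>)) = complex_of_real (norm \<xi> powr s) * cnj (g (- \<xi>))" using elim(1) by simp
    also have "\<dots> = h \<xi>" using elim(2,3) by simp
    finally show ?case by simp
  qed
  then have "AE x in lborel. half_frac_laplacian s u x = cnj (half_frac_laplacian s u x)"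
    using fourier_transform_unique[OF h fourier_transform_cnj[OF h]] by simp
  then show ?thesis
    by eventually_elim (metis Reals_cnj_iff complex_is_Real_iff)
qed

lemma half_frac_laplacian_energy:
  fixes u v :: "'a::euclidean_space \<Rightarrow> real"
  assumes s: "0 < s" "s < 1" and u: "u \<in> sobolev s" and v: "v \<in> sobolev s"
  shows "energy s (\<lambda>x. u x + v x) = gagliardo_constant TYPE('a) s * (l2_norm (\<lambda>x. half_frac_laplacian s u x + half_frac_laplacian s v x))\<^sup>2"
    and "energy s (\<lambda>x. u x - v x) = gagliardo_constant TYPE('a) s * (l2_norm (\<lambda>x. half_frac_laplacian s u x - half_frac_laplacian s v x))\<^sup>2"
proof -
  obtain g h where g: "is_fourier_transform (\<lambda>x. complex_of_real (u x)) g"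
    and h: "is_fourier_transform (half_frac_laplacian s u) h"
    and gh: "AE \<xi> in lborel. h \<xi> = complex_of_real (norm \<xi> powr s) * g \<xi>"
    by (rule half_frac_laplacian_transform[OF s u])
  obtain g' h' where g': "is_fourier_transform (\<lambda>x. complex_of_real (v x)) g'"
    and h': "is_fourier_transform (half_frac_laplacian s v) h'"
    and gh': "AE \<xi> in lborel. h' \<xi> = complex_of_real (norm \<xi> powr s) * g' \<xi>"
    by (rule half_frac_laplacian_transform[OF s v])
  have [measurable]: "g \<in> borel_measurable borel" "h \<in> borel_measurable borel" "g' \<in> borel_measurable borel" "h' \<in> borel_measurable borel"
    using is_fourier_transformD(2)[OF g] is_fourier_transformD(2)[OF h] is_fourier_transformD(2)[OF g'] is_fourier_transformD(2)[OF h']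
    by (auto simp: square_integrable_measurable)
  have "energy s (\<lambda>x. u x + v x) = gagliardo_constant TYPE('a) s * (l2_norm (\<lambda>\<xi>. complex_of_real (norm \<xi> powr s) * (g \<xi> + g' \<xi>)))\<^sup>2"
    using fourier_transform_add[OF g g'] by (intro energy_multiplier(2) s sobolev_add u v) simp
  also have "l2_norm (\<lambda>\<xi>. complex_of_real (norm \<xi> powr s) * (g \<xi> + g' \<xi>)) = l2_norm (\<lambda>\<xi>. h \<xi> + h' \<xi>)"
  proof (rule l2_norm_cong_AE)
    show "AE \<xi> in lborel. norm (complex_of_real (norm \<xi> powr s) * (g \<xi> + g' \<xi>)) = norm (h \<xi> + h' \<xi>)"
      using gh gh' by eventually_elim (simp add: distrib_left)
  qed measurable
  also have "\<dots> = l2_norm (\<lambda>x. half_frac_laplacian s u x + half_frac_laplacian s v x)"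
    by (rule plancherel[OF fourier_transform_add[OF h h']])
  finally show "energy s (\<lambda>x. u x + v x) = gagliardo_constant TYPE('a) s * (l2_norm (\<lambda>x. half_frac_laplacian s u x + half_frac_laplacian s v x))\<^sup>2" .
  have "energy s (\<lambda>x. u x - v x) = gagliardo_constant TYPE('a) s * (l2_norm (\<lambda>\<xi>. complex_of_real (norm \<xi> powr s) * (g \<xi> - g' \<xi>)))\<^sup>2"
    using fourier_transform_diff[OF g g'] by (intro energy_multiplier(2) s sobolev_diff u v) simp
  also have "l2_norm (\<lambda>\<xi>. complex_of_real (norm \<xi> powr s) * (g \<xi> - g' \<xi>)) = l2_norm (\<lambda>\<xi>. h \<xi> - h' \<xi>)"
  proof (rule l2_norm_cong_AE)
    show "AE \<xi> in lborel. norm (complex_of_real (norm \<xi> powr s) * (g \<xi> - g' \<xi>)) = norm (h \<xi> - h' \<xi>)"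
      using gh gh' by eventually_elim (simp add: right_diff_distrib)
  qed measurable
  also have "\<dots> = l2_norm (\<lambda>x. half_frac_laplacian s u x - half_frac_laplacian s v x)"
    by (rule plancherel[OF fourier_transform_diff[OF h h']])
  finally show "energy s (\<lambda>x. u x - v x) = gagliardo_constant TYPE('a) s * (l2_norm (\<lambda>x. half_frac_laplacian s u x - half_frac_laplacian s v x))\<^sup>2" .
qed

text \<open>Polarisation of the identity between the energy and the norm of the half Laplacian. As the pairing
  has no conjugate, this relies on the factors being real. The right side is the symmetric bilinear
  form of \<open>E / \<kappa>\<close>; keeping it as a difference of energies avoids a separate bilinear form.\<close>

theorem half_frac_laplacian_pairing:
  fixes u v :: "'a::euclidean_space \<Rightarrow> real"
  assumes s: "0 < s" "s < 1" and u: "u \<in> sobolev s" and v: "v \<in> sobolev s"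
  shows "(LINT x|lborel. half_frac_laplacian s u x * half_frac_laplacian s v x)
    = complex_of_real ((energy s (\<lambda>x. u x + v x) - energy s (\<lambda>x. u x - v x)) / (4 * gagliardo_constant TYPE('a) s))"
proof -
  let ?U = "half_frac_laplacian s u" and ?V = "half_frac_laplacian s v"
  obtain g h where "is_fourier_transform ?U h"
    by (rule half_frac_laplacian_transform[OF s u])
  then have U: "square_integrable ?U" by (rule is_fourier_transformD)
  obtain g h where "is_fourier_transform ?V h"
    by (rule half_frac_laplacian_transform[OF s v])
  then have V: "square_integrable ?V" by (rule is_fourier_transformD)
  have [measurable]: "?U \<in> borel_measurable borel" "?V \<in> borel_measurable borel"
    using U V by (auto simp: square_integrable_measurable)
  have "(LINT x|lborel. ?U x * ?V x) = (LINT x|lborel. complex_of_real (((norm (?U x + ?V x))\<^sup>2 - (norm (?U x - ?V x))\<^sup>2) / 4))"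
  proof (rule integral_cong_AE)
    show "AE x in lborel. ?U x * ?V x = complex_of_real (((norm (?U x + ?V x))\<^sup>2 - (norm (?U x - ?V x))\<^sup>2) / 4)"
      using half_frac_laplacian_real[OF s u] half_frac_laplacian_real[OF s v]
    proof eventually_elim
      case (elim x)
      then show ?case
        by (simp add: cmod_power2 complex_eq_iff) (simp add: power2_eq_square algebra_simps)
    qed
  qed measurable
  also have "\<dots> = complex_of_real (((l2_norm (\<lambda>x. ?U x + ?V x))\<^sup>2 - (l2_norm (\<lambda>x. ?U x - ?V x))\<^sup>2) / 4)"
    using square_integrable_integrable[OF square_integrable_add(1)[OF U V]] square_integrable_integrable[OF square_integrable_diff(1)[OF U V]]
    unfolding integral_complex_of_real l2_norm_power2 by simp
  also have "\<dots> = complex_of_real ((energy s (\<lambda>x. u x + v x) - energy s (\<lambda>x. u x - v x)) / (4 * gagliardo_constant TYPE('a) s))"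
    using gagliardo_symbol_eq(2)[OF s, where 'a='a]
    unfolding half_frac_laplacian_energy[OF s u v] by (simp add: right_diff_distrib[symmetric] del: of_real_diff of_real_mult of_real_divide)
  finally show ?thesis .
qed

section \<open>Translation and Poincare estimates\<close>

text \<open>On the Fourier side \<open>|iexp (h \<bullet> \<xi>) - 1|\<^sup>2 \<le> 4 |h|\<^bsup>2s\<^esup> |\<xi>|\<^bsup>2s\<^esup>\<close>.\<close>

lemma translation_estimate:
  fixes u :: "'a::euclidean_space \<Rightarrow> real"
  assumes s: "0 < s" "s < 1" and u: "u \<in> sobolev s"
  shows "square_integrable (\<lambda>x. u (x + h) - u x)"
    and "(l2_norm (\<lambda>x. u (x + h) - u x))\<^sup>2 \<le> 4 / gagliardo_constant TYPE('a) s * norm h powr (2 * s) * energy s u"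
proof -
  note k0 = gagliardo_symbol_eq(2)[OF s, where 'a='a]
  show d: "square_integrable (\<lambda>x. u (x + h) - u x)"
    by (intro square_integrable_diff(1) square_integrable_translate sobolevD[OF u])
  obtain g where g: "is_fourier_transform (\<lambda>x. complex_of_real (u x)) g"
    by (rule fourier_transform_exists[OF square_integrable_complex_of_real[OF sobolevD(1)[OF u]]])
  have [measurable]: "g \<in> borel_measurable borel"
    by (rule square_integrable_measurable[OF is_fourier_transformD(2)[OF g]])
  let ?w = "\<lambda>\<xi>. complex_of_real (norm \<xi> powr s) * g \<xi>"
  note w = energy_multiplier[OF s u g]
  have "ennreal ((l2_norm (\<lambda>x. u (x + h) - u x))\<^sup>2) = (\<integral>\<^sup>+ x. ennreal ((u (x + h) - u x)\<^sup>2) \<partial>lborel)"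
    using nn_integral_l2_norm[OF d] by simp
  also have "\<dots> = (\<integral>\<^sup>+ \<xi>. ennreal ((norm (iexp (h \<bullet> \<xi>) - 1))\<^sup>2 * (norm (g \<xi>))\<^sup>2) \<partial>lborel)"
    by (rule nn_integral_translation_difference[OF g])
  also have "\<dots> \<le> (\<integral>\<^sup>+ \<xi>. ennreal (4 * norm h powr (2 * s)) * ennreal ((norm (?w \<xi>))\<^sup>2) \<partial>lborel)"
  proof (rule nn_integral_mono)
    fix \<xi> :: 'a
    have "(norm (iexp (h \<bullet> \<xi>) - 1))\<^sup>2 \<le> 4 * \<bar>h \<bullet> \<xi>\<bar> powr (2 * s)"
      using s by (intro norm_iexp_minus_one_power2_le) auto
    also have "\<dots> \<le> 4 * (norm h * norm \<xi>) powr (2 * s)"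
      using s by (intro mult_left_mono powr_mono2 Cauchy_Schwarz_ineq2) auto
    also have "\<dots> = 4 * norm h powr (2 * s) * (norm \<xi> powr s)\<^sup>2"
      by (simp add: powr_mult power2_eq_square flip: powr_add)
    finally have "(norm (iexp (h \<bullet> \<xi>) - 1))\<^sup>2 * (norm (g \<xi>))\<^sup>2
        \<le> 4 * norm h powr (2 * s) * (norm \<xi> powr s)\<^sup>2 * (norm (g \<xi>))\<^sup>2"
      by (rule mult_right_mono) simp
    also have "\<dots> = (4 * norm h powr (2 * s)) * (norm (?w \<xi>))\<^sup>2"
      by (simp add: norm_mult power_mult_distrib)
    finally show "ennreal ((norm (iexp (h \<bullet> \<xi>) - 1))\<^sup>2 * (norm (g \<xi>))\<^sup>2)
        \<le> ennreal (4 * norm h powr (2 * s)) * ennreal ((norm (?w \<xi>))\<^sup>2)"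
      by (subst ennreal_mult[symmetric]) (auto intro: ennreal_leI)
  qed
  also have "\<dots> = ennreal (4 * norm h powr (2 * s)) * (\<integral>\<^sup>+ \<xi>. ennreal ((norm (?w \<xi>))\<^sup>2) \<partial>lborel)"
    by (rule nn_integral_cmult) measurable
  also have "\<dots> = ennreal (4 * norm h powr (2 * s) * (l2_norm ?w)\<^sup>2)"
    unfolding nn_integral_l2_norm[OF w(1)] by (rule ennreal_mult[symmetric]) auto
  also have "4 * norm h powr (2 * s) * (l2_norm ?w)\<^sup>2 = 4 / gagliardo_constant TYPE('a) s * norm h powr (2 * s) * energy s u"
    unfolding w(2) using k0 by simp
  finally show "(l2_norm (\<lambda>x. u (x + h) - u x))\<^sup>2 \<le> 4 / gagliardo_constant TYPE('a) s * norm h powr (2 * s) * energy s u"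
    by (subst (asm) ennreal_le_iff) (use k0 in auto)
qed

text \<open>Apply the translation estimate to a shift so long that \<open>u\<close> and its translate have disjoint supports.\<close>

theorem poincare:
  fixes u :: "'a::euclidean_space \<Rightarrow> real"
  assumes s: "0 < s" "s < 1" and u: "u \<in> sobolev s"
    and zero: "AE x in lborel. x \<notin> ball c r \<longrightarrow> u x = 0" and "0 < r"
  shows "(l2_norm u)\<^sup>2 \<le> 4 / gagliardo_constant TYPE('a) s * (2 * r) powr (2 * s) * energy s u"
proof -
  define e :: 'a where "e = (SOME b. b \<in> Basis)"
  have e: "norm e = 1" using SOME_Basis by (simp add: e_def)
  let ?h = "(2 * r) *\<^sub>R e"
  have [measurable]: "u \<in> borel_measurable borel" by (rule sobolevD[OF u])
  have zero': "AE x in lborel. ?h + 1 *\<^sub>R x \<notin> ball c r \<longrightarrow> u (?h + 1 *\<^sub>R x) = 0"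
    by (rule AE_lborel_affine[OF _ _ zero]) (simp, simp only: mem_ball, measurable)
  \<comment> \<open>the supports of \<open>u\<close> and of its translate by the diameter of the ball are disjoint\<close>
  have "AE x in lborel. (u x)\<^sup>2 \<le> (u (x + ?h) - u x)\<^sup>2"
    using zero zero'
  proof eventually_elim
    case (elim x)
    have "x + ?h \<notin> ball c r" if "x \<in> ball c r"
    proof
      assume "x + ?h \<in> ball c r"
      then have "norm ?h < 2 * r"
        using that dist_triangle2[of x "x + ?h" c] by (auto simp: dist_commute dist_norm)
      then show False using e \<open>0 < r\<close> by simp
    qed
    then show ?case using elim by (cases "x \<in> ball c r") (auto simp: add.commute)
  qed
  then have "(LINT x|lborel. (norm (u x))\<^sup>2) \<le> (LINT x|lborel. (norm (u (x + ?h) - u x))\<^sup>2)"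
    using square_integrable_integrable[OF sobolevD(1)[OF u]]
      square_integrable_integrable[OF translation_estimate(1)[OF s u, of ?h]]
    by (intro integral_mono_AE) auto
  then have "(l2_norm u)\<^sup>2 \<le> (l2_norm (\<lambda>x. u (x + ?h) - u x))\<^sup>2"
    by (simp only: l2_norm_power2)
  also have "\<dots> \<le> 4 / gagliardo_constant TYPE('a) s * norm ?h powr (2 * s) * energy s u"
    by (rule translation_estimate(2)[OF s u])
  finally show ?thesis using e \<open>0 < r\<close> by simp
qed

section \<open>Patchworks of translations\<close>

lemma square_sum_convex:
  fixes p a :: "'i \<Rightarrow> real"
  assumes "\<And>i. i \<in> I \<Longrightarrow> 0 \<le> p i" and "(\<Sum>i\<in>I. p i) = 1"
  shows "(\<Sum>i\<in>I. p i * a i)\<^sup>2 \<le> (\<Sum>i\<in>I. p i * (a i)\<^sup>2)"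
proof -
  let ?A = "\<Sum>i\<in>I. p i * a i"
  have "0 \<le> (\<Sum>i\<in>I. p i * (a i - ?A)\<^sup>2)"
    using assms(1) by (intro sum_nonneg mult_nonneg_nonneg) auto
  also have "\<dots> = (\<Sum>i\<in>I. p i * (a i)\<^sup>2 - 2 * ?A * (p i * a i) + ?A\<^sup>2 * p i)"
    by (intro sum.cong refl) (simp add: power2_eq_square algebra_simps)
  also have "\<dots> = (\<Sum>i\<in>I. p i * (a i)\<^sup>2) - 2 * ?A * ?A + ?A\<^sup>2 * (\<Sum>i\<in>I. p i)"
    by (simp only: sum.distrib sum_subtractf sum_distrib_left)
  finally show ?thesis using assms(2) by (simp add: power2_eq_square)
qed

lemma square_add_le:
  fixes a b \<eta> :: real
  assumes "0 < \<eta>"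
  shows "(a + b)\<^sup>2 \<le> (1 + \<eta>) * a\<^sup>2 + (1 + 1 / \<eta>) * b\<^sup>2"
proof -
  have "0 \<le> (\<eta> * a - b)\<^sup>2 / \<eta>" using assms by simp
  also have "\<dots> = \<eta> * a\<^sup>2 - 2 * a * b + b\<^sup>2 / \<eta>"
    using assms by (simp add: power2_eq_square field_simps)
  finally show ?thesis by (simp add: power2_eq_square algebra_simps)
qed

text \<open>Controls the commutator of the energy with a Lipschitz cutoff \<open>\<phi>\<close>, for which
  \<open>|\<phi> x - \<phi> y|\<^sup>2\<close> is at most a multiple of \<open>min 1 |x - y|\<^sup>2\<close>.\<close>

definition kernel_mass :: "'a::euclidean_space itself \<Rightarrow> real \<Rightarrow> real" where
  "kernel_mass _ s = enn2real (\<integral>\<^sup>+ h. ennreal (min 1 ((norm h)\<^sup>2) / norm h powr (real DIM('a) + 2 * s)) \<partial>(lborel :: 'a measure))"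

text \<open>Different translations, all of length at most \<open>t\<close>, are used in different regions and glued by a
  partition of unity. The normalisation \<open>1 \<le> L\<close> makes \<open>L\<^sup>2 * min 1 |x - y|\<^sup>2\<close> a common bound for
  the Lipschitz estimate and the trivial bound \<open>1\<close> of \<open>|\<phi> x - \<phi> y|\<^sup>2\<close>.\<close>

locale translation_patchwork =
  fixes I :: "'i set" and \<phi> :: "'i \<Rightarrow> 'a::euclidean_space \<Rightarrow> real" and h :: "'i \<Rightarrow> 'a" and L t :: real
  assumes finite_I: "finite I"
    and \<phi>_nonneg: "\<And>i x. i \<in> I \<Longrightarrow> 0 \<le> \<phi> i x"
    and \<phi>_sum: "\<And>x. (\<Sum>i\<in>I. \<phi> i x) = 1"
    and \<phi>_lipschitz: "\<And>i x y. i \<in> I \<Longrightarrow> \<bar>\<phi> i x - \<phi> i y\<bar> \<le> L * norm (x - y)"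
    and L_ge_1: "1 \<le> L"
    and h_le: "\<And>i. i \<in> I \<Longrightarrow> norm (h i) \<le> t"
    and t_pos: "0 < t"
begin

definition patchwork :: "('a \<Rightarrow> real) \<Rightarrow> 'a \<Rightarrow> real" where
  "patchwork u x = (\<Sum>i\<in>I. \<phi> i x * u (x + h i))"

lemma \<phi>_le_1: "i \<in> I \<Longrightarrow> \<phi> i x \<le> 1"
  using member_le_sum[of i I "\<lambda>i. \<phi> i x"] finite_I \<phi>_nonneg \<phi>_sum[of x] by simp

lemma measurable_\<phi> [measurable]: "i \<in> I \<Longrightarrow> \<phi> i \<in> borel_measurable borel"
proof -
  assume i: "i \<in> I"
  have "L-lipschitz_on UNIV (\<phi> i)"
    using \<phi>_lipschitz[OF i] L_ge_1 by (intro lipschitz_onI) (auto simp: dist_norm)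
  then show "\<phi> i \<in> borel_measurable borel"
    by (intro borel_measurable_continuous_onI lipschitz_on_continuous_on)
qed

lemma measurable_patchwork [measurable]:
  assumes [measurable]: "u \<in> borel_measurable borel"
  shows "patchwork u \<in> borel_measurable borel"
  unfolding patchwork_def[abs_def] by measurable

lemma patchwork_minus_self: "patchwork u x - u x = (\<Sum>i\<in>I. \<phi> i x * (u (x + h i) - u x))"
  unfolding patchwork_def right_diff_distrib sum_subtractf sum_distrib_right[symmetric] \<phi>_sum by simp

lemma patchwork_L2:
  assumes s: "0 < s" "s < 1" and u: "u \<in> sobolev s"
  shows "square_integrable (\<lambda>x. patchwork u x - u x)"
    and "(l2_norm (\<lambda>x. patchwork u x - u x))\<^sup>2
      \<le> real (card I) * (4 / gagliardo_constant TYPE('a) s) * t powr (2 * s) * energy s u"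
proof -
  have [measurable]: "u \<in> borel_measurable borel" by (rule sobolevD[OF u])
  note d = translation_estimate[OF s u]
  have k0: "0 < gagliardo_constant TYPE('a) s" by (rule gagliardo_symbol_eq(2)[OF s])
  have le: "(patchwork u x - u x)\<^sup>2 \<le> (\<Sum>i\<in>I. (u (x + h i) - u x)\<^sup>2)" for x
  proof -
    have "(patchwork u x - u x)\<^sup>2 \<le> (\<Sum>i\<in>I. \<phi> i x * (u (x + h i) - u x)\<^sup>2)"
      unfolding patchwork_minus_self by (rule square_sum_convex) (auto simp: \<phi>_nonneg \<phi>_sum)
    also have "\<dots> \<le> (\<Sum>i\<in>I. (u (x + h i) - u x)\<^sup>2)"
      by (intro sum_mono mult_left_le_one_le) (auto simp: \<phi>_nonneg \<phi>_le_1)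
    finally show ?thesis .
  qed
  have i: "integrable lborel (\<lambda>x. \<Sum>i\<in>I. (u (x + h i) - u x)\<^sup>2)"
    using square_integrable_integrable[OF d(1)] by (intro Bochner_Integration.integrable_sum) auto
  have j: "integrable lborel (\<lambda>x. (norm (patchwork u x - u x))\<^sup>2)"
    by (rule Bochner_Integration.integrable_bound[OF i]) (auto intro!: AE_I2 order_trans[OF le] simp: sum_nonneg)
  then show "square_integrable (\<lambda>x. patchwork u x - u x)"
    by (simp add: square_integrable_def)
  have "(l2_norm (\<lambda>x. patchwork u x - u x))\<^sup>2 \<le> (LINT x|lborel. (\<Sum>i\<in>I. (u (x + h i) - u x)\<^sup>2))"
    unfolding l2_norm_power2 by (rule integral_mono[OF j i]) (use le in simp)
  also have "\<dots> = (\<Sum>i\<in>I. (LINT x|lborel. (u (x + h i) - u x)\<^sup>2))"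
    using square_integrable_integrable[OF d(1)] by (intro Bochner_Integration.integral_sum) auto
  also have "\<dots> = (\<Sum>i\<in>I. (l2_norm (\<lambda>x. u (x + h i) - u x))\<^sup>2)"
    by (simp add: l2_norm_power2)
  also have "\<dots> \<le> (\<Sum>i\<in>I. 4 / gagliardo_constant TYPE('a) s * t powr (2 * s) * energy s u)"
  proof (rule sum_mono)
    fix i assume "i \<in> I"
    have "(l2_norm (\<lambda>x. u (x + h i) - u x))\<^sup>2 \<le> 4 / gagliardo_constant TYPE('a) s * norm (h i) powr (2 * s) * energy s u"
      by (rule d(2))
    also have "\<dots> \<le> 4 / gagliardo_constant TYPE('a) s * t powr (2 * s) * energy s u"
      using k0 s h_le[OF \<open>i \<in> I\<close>] by (intro mult_right_mono mult_left_mono powr_mono2) auto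
    finally show "(l2_norm (\<lambda>x. u (x + h i) - u x))\<^sup>2 \<le> 4 / gagliardo_constant TYPE('a) s * t powr (2 * s) * energy s u" .
  qed
  finally show "(l2_norm (\<lambda>x. patchwork u x - u x))\<^sup>2
      \<le> real (card I) * (4 / gagliardo_constant TYPE('a) s) * t powr (2 * s) * energy s u"
    by (simp add: mult.assoc)
qed

text \<open>The increment of the patchwork splits into the convex combination \<open>A\<close> of the increments of the
  translates, and a commutator \<open>B\<close> that contains increments of the cutoffs. Since the cutoffs sum to
  \<open>1\<close>, \<open>u y\<close> may be subtracted in \<open>B\<close>, so that only the small differences \<open>u (y + h i) - u y\<close>
  remain. The factor \<open>1 + \<eta>\<close> in front of \<open>A\<close> rather than \<open>2\<close> is essential: the result must be a small
  perturbation of the energy of \<open>u\<close>.\<close>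

lemma patchwork_integrand_le:
  assumes "0 < \<eta>"
  shows "gagliardo_integrand s (patchwork u) (x, y)
    \<le> (1 + \<eta>) * (\<Sum>i\<in>I. \<phi> i x * gagliardo_integrand s (\<lambda>x. u (x + h i)) (x, y))
      + (1 + 1 / \<eta>) * real (card I) * L\<^sup>2 *
        (\<Sum>i\<in>I. min 1 ((norm (x - y))\<^sup>2) / norm (x - y) powr (real DIM('a) + 2 * s) * (u (y + h i) - u y)\<^sup>2)"
proof -
  let ?K = "norm (x - y) powr (real DIM('a) + 2 * s)"
  let ?m = "min 1 ((norm (x - y))\<^sup>2)"
  let ?A = "\<Sum>i\<in>I. \<phi> i x * (u (x + h i) - u (y + h i))"
  let ?B = "\<Sum>i\<in>I. (\<phi> i x - \<phi> i y) * (u (y + h i) - u y)"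
  have "(\<Sum>i\<in>I. (\<phi> i x - \<phi> i y) * u y) = 0"
    by (simp add: sum_distrib_right[symmetric] sum_subtractf \<phi>_sum)
  then have B: "?B = (\<Sum>i\<in>I. (\<phi> i x - \<phi> i y) * u (y + h i))"
    by (simp add: right_diff_distrib sum_subtractf)
  have "patchwork u x - patchwork u y = ?A + ?B"
    unfolding B patchwork_def by (simp add: algebra_simps sum.distrib sum_subtractf)
  then have "(patchwork u x - patchwork u y)\<^sup>2 \<le> (1 + \<eta>) * ?A\<^sup>2 + (1 + 1 / \<eta>) * ?B\<^sup>2"
    using square_add_le[OF assms] by simp
  moreover have "?A\<^sup>2 \<le> (\<Sum>i\<in>I. \<phi> i x * (u (x + h i) - u (y + h i))\<^sup>2)"
    by (rule square_sum_convex) (auto simp: \<phi>_nonneg \<phi>_sum)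
  moreover have "?B\<^sup>2 \<le> real (card I) * (\<Sum>i\<in>I. L\<^sup>2 * ?m * (u (y + h i) - u y)\<^sup>2)"
  proof -
    have "?B\<^sup>2 \<le> real (card I) * (\<Sum>i\<in>I. ((\<phi> i x - \<phi> i y) * (u (y + h i) - u y))\<^sup>2)"
      using sum_squared_le_sum_of_squares[of "\<lambda>i. (\<phi> i x - \<phi> i y) * (u (y + h i) - u y)" I] by (simp add: mult.commute)
    also have "\<dots> \<le> real (card I) * (\<Sum>i\<in>I. L\<^sup>2 * ?m * (u (y + h i) - u y)\<^sup>2)"
    proof (intro mult_left_mono sum_mono)
      fix i assume i: "i \<in> I"
      have "\<bar>\<phi> i x - \<phi> i y\<bar> \<le> 1"
        using \<phi>_nonneg[OF i, of x] \<phi>_nonneg[OF i, of y] \<phi>_le_1[OF i, of x] \<phi>_le_1[OF i, of y] by linarith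
      then have 1: "(\<phi> i x - \<phi> i y)\<^sup>2 \<le> 1" by (simp add: abs_square_le_1)
      have 2: "(\<phi> i x - \<phi> i y)\<^sup>2 \<le> L\<^sup>2 * (norm (x - y))\<^sup>2"
        using power_mono[OF \<phi>_lipschitz[OF i, of x y], of 2] by (simp add: power_mult_distrib)
      have "1 \<le> L\<^sup>2" using L_ge_1 by simp
      then have "(\<phi> i x - \<phi> i y)\<^sup>2 \<le> L\<^sup>2 * ?m"
        using 1 2 by (auto simp: min_def)
      then show "((\<phi> i x - \<phi> i y) * (u (y + h i) - u y))\<^sup>2 \<le> L\<^sup>2 * ?m * (u (y + h i) - u y)\<^sup>2"
        unfolding power_mult_distrib by (rule mult_right_mono) simp
    qed simp
    finally show ?thesis .
  qed
  ultimately have "(patchwork u x - patchwork u y)\<^sup>2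
      \<le> (1 + \<eta>) * (\<Sum>i\<in>I. \<phi> i x * (u (x + h i) - u (y + h i))\<^sup>2)
        + (1 + 1 / \<eta>) * (real (card I) * (\<Sum>i\<in>I. L\<^sup>2 * ?m * (u (y + h i) - u y)\<^sup>2))"
    using assms by (elim order_trans) (intro add_mono mult_left_mono, auto)
  then have "(patchwork u x - patchwork u y)\<^sup>2 / ?K
      \<le> ((1 + \<eta>) * (\<Sum>i\<in>I. \<phi> i x * (u (x + h i) - u (y + h i))\<^sup>2)
        + (1 + 1 / \<eta>) * (real (card I) * (\<Sum>i\<in>I. L\<^sup>2 * ?m * (u (y + h i) - u y)\<^sup>2))) / ?K"
    by (rule divide_right_mono) simp
  also have "\<dots> = (1 + \<eta>) * (\<Sum>i\<in>I. \<phi> i x * ((u (x + h i) - u (y + h i))\<^sup>2 / ?K))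
        + (1 + 1 / \<eta>) * real (card I) * L\<^sup>2 * (\<Sum>i\<in>I. ?m / ?K * (u (y + h i) - u y)\<^sup>2)"
    by (simp add: add_divide_distrib sum_divide_distrib sum_distrib_left mult_ac)
  finally show ?thesis
    by (simp add: gagliardo_integrand_def)
qed

text \<open>Translating back moves the shift from \<open>u\<close> to the cutoff, where it costs at most \<open>L * t\<close>. Summed over
  \<open>i\<close> the weights give \<open>1 + card I * L * t\<close>.\<close>

lemma nn_integral_weighted_translate:
  assumes u: "u \<in> sobolev s" and i: "i \<in> I"
  shows "(\<integral>\<^sup>+ z. ennreal (\<phi> i (fst z) * gagliardo_integrand s (\<lambda>x. u (x + h i)) z) \<partial>(lborel \<Otimes>\<^sub>M lborel))
    \<le> (\<integral>\<^sup>+ z. ennreal ((\<phi> i (fst z) + L * t) * gagliardo_integrand s u z) \<partial>(lborel \<Otimes>\<^sub>M lborel))"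
proof -
  let ?a = "real DIM('a) + 2 * s"
  have [measurable]: "u \<in> borel_measurable borel" by (rule sobolevD[OF u])
  note [measurable] = measurable_\<phi>[OF i]
  have "(\<integral>\<^sup>+ z. ennreal (\<phi> i (fst z) * gagliardo_integrand s (\<lambda>x. u (x + h i)) z) \<partial>(lborel \<Otimes>\<^sub>M lborel))
      = (\<integral>\<^sup>+ z. ennreal (\<phi> i (fst z) * (\<bar>u (fst z + h i) - u (snd z + h i)\<bar>\<^sup>2 / norm (fst z - snd z) powr ?a)) \<partial>(lborel \<Otimes>\<^sub>M lborel))"
    by (simp add: gagliardo_integrand_def split_beta')
  also have "\<dots> = (\<integral>\<^sup>+ k. (\<integral>\<^sup>+ x. ennreal (\<phi> i x * (\<bar>u (x + h i) - u (x + k + h i)\<bar>\<^sup>2 / norm (x - (x + k)) powr ?a)) \<partial>lborel) \<partial>lborel)"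
    by (rule nn_integral_shear) measurable
  also have "\<dots> = (\<integral>\<^sup>+ k. (\<integral>\<^sup>+ x. ennreal (\<phi> i (- h i + x) * (\<bar>u (- h i + x + h i) - u (- h i + x + k + h i)\<bar>\<^sup>2 / norm (- h i + x - (- h i + x + k)) powr ?a)) \<partial>lborel) \<partial>lborel)"
    by (rule nn_integral_cong, rule nn_integral_lborel_translate[symmetric]) measurable
  also have "\<dots> = (\<integral>\<^sup>+ k. (\<integral>\<^sup>+ x. ennreal (\<phi> i (x - h i) * (\<bar>u x - u (x + k)\<bar>\<^sup>2 / norm (x - (x + k)) powr ?a)) \<partial>lborel) \<partial>lborel)"
    by (simp add: algebra_simps)
  also have "\<dots> \<le> (\<integral>\<^sup>+ k. (\<integral>\<^sup>+ x. ennreal ((\<phi> i x + L * t) * (\<bar>u x - u (x + k)\<bar>\<^sup>2 / norm (x - (x + k)) powr ?a)) \<partial>lborel) \<partial>lborel)"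
  proof (rule nn_integral_mono, rule nn_integral_mono, rule ennreal_leI, rule mult_right_mono)
    fix x
    have "\<bar>\<phi> i (x - h i) - \<phi> i x\<bar> \<le> L * norm (h i)"
      using \<phi>_lipschitz[OF i, of "x - h i" x] by simp
    also have "\<dots> \<le> L * t" using h_le[OF i] L_ge_1 by (intro mult_left_mono) auto
    finally show "\<phi> i (x - h i) \<le> \<phi> i x + L * t" by linarith
  qed simp
  also have "\<dots> = (\<integral>\<^sup>+ z. ennreal ((\<phi> i (fst z) + L * t) * (\<bar>u (fst z) - u (snd z)\<bar>\<^sup>2 / norm (fst z - snd z) powr ?a)) \<partial>(lborel \<Otimes>\<^sub>M lborel))"
    by (rule nn_integral_shear[symmetric]) measurable
  also have "\<dots> = (\<integral>\<^sup>+ z. ennreal ((\<phi> i (fst z) + L * t) * gagliardo_integrand s u z) \<partial>(lborel \<Otimes>\<^sub>M lborel))"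
    by (simp add: gagliardo_integrand_def split_beta')
  finally show ?thesis .
qed

lemma nn_integral_commutator:
  assumes s: "0 < s" "s < 1" and u: "u \<in> sobolev s" and i: "i \<in> I"
  shows "(\<integral>\<^sup>+ z. ennreal (min 1 ((norm (fst z - snd z))\<^sup>2) / norm (fst z - snd z) powr (real DIM('a) + 2 * s) * (u (snd z + h i) - u (snd z))\<^sup>2) \<partial>(lborel \<Otimes>\<^sub>M lborel))
    \<le> ennreal (kernel_mass TYPE('a) s * (4 / gagliardo_constant TYPE('a) s * t powr (2 * s) * energy s u))"
proof -
  let ?a = "real DIM('a) + 2 * s"
  let ?J = "\<lambda>k::'a. min 1 ((norm k)\<^sup>2) / norm k powr ?a"
  have k0: "0 < gagliardo_constant TYPE('a) s" by (rule gagliardo_symbol_eq(2)[OF s])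
  have [measurable]: "u \<in> borel_measurable borel" by (rule sobolevD[OF u])
  note d = translation_estimate[OF s u, of "h i"]
  have "(\<integral>\<^sup>+ z. ennreal (min 1 ((norm (fst z - snd z))\<^sup>2) / norm (fst z - snd z) powr ?a * (u (snd z + h i) - u (snd z))\<^sup>2) \<partial>(lborel \<Otimes>\<^sub>M lborel))
      = (\<integral>\<^sup>+ k. (\<integral>\<^sup>+ x. ennreal (min 1 ((norm (x - (x + k)))\<^sup>2) / norm (x - (x + k)) powr ?a * (u (x + k + h i) - u (x + k))\<^sup>2) \<partial>lborel) \<partial>lborel)"
    by (rule nn_integral_shear) measurable
  also have "\<dots> = (\<integral>\<^sup>+ k. (\<integral>\<^sup>+ x. ennreal (?J k) * ennreal ((u (k + x + h i) - u (k + x))\<^sup>2) \<partial>lborel) \<partial>lborel)"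
    by (rule nn_integral_cong, rule nn_integral_cong, subst ennreal_mult[symmetric]) (auto simp: add.commute)
  also have "\<dots> = (\<integral>\<^sup>+ k. ennreal (?J k) * (\<integral>\<^sup>+ x. ennreal ((u (k + x + h i) - u (k + x))\<^sup>2) \<partial>lborel) \<partial>lborel)"
    by (rule nn_integral_cong, rule nn_integral_cmult) measurable
  also have "\<dots> = (\<integral>\<^sup>+ k. ennreal (?J k) * ennreal ((l2_norm (\<lambda>x. u (x + h i) - u x))\<^sup>2) \<partial>lborel)"
  proof (rule nn_integral_cong)
    fix k :: 'a
    have "(\<integral>\<^sup>+ x. ennreal ((u (k + x + h i) - u (k + x))\<^sup>2) \<partial>lborel) = (\<integral>\<^sup>+ x. ennreal ((u (x + h i) - u x)\<^sup>2) \<partial>lborel)"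
      by (rule nn_integral_lborel_translate) measurable
    then show "ennreal (?J k) * (\<integral>\<^sup>+ x. ennreal ((u (k + x + h i) - u (k + x))\<^sup>2) \<partial>lborel) = ennreal (?J k) * ennreal ((l2_norm (\<lambda>x. u (x + h i) - u x))\<^sup>2)"
      using nn_integral_l2_norm[OF d(1)] by simp
  qed
  also have "\<dots> = (\<integral>\<^sup>+ k. ennreal (?J k) \<partial>lborel) * ennreal ((l2_norm (\<lambda>x. u (x + h i) - u x))\<^sup>2)"
    by (rule nn_integral_multc) measurable
  also have "(\<integral>\<^sup>+ k. ennreal (?J k) \<partial>lborel) = ennreal (kernel_mass TYPE('a) s)"
    using truncated_kernel_integrable[OF s, where 'a='a] by (simp add: kernel_mass_def)
  also have "\<dots> * ennreal ((l2_norm (\<lambda>x. u (x + h i) - u x))\<^sup>2) = ennreal (kernel_mass TYPE('a) s * (l2_norm (\<lambda>x. u (x + h i) - u x))\<^sup>2)"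
    by (simp add: ennreal_mult kernel_mass_def)
  also have "\<dots> \<le> ennreal (kernel_mass TYPE('a) s * (4 / gagliardo_constant TYPE('a) s * t powr (2 * s) * energy s u))"
  proof (intro ennreal_leI mult_left_mono order_trans[OF d(2)] mult_right_mono powr_mono2)
    show "norm (h i) \<le> t" by (rule h_le[OF i])
  qed (use k0 s in \<open>auto simp: kernel_mass_def\<close>)
  finally show ?thesis .
qed

text \<open>The parameter \<open>\<eta>\<close> is still free; with \<open>\<eta> = t powr s\<close> both \<open>\<eta>\<close> and the commutator term
  \<open>t powr (2 * s) / \<eta>\<close> are of order \<open>t powr s\<close>.\<close>

lemma patchwork_energy:
  assumes s: "0 < s" "s < 1" and u: "u \<in> sobolev s" and \<eta>: "0 < \<eta>"
  shows "patchwork u \<in> sobolev s"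
    and "energy s (patchwork u) \<le> ((1 + \<eta>) * (1 + real (card I) * (L * t))
      + (1 + 1 / \<eta>) * real (card I) * L\<^sup>2 * (real (card I) * (kernel_mass TYPE('a) s * (4 / gagliardo_constant TYPE('a) s * t powr (2 * s))))) * energy s u"
proof -
  let ?n = "real (card I)"
  let ?q = "4 / gagliardo_constant TYPE('a) s * t powr (2 * s)"
  let ?F = "\<lambda>i z. \<phi> i (fst z) * gagliardo_integrand s (\<lambda>x. u (x + h i)) z"
  let ?G = "\<lambda>i z. min 1 ((norm (fst z - snd z))\<^sup>2) / norm (fst z - snd z) powr (real DIM('a) + 2 * s) * (u (snd z + h i) - u (snd z))\<^sup>2"
  \<comment> \<open>\<open>F\<close> collects the translated energies and \<open>G\<close> the commutators\<close>
  let ?c = "(1 + 1 / \<eta>) * ?n * L\<^sup>2"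
  let ?M = "lborel \<Otimes>\<^sub>M lborel :: ('a \<times> 'a) measure"
  have k0: "0 < gagliardo_constant TYPE('a) s" by (rule gagliardo_symbol_eq(2)[OF s])
  have [measurable]: "u \<in> borel_measurable borel" by (rule sobolevD[OF u])
  have F0: "0 \<le> ?F i z" if "i \<in> I" for i z
    using that by (simp add: \<phi>_nonneg gagliardo_integrand_nonneg)
  have G0: "0 \<le> ?G i z" for i z by simp
  have c0: "0 \<le> ?c" using \<eta> by simp
  have mF[measurable]: "?F i \<in> borel_measurable ?M" if "i \<in> I" for i
    using measurable_\<phi>[OF that] by measurable
  have mG[measurable]: "?G i \<in> borel_measurable ?M" for i by measurable
  have SF: "(\<Sum>i\<in>I. \<integral>\<^sup>+ z. ennreal (?F i z) \<partial>?M) \<le> ennreal ((1 + ?n * (L * t)) * energy s u)"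
  proof -
    have "(\<Sum>i\<in>I. \<integral>\<^sup>+ z. ennreal (?F i z) \<partial>?M) \<le> (\<Sum>i\<in>I. \<integral>\<^sup>+ z. ennreal ((\<phi> i (fst z) + L * t) * gagliardo_integrand s u z) \<partial>?M)"
      by (intro sum_mono nn_integral_weighted_translate u)
    also have "\<dots> = (\<integral>\<^sup>+ z. (\<Sum>i\<in>I. ennreal ((\<phi> i (fst z) + L * t) * gagliardo_integrand s u z)) \<partial>?M)"
      by (rule nn_integral_sum[symmetric]) measurable
    also have "\<dots> = (\<integral>\<^sup>+ z. ennreal (1 + ?n * (L * t)) * ennreal (gagliardo_integrand s u z) \<partial>?M)"
    proof (rule nn_integral_cong)
      fix z
      have "(\<Sum>i\<in>I. ennreal ((\<phi> i (fst z) + L * t) * gagliardo_integrand s u z)) = ennreal (\<Sum>i\<in>I. (\<phi> i (fst z) + L * t) * gagliardo_integrand s u z)"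
        using L_ge_1 t_pos by (intro sum_ennreal mult_nonneg_nonneg) (auto simp: \<phi>_nonneg gagliardo_integrand_nonneg)
      also have "(\<Sum>i\<in>I. (\<phi> i (fst z) + L * t) * gagliardo_integrand s u z) = (1 + ?n * (L * t)) * gagliardo_integrand s u z"
        by (simp add: sum_distrib_right[symmetric] sum.distrib \<phi>_sum)
      finally show "(\<Sum>i\<in>I. ennreal ((\<phi> i (fst z) + L * t) * gagliardo_integrand s u z)) = ennreal (1 + ?n * (L * t)) * ennreal (gagliardo_integrand s u z)"
        using L_ge_1 t_pos by (simp add: ennreal_mult gagliardo_integrand_nonneg)
    qed
    also have "\<dots> = ennreal (1 + ?n * (L * t)) * ennreal (energy s u)"
      unfolding nn_integral_energy[OF u, symmetric] by (rule nn_integral_cmult) measurable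
    also have "\<dots> = ennreal ((1 + ?n * (L * t)) * energy s u)"
      using L_ge_1 t_pos by (intro ennreal_mult[symmetric]) auto
    finally show ?thesis .
  qed
  have SG: "(\<Sum>i\<in>I. \<integral>\<^sup>+ z. ennreal (?G i z) \<partial>?M) \<le> ennreal (?n * (kernel_mass TYPE('a) s * (?q * energy s u)))"
  proof -
    have "(\<Sum>i\<in>I. \<integral>\<^sup>+ z. ennreal (?G i z) \<partial>?M) \<le> (\<Sum>i\<in>I. ennreal (kernel_mass TYPE('a) s * (?q * energy s u)))"
      by (intro sum_mono nn_integral_commutator s u)
    also have "\<dots> = ennreal (\<Sum>i\<in>I. kernel_mass TYPE('a) s * (?q * energy s u))"
      using k0 by (intro sum_ennreal) (simp add: kernel_mass_def)
    finally show ?thesis by simp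
  qed
  have "(\<integral>\<^sup>+ z. ennreal (gagliardo_integrand s (patchwork u) z) \<partial>?M)
      \<le> (\<integral>\<^sup>+ z. ennreal (1 + \<eta>) * (\<Sum>i\<in>I. ennreal (?F i z)) + ennreal ?c * (\<Sum>i\<in>I. ennreal (?G i z)) \<partial>?M)"
  proof (rule nn_integral_mono)
    fix z :: "'a \<times> 'a"
    have "gagliardo_integrand s (patchwork u) z \<le> (1 + \<eta>) * (\<Sum>i\<in>I. ?F i z) + ?c * (\<Sum>i\<in>I. ?G i z)"
      using patchwork_integrand_le[OF \<eta>, of s u "fst z" "snd z"] by simp
    then have "ennreal (gagliardo_integrand s (patchwork u) z) \<le> ennreal ((1 + \<eta>) * (\<Sum>i\<in>I. ?F i z) + ?c * (\<Sum>i\<in>I. ?G i z))"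
      by (rule ennreal_leI)
    also have "\<dots> = ennreal ((1 + \<eta>) * (\<Sum>i\<in>I. ?F i z)) + ennreal (?c * (\<Sum>i\<in>I. ?G i z))"
      using \<eta> by (intro ennreal_plus mult_nonneg_nonneg sum_nonneg) (auto simp: \<phi>_nonneg gagliardo_integrand_nonneg)
    also have "ennreal ((1 + \<eta>) * (\<Sum>i\<in>I. ?F i z)) = ennreal (1 + \<eta>) * (\<Sum>i\<in>I. ennreal (?F i z))"
      using \<eta> by (subst ennreal_mult) (auto intro!: sum_nonneg mult_nonneg_nonneg simp: \<phi>_nonneg gagliardo_integrand_nonneg)
    also have "ennreal (?c * (\<Sum>i\<in>I. ?G i z)) = ennreal ?c * (\<Sum>i\<in>I. ennreal (?G i z))"
      using G0 c0 by (subst ennreal_mult) (auto intro: sum_nonneg simp del: times_divide_eq_left)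
    finally show "ennreal (gagliardo_integrand s (patchwork u) z)
        \<le> ennreal (1 + \<eta>) * (\<Sum>i\<in>I. ennreal (?F i z)) + ennreal ?c * (\<Sum>i\<in>I. ennreal (?G i z))" .
  qed
  also have "\<dots> = ennreal (1 + \<eta>) * (\<Sum>i\<in>I. \<integral>\<^sup>+ z. ennreal (?F i z) \<partial>?M) + ennreal ?c * (\<Sum>i\<in>I. \<integral>\<^sup>+ z. ennreal (?G i z) \<partial>?M)"
  proof -
    have 1: "(\<integral>\<^sup>+ z. ennreal (1 + \<eta>) * (\<Sum>i\<in>I. ennreal (?F i z)) \<partial>?M) = ennreal (1 + \<eta>) * (\<Sum>i\<in>I. \<integral>\<^sup>+ z. ennreal (?F i z) \<partial>?M)"
    proof -
      have "(\<integral>\<^sup>+ z. ennreal (1 + \<eta>) * (\<Sum>i\<in>I. ennreal (?F i z)) \<partial>?M) = ennreal (1 + \<eta>) * (\<integral>\<^sup>+ z. (\<Sum>i\<in>I. ennreal (?F i z)) \<partial>?M)"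
        by (rule nn_integral_cmult) (intro borel_measurable_sum measurable_compose[OF mF measurable_ennreal])
      also have "(\<integral>\<^sup>+ z. (\<Sum>i\<in>I. ennreal (?F i z)) \<partial>?M) = (\<Sum>i\<in>I. \<integral>\<^sup>+ z. ennreal (?F i z) \<partial>?M)"
        by (rule nn_integral_sum) (intro measurable_compose[OF mF measurable_ennreal])
      finally show ?thesis .
    qed
    have 2: "(\<integral>\<^sup>+ z. ennreal ?c * (\<Sum>i\<in>I. ennreal (?G i z)) \<partial>?M) = ennreal ?c * (\<Sum>i\<in>I. \<integral>\<^sup>+ z. ennreal (?G i z) \<partial>?M)"
    proof -
      have "(\<integral>\<^sup>+ z. ennreal ?c * (\<Sum>i\<in>I. ennreal (?G i z)) \<partial>?M) = ennreal ?c * (\<integral>\<^sup>+ z. (\<Sum>i\<in>I. ennreal (?G i z)) \<partial>?M)"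
        by (rule nn_integral_cmult) (intro borel_measurable_sum measurable_compose[OF mG measurable_ennreal])
      also have "(\<integral>\<^sup>+ z. (\<Sum>i\<in>I. ennreal (?G i z)) \<partial>?M) = (\<Sum>i\<in>I. \<integral>\<^sup>+ z. ennreal (?G i z) \<partial>?M)"
        by (rule nn_integral_sum) (intro measurable_compose[OF mG measurable_ennreal])
      finally show ?thesis .
    qed
    show ?thesis
      unfolding 1[symmetric] 2[symmetric]
    proof (rule nn_integral_add)
      show "(\<lambda>z. ennreal (1 + \<eta>) * (\<Sum>i\<in>I. ennreal (?F i z))) \<in> borel_measurable ?M"
        by (intro borel_measurable_times_ennreal borel_measurable_const borel_measurable_sum measurable_compose[OF mF measurable_ennreal])
      show "(\<lambda>z. ennreal ?c * (\<Sum>i\<in>I. ennreal (?G i z))) \<in> borel_measurable ?M"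
        by (intro borel_measurable_times_ennreal borel_measurable_const borel_measurable_sum measurable_compose[OF mG measurable_ennreal])
    qed
  qed
  also have "\<dots> \<le> ennreal (1 + \<eta>) * ennreal ((1 + ?n * (L * t)) * energy s u) + ennreal ?c * ennreal (?n * (kernel_mass TYPE('a) s * (?q * energy s u)))"
    by (intro add_mono mult_left_mono SF SG) auto
  also have "\<dots> = ennreal ((1 + \<eta>) * ((1 + ?n * (L * t)) * energy s u) + ?c * (?n * (kernel_mass TYPE('a) s * (?q * energy s u))))"
  proof -
    have 1: "0 \<le> (1 + ?n * (L * t)) * energy s u" using L_ge_1 t_pos by simp
    have 2: "0 \<le> ?n * (kernel_mass TYPE('a) s * (?q * energy s u))"
      using k0 by (simp add: kernel_mass_def)
    have "ennreal (1 + \<eta>) * ennreal ((1 + ?n * (L * t)) * energy s u) = ennreal ((1 + \<eta>) * ((1 + ?n * (L * t)) * energy s u))"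
      using \<eta> by (intro ennreal_mult[symmetric] 1) simp
    moreover have "ennreal ?c * ennreal (?n * (kernel_mass TYPE('a) s * (?q * energy s u))) = ennreal (?c * (?n * (kernel_mass TYPE('a) s * (?q * energy s u))))"
      by (rule ennreal_mult[OF c0 2, symmetric])
    ultimately show ?thesis
      using mult_nonneg_nonneg[OF _ 1, of "1 + \<eta>"] mult_nonneg_nonneg[OF c0 2] \<eta>
      by (simp only: ennreal_plus add_nonneg_nonneg zero_le_one less_imp_le)
  qed
  also have "(1 + \<eta>) * ((1 + ?n * (L * t)) * energy s u) + ?c * (?n * (kernel_mass TYPE('a) s * (?q * energy s u)))
      = ((1 + \<eta>) * (1 + ?n * (L * t)) + ?c * (?n * (kernel_mass TYPE('a) s * ?q))) * energy s u"
    by (simp only: distrib_right mult.assoc)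
  finally have le: "(\<integral>\<^sup>+ z. ennreal (gagliardo_integrand s (patchwork u) z) \<partial>?M)
      \<le> ennreal (((1 + \<eta>) * (1 + ?n * (L * t)) + ?c * (?n * (kernel_mass TYPE('a) s * ?q))) * energy s u)" .
  have "square_integrable (\<lambda>x. (patchwork u x - u x) + u x)"
    by (rule square_integrable_add(1)[OF patchwork_L2(1)[OF s u] sobolevD(1)[OF u]])
  then have sq: "square_integrable (patchwork u)" by simp
  show P: "patchwork u \<in> sobolev s"
    by (rule sobolevI[OF sq]) (rule le_less_trans[OF le], simp)
  have "0 \<le> ((1 + \<eta>) * (1 + ?n * (L * t)) + ?c * (?n * (kernel_mass TYPE('a) s * ?q))) * energy s u"
    using \<eta> c0 k0 L_ge_1 t_pos
    by (intro mult_nonneg_nonneg add_nonneg_nonneg) (auto simp: kernel_mass_def)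
  then show "energy s (patchwork u) \<le> ((1 + \<eta>) * (1 + ?n * (L * t)) + ?c * (?n * (kernel_mass TYPE('a) s * ?q))) * energy s u"
    using le unfolding nn_integral_energy[OF P] by (subst (asm) ennreal_le_iff) auto
qed

end

section \<open>Translations along cone directions\<close>

text \<open>The distance of the axis point \<open>t n\<close> to the boundary of the infinite cone is \<open>t sin \<theta>\<close>, and
  \<open>t < \<rho> / 2\<close> keeps the ball of this radius within distance \<open>\<rho>\<close> of the apex.\<close>

lemma perturbed_axis_in_open_cone:
  fixes n q :: "'a::euclidean_space"
  assumes n: "norm n = 1" and q: "norm q < t * sin \<theta>" and t: "0 < t" "t < \<rho> / 2"
    and \<theta>: "0 < \<theta>" "\<theta> < pi / 2"
  shows "t *\<^sub>R n + q \<in> open_cone \<rho> \<theta> n"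
proof -
  let ?v = "t *\<^sub>R n + q"
  have c: "0 < cos \<theta>" using \<theta> by (intro cos_gt_zero_pi) auto
  have nn: "n \<bullet> n = 1" using n by (simp add: norm_eq_sqrt_inner)
  have "(norm q)\<^sup>2 < (t * sin \<theta>)\<^sup>2" using q by (intro power_strict_mono) auto
  also have "\<dots> = t\<^sup>2 - (t * cos \<theta>)\<^sup>2"
    by (simp add: power_mult_distrib sin_squared_eq algebra_simps)
  finally have q2: "(norm q)\<^sup>2 < t\<^sup>2 - (t * cos \<theta>)\<^sup>2" .
  have "(norm q)\<^sup>2 = (norm ?v)\<^sup>2 - 2 * t * (?v \<bullet> n) + t\<^sup>2"
    unfolding power2_norm_eq_inner using nn
    by (simp add: inner_add_left inner_add_right inner_commute power2_eq_square algebra_simps)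
  moreover have "0 \<le> (norm ?v - t * cos \<theta>)\<^sup>2" by simp
  ultimately have "2 * t * (norm ?v * cos \<theta>) < 2 * t * (?v \<bullet> n)"
    using q2 by (simp add: power2_diff mult_ac)
  then have axis: "norm ?v * cos \<theta> < ?v \<bullet> n" using t by simp
  then have "?v \<noteq> 0" by auto
  have "t * sin \<theta> \<le> t * 1" using t by (intro mult_left_mono) auto
  moreover have "norm (t *\<^sub>R n) = t" using n t by simp
  ultimately have "norm ?v < \<rho>"
    using norm_triangle_ineq[of "t *\<^sub>R n" q] q t by linarith
  then show ?thesis using axis \<open>?v \<noteq> 0\<close> by (simp add: open_cone_def)
qed

lemma point_set_dist_less:
  assumes "point_set_dist x F + point_set_dist y G < ennreal T"
  obtains z w where "z \<in> F" "w \<in> G" "dist x z + dist y w < T"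
proof -
  let ?A = "point_set_dist x F" and ?B = "point_set_dist y G"
  have fin: "?A < top" "?B < top" using assms by (auto simp: less_top[symmetric])
  define a b where "a = enn2real ?A" and "b = enn2real ?B"
  have A: "?A = ennreal a" and B: "?B = ennreal b" and nn: "0 \<le> a" "0 \<le> b"
    using fin by (simp_all add: a_def b_def)
  have "a + b < T"
    using assms nn unfolding A B by (simp add: ennreal_less_iff flip: ennreal_plus)
  define e where "e = (T - a - b) / 2"
  have "0 < e" using \<open>a + b < T\<close> by (simp add: e_def)
  have "?A < ennreal (a + e)" "?B < ennreal (b + e)"
    using nn \<open>0 < e\<close> unfolding A B by (simp_all add: ennreal_less_iff)
  then obtain z w where "z \<in> F" "ennreal (dist x z) < ennreal (a + e)" "w \<in> G" "ennreal (dist y w) < ennreal (b + e)"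
    unfolding point_set_dist_def INF_less_iff by blast
  then have "dist x z < a + e" "dist y w < b + e" "z \<in> F" "w \<in> G"
    by (auto simp: ennreal_less_iff)
  moreover have "(a + e) + (b + e) = T" by (simp add: e_def field_simps)
  ultimately show ?thesis
    by (intro that[of z w]) auto
qed

lemma point_set_dist_self: "x \<in> F \<Longrightarrow> point_set_dist x F = 0"
  unfolding point_set_dist_def by (rule antisym, rule INF_lower2[of x]) auto

lemma point_set_dist_le_excess: "x \<in> E \<Longrightarrow> point_set_dist x F \<le> excess E F"
  unfolding excess_def by (rule SUP_upper)

text \<open>Suppose the translate of \<open>x\<close> lay in the union. Then there are \<open>w \<in> \<Omega>\<^sub>a\<close> near \<open>x + t n\<close> (up to the
  excess of \<open>\<Omega>\<^sub>b\<close> over \<open>\<Omega>\<^sub>a\<close>) and \<open>z \<notin> \<Omega>\<^sub>a\<close> near \<open>x\<close> (up to the excess of the complements). The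
  total error is below \<open>t sin \<theta>\<close>, so \<open>w - z\<close> lies in the cone, and the cone condition at \<open>z\<close>
  forces \<open>w \<notin> \<Omega>\<^sub>a\<close>.\<close>

lemma cone_translation_leaves_union:
  assumes n: "n \<in> cone_directions \<rho> \<theta> c \<Omega>\<^sub>a" and \<theta>: "0 < \<theta>" "\<theta> < pi / 2"
    and t: "0 < t" "t < \<rho> / 2" and dev: "set_deviation \<Omega>\<^sub>b \<Omega>\<^sub>a < ennreal (t * sin \<theta>)"
    and x: "x \<in> ball c \<rho>" "x \<notin> \<Omega>\<^sub>a \<inter> \<Omega>\<^sub>b"
  shows "x + t *\<^sub>R n \<notin> \<Omega>\<^sub>a \<union> \<Omega>\<^sub>b"
proof
  assume y: "x + t *\<^sub>R n \<in> \<Omega>\<^sub>a \<union> \<Omega>\<^sub>b"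
  have 1: "point_set_dist x (- \<Omega>\<^sub>a) \<le> excess (- \<Omega>\<^sub>b) (- \<Omega>\<^sub>a)"
    using x(2) point_set_dist_self[of x "- \<Omega>\<^sub>a"] by (cases "x \<in> \<Omega>\<^sub>a") (auto intro: point_set_dist_le_excess)
  have 2: "point_set_dist (x + t *\<^sub>R n) \<Omega>\<^sub>a \<le> excess \<Omega>\<^sub>b \<Omega>\<^sub>a"
    using y point_set_dist_self[of "x + t *\<^sub>R n" "\<Omega>\<^sub>a"] by (cases "x + t *\<^sub>R n \<in> \<Omega>\<^sub>a") (auto intro: point_set_dist_le_excess)
  have "point_set_dist x (- \<Omega>\<^sub>a) + point_set_dist (x + t *\<^sub>R n) \<Omega>\<^sub>a \<le> set_deviation \<Omega>\<^sub>b \<Omega>\<^sub>a"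
    unfolding set_deviation_def complementary_excess_def using add_mono[OF 1 2] by (simp add: add.commute)
  then have "point_set_dist x (- \<Omega>\<^sub>a) + point_set_dist (x + t *\<^sub>R n) \<Omega>\<^sub>a < ennreal (t * sin \<theta>)"
    using dev by (rule le_less_trans)
  then obtain z w where z: "z \<in> - \<Omega>\<^sub>a" and w: "w \<in> \<Omega>\<^sub>a" and zw: "dist x z + dist (x + t *\<^sub>R n) w < t * sin \<theta>"
    by (rule point_set_dist_less)
  define q where "q = (x - z) + (w - (x + t *\<^sub>R n))"
  have "norm q \<le> dist x z + dist (x + t *\<^sub>R n) w"
    unfolding q_def dist_norm using norm_triangle_ineq[of "x - z" "w - (x + t *\<^sub>R n)"] by (simp add: norm_minus_commute)
  then have q: "norm q < t * sin \<theta>" using zw by simp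
  have "t *\<^sub>R n + q \<in> open_cone \<rho> \<theta> n"
    using n by (intro perturbed_axis_in_open_cone q t \<theta>) (simp add: cone_directions_def)
  moreover have "z \<in> ball c (3 * \<rho>) - \<Omega>\<^sub>a"
  proof -
    have "t * sin \<theta> \<le> t * 1" using t by (intro mult_left_mono) auto
    then have "dist x z < \<rho>" using zw zero_le_dist[of "x + t *\<^sub>R n" w] t by linarith
    then have "dist c z < 3 * \<rho>"
      using x(1) dist_triangle[of c z x] t by (simp add: dist_commute)
    then show ?thesis using z by simp
  qed
  ultimately have "z + (t *\<^sub>R n + q) \<in> - \<Omega>\<^sub>a"
    using n by (auto simp: cone_directions_def)
  then show False using w by (simp add: q_def)
qed

section \<open>A partition of unity subordinate to finitely many balls\<close>

text \<open>The index \<open>None\<close> stands for the region away from the ball of radius \<open>R\<close>, where functions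
  are left untranslated. The tent functions \<open>\<psi> p\<close> are normalised by \<open>max S (1/2)\<close> instead of their sum \<open>S\<close>: the
  two agree on the ball, and the denominator stays bounded below everywhere, which makes the
  quotients globally Lipschitz. The data do not depend on a domain; only \<open>R\<close> and \<open>\<rho>\<close> enter.\<close>

lemma exists_partition_of_unity:
  fixes R \<rho> :: real
  assumes "0 < \<rho>"
  obtains P :: "'a::euclidean_space set" and L :: real and \<phi> :: "'a option \<Rightarrow> 'a \<Rightarrow> real"
  where "finite P" "1 \<le> L"
    "\<And>i x. i \<in> insert None (Some ` P) \<Longrightarrow> 0 \<le> \<phi> i x"
    "\<And>x. (\<Sum>i\<in>insert None (Some ` P). \<phi> i x) = 1"
    "\<And>i x y. i \<in> insert None (Some ` P) \<Longrightarrow> \<bar>\<phi> i x - \<phi> i y\<bar> \<le> L * norm (x - y)"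
    "\<And>p x. p \<in> P \<Longrightarrow> \<phi> (Some p) x \<noteq> 0 \<Longrightarrow> x \<in> ball p \<rho>"
    "\<And>x. norm x < R \<Longrightarrow> \<phi> None x = 0"
proof -
  have "compact (cball (0::'a) R)" by simp
  then obtain P where P: "P \<subseteq> cball (0::'a) R" "finite P" "cball 0 R \<subseteq> (\<Union>p\<in>P. ball p (\<rho> / 2))"
  proof (rule compactE_image[where C="cball 0 R" and f="\<lambda>p. ball p (\<rho> / 2)"])
    show "cball (0::'a) R \<subseteq> (\<Union>c\<in>cball 0 R. ball c (\<rho> / 2))"
      using \<open>0 < \<rho>\<close> by force
  qed auto
  let ?n = "real (card P)"
  define \<psi> where "\<psi> p x = max 0 (1 - norm (x - p) / \<rho>)" for p x :: 'a
  define S where "S x = (\<Sum>p\<in>P. \<psi> p x)" for x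
  define M where "M x = max (S x) (1 / 2)" for x
  define \<phi> where "\<phi> i x = (case i of Some p \<Rightarrow> \<psi> p x / M x | None \<Rightarrow> 1 - S x / M x)" for i x
  define K where "K = (2 + 2 * ?n) / \<rho>"
  define L where "L = max 1 ((?n + 1) * K)"
  have K0: "0 \<le> K" using \<open>0 < \<rho>\<close> by (simp add: K_def)
  have \<psi>0: "0 \<le> \<psi> p x" for p x by (simp add: \<psi>_def)
  have M: "1 / 2 \<le> M x" "S x \<le> M x" for x by (simp_all add: M_def)
  have \<psi>S: "\<psi> p x \<le> S x" if "p \<in> P" for p x
    unfolding S_def using that P(2) \<psi>0 by (intro member_le_sum) auto
  have S0: "0 \<le> S x" for x unfolding S_def by (intro sum_nonneg \<psi>0)
  have lip\<psi>: "\<bar>\<psi> p x - \<psi> p y\<bar> \<le> norm (x - y) / \<rho>" for p x y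
  proof -
    have "\<bar>norm (x - p) - norm (y - p)\<bar> \<le> norm (x - y)"
      using norm_triangle_ineq3[of "x - p" "y - p"] by simp
    then have "\<bar>norm (x - p) / \<rho> - norm (y - p) / \<rho>\<bar> \<le> norm (x - y) / \<rho>"
      using \<open>0 < \<rho>\<close> by (simp add: diff_divide_distrib[symmetric] divide_right_mono)
    then show ?thesis unfolding \<psi>_def by linarith
  qed
  have lipS: "\<bar>S x - S y\<bar> \<le> ?n * (norm (x - y) / \<rho>)" for x y
  proof -
    have "\<bar>S x - S y\<bar> \<le> (\<Sum>p\<in>P. \<bar>\<psi> p x - \<psi> p y\<bar>)"
      unfolding S_def sum_subtractf[symmetric] by (rule sum_abs)
    also have "\<dots> \<le> (\<Sum>p\<in>P. norm (x - y) / \<rho>)" by (intro sum_mono lip\<psi>)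
    finally show ?thesis by simp
  qed
  have lipM: "\<bar>M x - M y\<bar> \<le> ?n * (norm (x - y) / \<rho>)" for x y
    using lipS[of x y] unfolding M_def by linarith
  have quot: "\<bar>\<psi> p x / M x - \<psi> p y / M y\<bar> \<le> K * norm (x - y)" if "p \<in> P" for p x y
  proof -
    have Mx: "0 < M x" and My: "0 < M y" using M(1)[of x] M(1)[of y] by linarith+
    have "\<psi> p x / M x - \<psi> p y / M y = (\<psi> p x - \<psi> p y) / M x + (\<psi> p y / M y) * ((M y - M x) / M x)"
      using Mx My by (simp add: field_simps)
    then have "\<bar>\<psi> p x / M x - \<psi> p y / M y\<bar> \<le> \<bar>(\<psi> p x - \<psi> p y) / M x\<bar> + \<bar>(\<psi> p y / M y) * ((M y - M x) / M x)\<bar>"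
      by (simp only: abs_triangle_ineq)
    also have "\<bar>(\<psi> p y / M y) * ((M y - M x) / M x)\<bar> \<le> 1 * \<bar>(M y - M x) / M x\<bar>"
      unfolding abs_mult
    proof (rule mult_right_mono)
      have "\<psi> p y \<le> M y" using \<psi>S[OF that, of y] M(2)[of y] by linarith
      then show "\<bar>\<psi> p y / M y\<bar> \<le> 1" using My \<psi>0[of p y] by simp
    qed simp
    also have "\<bar>(\<psi> p x - \<psi> p y) / M x\<bar> \<le> 2 * \<bar>\<psi> p x - \<psi> p y\<bar>"
      using M(1)[of x] Mx mult_left_mono[of "1/2" "M x" "\<bar>\<psi> p x - \<psi> p y\<bar>"] by (simp add: field_simps)
    also have "1 * \<bar>(M y - M x) / M x\<bar> \<le> 2 * \<bar>M y - M x\<bar>"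
      using M(1)[of x] Mx mult_left_mono[of "1/2" "M x" "\<bar>M y - M x\<bar>"] by (simp add: field_simps)
    finally have "\<bar>\<psi> p x / M x - \<psi> p y / M y\<bar> \<le> 2 * \<bar>\<psi> p x - \<psi> p y\<bar> + 2 * \<bar>M y - M x\<bar>" by simp
    also have "\<dots> \<le> 2 * (norm (x - y) / \<rho>) + 2 * (?n * (norm (x - y) / \<rho>))"
      using lip\<psi>[of p x y] lipM[of x y] abs_minus_commute[of "M y" "M x"]
      by (intro add_mono mult_left_mono) auto
    also have "\<dots> = K * norm (x - y)" by (simp add: K_def add_divide_distrib algebra_simps)
    finally show ?thesis .
  qed
  have sum_Some: "(\<Sum>i\<in>Some ` P. \<phi> i x) = S x / M x" for x
    by (subst sum.reindex) (auto simp: \<phi>_def S_def sum_divide_distrib)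
  show ?thesis
  proof (rule that[of P L \<phi>])
    show "finite P" by (rule P(2))
    show "1 \<le> L" by (simp add: L_def)
    show "0 \<le> \<phi> i x" if "i \<in> insert None (Some ` P)" for i x
    proof -
      have "S x / M x \<le> 1" using M[of x] by (simp add: divide_le_eq)
      moreover have "0 \<le> \<psi> p x / M x" for p using \<psi>0[of p x] M(1)[of x] by simp
      ultimately show ?thesis by (auto simp: \<phi>_def split: option.split)
    qed
    show "(\<Sum>i\<in>insert None (Some ` P). \<phi> i x) = 1" for x
    proof -
      have "(\<Sum>i\<in>insert None (Some ` P). \<phi> i x) = \<phi> None x + (\<Sum>i\<in>Some ` P. \<phi> i x)"
        using P(2) by (subst sum.insert) auto
      then show ?thesis unfolding sum_Some by (simp add: \<phi>_def)
    qed
    show "\<bar>\<phi> i x - \<phi> i y\<bar> \<le> L * norm (x - y)" if "i \<in> insert None (Some ` P)" for i x y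
    proof (cases i)
      case None
      have "\<bar>\<phi> i x - \<phi> i y\<bar> = \<bar>\<Sum>p\<in>P. \<psi> p x / M x - \<psi> p y / M y\<bar>"
        using None by (simp add: \<phi>_def S_def sum_divide_distrib sum_subtractf abs_minus_commute)
      also have "\<dots> \<le> (\<Sum>p\<in>P. \<bar>\<psi> p x / M x - \<psi> p y / M y\<bar>)" by (rule sum_abs)
      also have "\<dots> \<le> (\<Sum>p\<in>P. K * norm (x - y))" by (intro sum_mono quot)
      also have "\<dots> \<le> (?n + 1) * K * norm (x - y)" using K0 by (simp add: algebra_simps)
      also have "\<dots> \<le> L * norm (x - y)" by (intro mult_right_mono) (auto simp: L_def)
      finally show ?thesis .
    next
      case (Some p)
      then have "\<bar>\<phi> i x - \<phi> i y\<bar> \<le> K * norm (x - y)"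
        using that quot[of p x y] by (auto simp: \<phi>_def)
      also have "\<dots> \<le> (?n + 1) * K * norm (x - y)" using K0 by (simp add: algebra_simps)
      also have "\<dots> \<le> L * norm (x - y)" by (intro mult_right_mono) (auto simp: L_def)
      finally show ?thesis .
    qed
    show "x \<in> ball p \<rho>" if "p \<in> P" "\<phi> (Some p) x \<noteq> 0" for p x
    proof -
      have "\<psi> p x \<noteq> 0" using that by (auto simp: \<phi>_def)
      then have "norm (x - p) / \<rho> < 1" unfolding \<psi>_def by linarith
      then show ?thesis using \<open>0 < \<rho>\<close> by (simp add: dist_norm norm_minus_commute)
    qed
    show "\<phi> None x = 0" if "norm x < R" for x
    proof -
      have "x \<in> cball 0 R" using that by simp
      then obtain p where p: "p \<in> P" "norm (x - p) < \<rho> / 2"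
        using P(3) by (auto simp: dist_norm norm_minus_commute)
      then have "1 / 2 \<le> \<psi> p x" using \<open>0 < \<rho>\<close> by (simp add: \<psi>_def field_simps)
      then have "1 / 2 \<le> S x" using \<psi>S[OF p(1), of x] by linarith
      then show ?thesis by (simp add: \<phi>_def M_def)
    qed
  qed
qed

section \<open>Dual norms and the variational identity\<close>

lemma dual_pairing_le: 
  assumes "square_integrable f" "square_integrable v"
  shows "\<bar>dual_pairing f v\<bar> \<le> l2_norm f * l2_norm v"
  using l2_pairing(2)[OF assms] by (simp add: dual_pairing_def)

lemma sobolev_norm_nonneg [simp]: "0 \<le> sobolev_norm s v"
  by (simp add: sobolev_norm_def)

lemma l2_norm_le_sobolev_norm: "l2_norm v \<le> sobolev_norm s v"
  unfolding sobolev_norm_def by (rule real_le_rsqrt) simp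

lemma zero_sobolev: "(\<lambda>x. 0) \<in> sobolev s"
  by (simp add: sobolev_def square_integrable_def gagliardo_integrand_def split_beta')

lemma dual_sobolev_norm_bounds:
  assumes f: "square_integrable f"
  shows "\<And>v. v \<in> sobolev s \<Longrightarrow> sobolev_norm s v \<le> 1 \<Longrightarrow> \<bar>dual_pairing f v\<bar> \<le> dual_sobolev_norm s f"
    and "0 \<le> dual_sobolev_norm s f" and "dual_sobolev_norm s f \<le> l2_norm f"
proof -
  let ?U = "{v. v \<in> sobolev s \<and> sobolev_norm s v \<le> 1} :: ('a \<Rightarrow> real) set"
  have le: "\<bar>dual_pairing f v\<bar> \<le> l2_norm f" if "v \<in> ?U" for v
  proof -
    have "\<bar>dual_pairing f v\<bar> \<le> l2_norm f * l2_norm v"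
      using that by (intro dual_pairing_le f sobolevD) auto
    also have "\<dots> \<le> l2_norm f * 1"
      using that l2_norm_le_sobolev_norm[of v s] by (intro mult_left_mono) auto
    finally show ?thesis by simp
  qed
  have bdd: "bdd_above ((\<lambda>v. \<bar>dual_pairing f v\<bar>) ` ?U)"
    by (rule bdd_aboveI2[of _ _ "l2_norm f"]) (rule le)
  show ub: "\<bar>dual_pairing f v\<bar> \<le> dual_sobolev_norm s f" if "v \<in> sobolev s" "sobolev_norm s v \<le> 1" for v
    unfolding dual_sobolev_norm_def using that by (intro cSUP_upper bdd) auto
  have "energy s (\<lambda>x::'a. 0) = 0"
    using energy_scale[of s 0 "\<lambda>x::'a. 0"] by simp
  then have 0: "sobolev_norm s (\<lambda>x::'a. 0) \<le> 1"
    by (simp add: sobolev_norm_def l2_norm_def)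
  show "0 \<le> dual_sobolev_norm s f"
    using order_trans[OF abs_ge_zero ub[OF zero_sobolev 0]] .
  show "dual_sobolev_norm s f \<le> l2_norm f"
    unfolding dual_sobolev_norm_def by (rule cSUP_least) (use zero_sobolev 0 le in auto)
qed

lemma dual_pairing_le_dual_sobolev_norm:
  assumes f: "square_integrable f" and v: "v \<in> sobolev s"
  shows "\<bar>dual_pairing f v\<bar> \<le> dual_sobolev_norm s f * sobolev_norm s v"
proof (cases "sobolev_norm s v = 0")
  case True
  then have "l2_norm v = 0" using l2_norm_le_sobolev_norm[of v s] l2_norm_nonneg[of v] by linarith
  then show ?thesis using dual_pairing_le[OF f sobolevD(1)[OF v]] True by simp
next
  case False
  let ?N = "sobolev_norm s v"
  have N: "0 < ?N" using False sobolev_norm_nonneg[of s v] by linarith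
  let ?w = "\<lambda>x. (1 / ?N) * v x"
  have w: "?w \<in> sobolev s" using sobolev_lincomb[OF v v, of "1 / ?N" 0] by simp
  have "(l2_norm ?w)\<^sup>2 = (1 / ?N)\<^sup>2 * (l2_norm v)\<^sup>2"
    unfolding l2_norm_power2 by (simp add: power_mult_distrib power_divide)
  then have "sobolev_norm s ?w = sqrt ((1 / ?N)\<^sup>2 * ((l2_norm v)\<^sup>2 + energy s v))"
    unfolding sobolev_norm_def energy_scale by (simp add: distrib_left)
  also have "\<dots> = (1 / ?N) * ?N"
    unfolding real_sqrt_mult using N by (simp add: sobolev_norm_def)
  finally have "\<bar>dual_pairing f ?w\<bar> \<le> dual_sobolev_norm s f"
    using N by (intro dual_sobolev_norm_bounds(1)[OF f w]) simp
  moreover have "dual_pairing f ?w = dual_pairing f v / ?N"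
    unfolding dual_pairing_def by (simp add: field_simps)
  ultimately have "\<bar>dual_pairing f v\<bar> / ?N \<le> dual_sobolev_norm s f"
    using N by (simp only: abs_divide abs_of_pos)
  then show ?thesis by (simp only: pos_divide_le_eq[OF N])
qed

lemma dual_pairing_lincomb:
  assumes f: "square_integrable f" and u: "square_integrable u" and v: "square_integrable v"
  shows "dual_pairing f (\<lambda>x. a * u x + b * v x) = a * dual_pairing f u + b * dual_pairing f v"
proof -
  have "dual_pairing f (\<lambda>x. a * u x + b * v x) = (LINT x|lborel. a * (f x * u x) + b * (f x * v x))"
    unfolding dual_pairing_def by (simp add: algebra_simps)
  then show ?thesis
    using l2_pairing(1)[OF f u] l2_pairing(1)[OF f v] by (simp add: dual_pairing_def)
qed

lemma sobolev_zeroD: "v \<in> sobolev_zero s \<Omega> \<Longrightarrow> v \<in> sobolev s"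
  by (simp add: sobolev_zero_def)

text \<open>The weak formulation in terms of energies. The first identity says that \<open>v \<mapsto> E v - 2 \<kappa> \<langle>f, v\<rangle>\<close> exceeds
  its minimum \<open>- E u\<close> by exactly \<open>E (u - v)\<close>.\<close>

lemma weak_solution_energy:
  fixes u v :: "'a::euclidean_space \<Rightarrow> real"
  assumes s: "0 < s" "s < 1" and w: "weak_solution s \<Omega> f u" and v: "v \<in> sobolev_zero s \<Omega>"
  defines "\<kappa> \<equiv> gagliardo_constant TYPE('a) s"
  shows "energy s v - 2 * \<kappa> * dual_pairing f v = energy s (\<lambda>x. u x - v x) - energy s u"
    and "energy s u = \<kappa> * dual_pairing f u"
proof -
  have k0: "0 < \<kappa>" unfolding \<kappa>_def by (rule gagliardo_symbol_eq(2)[OF s])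
  have uz: "u \<in> sobolev_zero s \<Omega>" using w by (simp add: weak_solution_def)
  note u = sobolev_zeroD[OF uz]
  have pair: "energy s (\<lambda>x. u x + v x) - energy s (\<lambda>x. u x - v x) = 4 * \<kappa> * dual_pairing f v"
    if v: "v \<in> sobolev_zero s \<Omega>" for v
  proof -
    have "complex_of_real ((energy s (\<lambda>x. u x + v x) - energy s (\<lambda>x. u x - v x)) / (4 * \<kappa>)) = complex_of_real (dual_pairing f v)"
      using w v unfolding \<kappa>_def half_frac_laplacian_pairing[OF s u sobolev_zeroD[OF v], symmetric]
      by (simp add: weak_solution_def)
    then have "(energy s (\<lambda>x. u x + v x) - energy s (\<lambda>x. u x - v x)) / (4 * \<kappa>) = dual_pairing f v"
      by (simp only: of_real_eq_iff)
    then show ?thesis using k0 by (simp add: field_simps)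
  qed
  show "energy s v - 2 * \<kappa> * dual_pairing f v = energy s (\<lambda>x. u x - v x) - energy s u"
    using pair[OF v] energy_parallelogram[OF u sobolev_zeroD[OF v]] by simp
  have "energy s (\<lambda>x. u x + u x) = 4 * energy s u"
  proof -
    have "(\<lambda>x. u x + u x) = (\<lambda>x. 2 * u x)" by auto
    then show ?thesis by (simp only: energy_scale) simp
  qed
  moreover have "energy s (\<lambda>x. u x - u x) = 0"
    using energy_scale[of s 0 u] by simp
  ultimately show "energy s u = \<kappa> * dual_pairing f u"
    using pair[OF uz] by simp
qed

text \<open>Test with the solution itself; the Poincare inequality bounds its Sobolev norm by its seminorm.\<close>

lemma weak_solution_bound:
  fixes u :: "'a::euclidean_space \<Rightarrow> real"
  assumes s: "0 < s" "s < 1" and f: "square_integrable f" and w: "weak_solution s \<Omega> f u"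
    and \<Omega>: "\<Omega> \<subseteq> ball c r" and "0 < r"
  defines "\<kappa> \<equiv> gagliardo_constant TYPE('a) s"
  shows "gagliardo_seminorm s u \<le> \<kappa> * sqrt (1 + 4 / \<kappa> * (2 * r) powr (2 * s)) * dual_sobolev_norm s f"
proof -
  have k0: "0 < \<kappa>" unfolding \<kappa>_def by (rule gagliardo_symbol_eq(2)[OF s])
  have uz: "u \<in> sobolev_zero s \<Omega>" using w by (simp add: weak_solution_def)
  note u = sobolev_zeroD[OF uz]
  let ?q = "4 / \<kappa> * (2 * r) powr (2 * s)" and ?g = "gagliardo_seminorm s u" and ?F = "dual_sobolev_norm s f"
  have F0: "0 \<le> ?F" by (rule dual_sobolev_norm_bounds(2)[OF f])
  have "AE x in lborel. x \<notin> \<Omega> \<longrightarrow> u x = 0" using uz by (simp add: sobolev_zero_def)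
  then have "AE x in lborel. x \<notin> ball c r \<longrightarrow> u x = 0"
    by eventually_elim (use \<Omega> in auto)
  from poincare[OF s u this \<open>0 < r\<close>] have "(l2_norm u)\<^sup>2 \<le> ?q * ?g\<^sup>2" by (simp add: \<kappa>_def)
  then have "sobolev_norm s u \<le> sqrt ((1 + ?q) * ?g\<^sup>2)"
    unfolding sobolev_norm_def by (intro real_sqrt_le_mono) (simp add: algebra_simps)
  also have "\<dots> = sqrt (1 + ?q) * ?g" by (simp add: real_sqrt_mult)
  finally have N: "sobolev_norm s u \<le> sqrt (1 + ?q) * ?g" .
  have "?g\<^sup>2 = \<kappa> * dual_pairing f u"
    unfolding \<kappa>_def by (rule weak_solution_energy(2)[OF s w uz])
  also have "\<dots> \<le> \<kappa> * (?F * sobolev_norm s u)"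
    using dual_pairing_le_dual_sobolev_norm[OF f u] k0 by (intro mult_left_mono) auto
  also have "\<dots> \<le> \<kappa> * (?F * (sqrt (1 + ?q) * ?g))"
    using N F0 k0 by (intro mult_left_mono) auto
  finally have "?g * ?g \<le> (\<kappa> * sqrt (1 + ?q) * ?F) * ?g"
    by (simp add: power2_eq_square mult_ac)
  moreover have "0 \<le> \<kappa> * sqrt (1 + ?q) * ?F"
    using F0 k0 by simp
  ultimately show ?thesis
    using gagliardo_seminorm_nonneg[of s u] by (cases "?g = 0") (auto dest: mult_right_le_imp_le)
qed

section \<open>Stability at a fixed translation length\<close>

text \<open>The coefficient of \<open>t powr s\<close> in the energy bound of \<open>patchwork_energy\<close> with \<open>\<eta> = t powr s\<close>, for \<open>n\<close> patches
  with Lipschitz constant \<open>L\<close> and translations of length at most \<open>\<tau>\<close>.\<close>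

definition increment_constant :: "'a::euclidean_space itself \<Rightarrow> real \<Rightarrow> real \<Rightarrow> real \<Rightarrow> real \<Rightarrow> real" where
  "increment_constant T s \<tau> n L =
     1 + (1 + \<tau> powr s) * (n * L * \<tau> powr (1 - s)
       + n * L\<^sup>2 * (n * (kernel_mass T s * (4 / gagliardo_constant T s))))"

context translation_patchwork
begin

lemma patchwork_energy_increment:
  assumes s: "0 < s" "s < 1" and u: "u \<in> sobolev s" and "t \<le> \<tau>"
  shows "energy s (patchwork u) \<le> (1 + increment_constant TYPE('a) s \<tau> (real (card I)) L * t powr s) * energy s u"
proof -
  let ?n = "real (card I)" and ?\<eta> = "t powr s"
  let ?q = "kernel_mass TYPE('a) s * (4 / gagliardo_constant TYPE('a) s)"
  have k0: "0 < gagliardo_constant TYPE('a) s" by (rule gagliardo_symbol_eq(2)[OF s])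
  have q0: "0 \<le> ?q" using k0 by (simp add: kernel_mass_def)
  have \<eta>: "0 < ?\<eta>" using t_pos by simp
  have \<eta>\<tau>: "1 + ?\<eta> \<le> 1 + \<tau> powr s" using t_pos \<open>t \<le> \<tau>\<close> s by (simp add: powr_mono2)
  have tt: "t = t powr (1 - s) * ?\<eta>" using t_pos by (simp flip: powr_add)
  have t2: "t powr (2 * s) = ?\<eta> * ?\<eta>" by (simp flip: powr_add)
  have 1: "(1 + ?\<eta>) * (?n * (L * t)) \<le> (1 + \<tau> powr s) * (?n * L * \<tau> powr (1 - s)) * ?\<eta>"
  proof -
    have "?n * (L * t) = ?n * L * t powr (1 - s) * ?\<eta>" using tt by (simp add: mult.assoc)
    also have "\<dots> \<le> ?n * L * \<tau> powr (1 - s) * ?\<eta>"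
      using t_pos \<open>t \<le> \<tau>\<close> s L_ge_1 by (intro mult_right_mono mult_left_mono powr_mono2) auto
    finally have "?n * (L * t) \<le> ?n * L * \<tau> powr (1 - s) * ?\<eta>" .
    from mult_mono[OF \<eta>\<tau> this]
    have "(1 + ?\<eta>) * (?n * (L * t)) \<le> (1 + \<tau> powr s) * (?n * L * \<tau> powr (1 - s) * ?\<eta>)"
      using L_ge_1 t_pos by simp
    then show ?thesis by (simp only: mult.assoc)
  qed
  have 2: "(1 + 1 / ?\<eta>) * ?n * L\<^sup>2 * (?n * (kernel_mass TYPE('a) s * (4 / gagliardo_constant TYPE('a) s * t powr (2 * s))))
      \<le> (1 + \<tau> powr s) * (?n * L\<^sup>2 * (?n * ?q)) * ?\<eta>"
  proof -
    have "(1 + 1 / ?\<eta>) * ?n * L\<^sup>2 * (?n * (kernel_mass TYPE('a) s * (4 / gagliardo_constant TYPE('a) s * t powr (2 * s))))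
        = ((1 + 1 / ?\<eta>) * (?\<eta> * ?\<eta>)) * (?n * L\<^sup>2 * (?n * ?q))"
      unfolding t2 by (simp only: mult_ac)
    also have "(1 + 1 / ?\<eta>) * (?\<eta> * ?\<eta>) = (1 + ?\<eta>) * ?\<eta>"
      using \<eta> by (simp add: distrib_right)
    also have "(1 + ?\<eta>) * ?\<eta> * (?n * L\<^sup>2 * (?n * ?q)) \<le> (1 + \<tau> powr s) * ?\<eta> * (?n * L\<^sup>2 * (?n * ?q))"
      using \<eta>\<tau> \<eta> by (intro mult_right_mono mult_nonneg_nonneg[OF _ mult_nonneg_nonneg[OF _ q0]]) auto
    finally show ?thesis by (simp only: mult_ac)
  qed
  have "energy s (patchwork u) \<le> ((1 + ?\<eta>) * (1 + ?n * (L * t))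
      + (1 + 1 / ?\<eta>) * ?n * L\<^sup>2 * (?n * (kernel_mass TYPE('a) s * (4 / gagliardo_constant TYPE('a) s * t powr (2 * s))))) * energy s u"
    by (rule patchwork_energy(2)[OF s u \<eta>])
  also have "\<dots> \<le> (1 + increment_constant TYPE('a) s \<tau> ?n L * ?\<eta>) * energy s u"
  proof (rule mult_right_mono)
    have "(1 + ?\<eta>) * (1 + ?n * (L * t)) = 1 + ?\<eta> + (1 + ?\<eta>) * (?n * (L * t))"
      by (simp add: algebra_simps)
    then show "(1 + ?\<eta>) * (1 + ?n * (L * t))
      + (1 + 1 / ?\<eta>) * ?n * L\<^sup>2 * (?n * (kernel_mass TYPE('a) s * (4 / gagliardo_constant TYPE('a) s * t powr (2 * s))))
      \<le> 1 + increment_constant TYPE('a) s \<tau> ?n L * ?\<eta>"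
      using 1 2 unfolding increment_constant_def by (simp only: distrib_left distrib_right mult_1_left)
  qed simp
  finally show ?thesis .
qed

end

text \<open>Both solutions minimise their functional over sets that contain \<open>v\<close>. Adding the two minimality
  inequalities and comparing with the mean \<open>m\<close>, whose functional is computed by the parallelogram law,
  leaves exactly a multiple of \<open>E (u\<^sub>a - u\<^sub>b)\<close>.\<close>

lemma energy_gap:
  fixes u\<^sub>a u\<^sub>b v :: "'a::euclidean_space \<Rightarrow> real"
  assumes s: "0 < s" "s < 1" and f: "square_integrable f"
    and a: "weak_solution s \<Omega>\<^sub>a f u\<^sub>a" and b: "weak_solution s \<Omega>\<^sub>b f u\<^sub>b"
    and v: "v \<in> sobolev_zero s \<Omega>\<^sub>a" "v \<in> sobolev_zero s \<Omega>\<^sub>b"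
  defines "\<kappa> \<equiv> gagliardo_constant TYPE('a) s" and "m \<equiv> \<lambda>x. (1/2) * u\<^sub>a x + (1/2) * u\<^sub>b x"
  shows "energy s (\<lambda>x. u\<^sub>a x - u\<^sub>b x) \<le> 4 * (energy s v - energy s m) - 8 * \<kappa> * dual_pairing f (\<lambda>x. v x - m x)"
    and "energy s m \<le> (energy s u\<^sub>a + energy s u\<^sub>b) / 2"
proof -
  have ua: "u\<^sub>a \<in> sobolev_zero s \<Omega>\<^sub>a" and ub: "u\<^sub>b \<in> sobolev_zero s \<Omega>\<^sub>b"
    using a b by (auto simp: weak_solution_def)
  note U = sobolev_zeroD[OF ua] and V = sobolev_zeroD[OF ub]
  have m: "m \<in> sobolev s" unfolding m_def by (rule sobolev_lincomb[OF U V])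
  have "energy s m = energy s (\<lambda>x. (1/2) * (u\<^sub>a x + u\<^sub>b x))"
    unfolding m_def by (simp only: distrib_left)
  also have "\<dots> = energy s (\<lambda>x. u\<^sub>a x + u\<^sub>b x) / 4"
    unfolding energy_scale by (simp add: power2_eq_square)
  finally have Em: "4 * energy s m = 2 * energy s u\<^sub>a + 2 * energy s u\<^sub>b - energy s (\<lambda>x. u\<^sub>a x - u\<^sub>b x)"
    using energy_parallelogram[OF U V] by simp
  then show "energy s m \<le> (energy s u\<^sub>a + energy s u\<^sub>b) / 2"
  proof -
    have "a * 2 \<le> b + c" if "4 * a = 2 * b + 2 * c - d" "0 \<le> d" for a b c d :: real
      using that by linarith
    from this[OF Em zero_le_power2] show ?thesis by simp
  qed
  have "\<kappa> * dual_pairing f m = (\<kappa> * dual_pairing f u\<^sub>a + \<kappa> * dual_pairing f u\<^sub>b) / 2"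
    unfolding m_def using dual_pairing_lincomb[OF f sobolevD(1)[OF U] sobolevD(1)[OF V], of "1/2" "1/2"]
    by (simp add: algebra_simps)
  then have fm: "2 * (\<kappa> * dual_pairing f m) = energy s u\<^sub>a + energy s u\<^sub>b"
    using weak_solution_energy(2)[OF s a ua] weak_solution_energy(2)[OF s b ub] by (simp add: \<kappa>_def)
  have lower: "- e \<le> x" if "x = q - e" "0 \<le> q" for e x q :: real
    using that by linarith
  have va: "- energy s u\<^sub>a \<le> energy s v - 2 * (\<kappa> * dual_pairing f v)"
    unfolding \<kappa>_def mult.assoc[symmetric] by (rule lower[OF weak_solution_energy(1)[OF s a v(1)] zero_le_power2])
  have vb: "- energy s u\<^sub>b \<le> energy s v - 2 * (\<kappa> * dual_pairing f v)"
    unfolding \<kappa>_def mult.assoc[symmetric] by (rule lower[OF weak_solution_energy(1)[OF s b v(2)] zero_le_power2])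
  have vm: "\<kappa> * dual_pairing f (\<lambda>x. v x - m x) = \<kappa> * dual_pairing f v - \<kappa> * dual_pairing f m"
    using dual_pairing_lincomb[OF f sobolevD(1)[OF sobolev_zeroD[OF v(1)]] sobolevD(1)[OF m], of 1 "-1"]
    by (simp add: right_diff_distrib)
  have "e \<le> 4 * (w - p) - 8 * z"
    if "- a \<le> w - 2 * x" "- b \<le> w - 2 * x" "z = x - y" "2 * y = a + b" "4 * p = 2 * a + 2 * b - e"
    for a b e p w x y z :: real
    using that by (smt (verit))
  from this[OF va vb vm fm Em]
  show "energy s (\<lambda>x. u\<^sub>a x - u\<^sub>b x) \<le> 4 * (energy s v - energy s m) - 8 * \<kappa> * dual_pairing f (\<lambda>x. v x - m x)"
    by (simp only: mult.assoc)
qed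

text \<open>Here \<open>B\<close> is the a priori constant of \<open>weak_solution_bound\<close> in a ball of radius \<open>r\<close>. The first summand
  comes from the energy increment of the patchwork, the second one from its mean square distance to
  the mean of the solutions.\<close>

definition stability_constant :: "'a::euclidean_space itself \<Rightarrow> real \<Rightarrow> real \<Rightarrow> real \<Rightarrow> real \<Rightarrow> real \<Rightarrow> real" where
  "stability_constant T s \<tau> r n L = (let \<kappa> = gagliardo_constant T s; B = \<kappa> * sqrt (1 + 4 / \<kappa> * (2 * r) powr (2 * s)) in
     4 * increment_constant T s \<tau> n L * B\<^sup>2 + 8 * \<kappa> * sqrt (n * (4 / \<kappa>)) * B)"

lemma increment_constant_nonneg:
  assumes "0 < s" "s < 1" "0 \<le> n" "0 \<le> L"
  shows "0 \<le> increment_constant TYPE('a::euclidean_space) s \<tau> n L"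
  using gagliardo_symbol_eq(2)[OF assms(1,2), where 'a='a] assms(3,4)
  by (auto simp: increment_constant_def kernel_mass_def intro!: add_nonneg_nonneg mult_nonneg_nonneg)

lemma stability_constant_nonneg:
  assumes "0 < s" "s < 1" "0 \<le> n" "0 \<le> L"
  shows "0 \<le> stability_constant TYPE('a::euclidean_space) s \<tau> r n L"
  using gagliardo_symbol_eq(2)[OF assms(1,2), where 'a='a] assms(3) increment_constant_nonneg[OF assms, where 'a='a]
  by (auto simp: stability_constant_def Let_def intro!: add_nonneg_nonneg mult_nonneg_nonneg)

context translation_patchwork
begin

text \<open>The hypothesis on the patchwork of the mean says that it is admissible on both domains, so that
  \<open>energy_gap\<close> applies to it.\<close>

lemma patchwork_stability:
  fixes u\<^sub>a u\<^sub>b :: "'a \<Rightarrow> real"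
  assumes s: "0 < s" "s < 1" and f: "square_integrable f" and "t \<le> \<tau>"
    and a: "weak_solution s \<Omega>\<^sub>a f u\<^sub>a" and b: "weak_solution s \<Omega>\<^sub>b f u\<^sub>b"
    and D: "\<Omega>\<^sub>a \<subseteq> ball c r" "\<Omega>\<^sub>b \<subseteq> ball c r" "0 < r"
    and vanish: "AE x in lborel. x \<notin> \<Omega>\<^sub>a \<inter> \<Omega>\<^sub>b \<longrightarrow> patchwork (\<lambda>x. (1/2) * u\<^sub>a x + (1/2) * u\<^sub>b x) x = 0"
  shows "energy s (\<lambda>x. u\<^sub>a x - u\<^sub>b x)
    \<le> stability_constant TYPE('a) s \<tau> r (real (card I)) L * t powr s * (l2_norm f * dual_sobolev_norm s f)"
proof -
  let ?n = "real (card I)" and ?F = "dual_sobolev_norm s f" and ?\<eta> = "t powr s"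
  define \<kappa> where "\<kappa> = gagliardo_constant TYPE('a) s"
  define K where "K = increment_constant TYPE('a) s \<tau> ?n L"
  define B where "B = \<kappa> * sqrt (1 + 4 / \<kappa> * (2 * r) powr (2 * s))"
  define m where "m = (\<lambda>x. (1/2) * u\<^sub>a x + (1/2) * u\<^sub>b x)"
  have k0: "0 < \<kappa>" unfolding \<kappa>_def by (rule gagliardo_symbol_eq(2)[OF s])
  have K0: "0 \<le> K" unfolding K_def using L_ge_1 by (intro increment_constant_nonneg s) auto
  have B0: "0 \<le> B" using k0 by (simp add: B_def)
  have F: "0 \<le> ?F" "?F \<le> l2_norm f" by (rule dual_sobolev_norm_bounds[OF f])+
  have m: "m \<in> sobolev s"
    unfolding m_def using a b by (intro sobolev_lincomb sobolev_zeroD) (auto simp: weak_solution_def)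
  have "patchwork m \<in> sobolev s"
    by (rule patchwork_energy(1)[OF s m zero_less_one])
  then have v: "patchwork m \<in> sobolev_zero s \<Omega>\<^sub>a" "patchwork m \<in> sobolev_zero s \<Omega>\<^sub>b"
    using vanish unfolding sobolev_zero_def m_def[symmetric] by (auto elim!: eventually_mono)
  have combine: "E \<le> 4 * X + Y" if "- D \<le> Y" "E \<le> 4 * p - D" "p \<le> X" for E X Y D p :: real
    using that by linarith
  have "gagliardo_seminorm s u\<^sub>a \<le> B * ?F" "gagliardo_seminorm s u\<^sub>b \<le> B * ?F"
    unfolding B_def \<kappa>_def by (rule weak_solution_bound[OF s f a D(1,3)], rule weak_solution_bound[OF s f b D(2,3)])
  then have "energy s u\<^sub>a \<le> (B * ?F)\<^sup>2" "energy s u\<^sub>b \<le> (B * ?F)\<^sup>2"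
    by (auto intro: power_mono)
  then have Em: "energy s m \<le> (B * ?F)\<^sup>2"
    using energy_gap(2)[OF s f a b v] by (simp add: m_def)
  then have gm: "gagliardo_seminorm s m \<le> B * ?F"
    by (rule power2_le_imp_le) (use B0 F in simp)
  have "energy s (patchwork m) - energy s m \<le> K * ?\<eta> * energy s m"
    using patchwork_energy_increment[OF s m \<open>t \<le> \<tau>\<close>] by (simp add: K_def algebra_simps)
  also have "\<dots> \<le> K * ?\<eta> * (B * ?F)\<^sup>2"
    using K0 Em by (intro mult_left_mono) auto
  also have "\<dots> = K * B\<^sup>2 * ?\<eta> * (?F * ?F)" by (simp add: power2_eq_square)
  also have "\<dots> \<le> K * B\<^sup>2 * ?\<eta> * (l2_norm f * ?F)"
    using K0 F by (intro mult_left_mono mult_right_mono) auto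
  finally have 1: "energy s (patchwork m) - energy s m \<le> K * B\<^sup>2 * ?\<eta> * (l2_norm f * ?F)" .
  have "(l2_norm (\<lambda>x. patchwork m x - m x))\<^sup>2 \<le> ?n * (4 / \<kappa>) * t powr (2 * s) * energy s m"
    unfolding \<kappa>_def by (rule patchwork_L2(2)[OF s m])
  also have "\<dots> = (sqrt (?n * (4 / \<kappa>)) * ?\<eta> * gagliardo_seminorm s m)\<^sup>2"
  proof -
    have "(t powr s)\<^sup>2 = t powr (2 * s)" by (simp add: power2_eq_square flip: powr_add)
    moreover have "(sqrt (?n * (4 / \<kappa>)))\<^sup>2 = ?n * (4 / \<kappa>)" using k0 by (intro real_sqrt_pow2) simp
    ultimately show ?thesis by (simp only: power_mult_distrib)
  qed
  finally have "l2_norm (\<lambda>x. patchwork m x - m x) \<le> sqrt (?n * (4 / \<kappa>)) * ?\<eta> * gagliardo_seminorm s m"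
    by (rule power2_le_imp_le) (use k0 in simp)
  also have "\<dots> \<le> sqrt (?n * (4 / \<kappa>)) * ?\<eta> * (B * ?F)"
    using k0 gm by (intro mult_left_mono) auto
  finally have "l2_norm f * l2_norm (\<lambda>x. patchwork m x - m x) \<le> l2_norm f * (sqrt (?n * (4 / \<kappa>)) * ?\<eta> * (B * ?F))"
    by (intro mult_left_mono) auto
  moreover have "- dual_pairing f (\<lambda>x. patchwork m x - m x) \<le> l2_norm f * l2_norm (\<lambda>x. patchwork m x - m x)"
    using dual_pairing_le[OF f patchwork_L2(1)[OF s m]] by linarith
  ultimately have "- dual_pairing f (\<lambda>x. patchwork m x - m x) \<le> l2_norm f * (sqrt (?n * (4 / \<kappa>)) * ?\<eta> * (B * ?F))"
    by simp
  then have "8 * \<kappa> * - dual_pairing f (\<lambda>x. patchwork m x - m x) \<le> 8 * \<kappa> * (l2_norm f * (sqrt (?n * (4 / \<kappa>)) * ?\<eta> * (B * ?F)))"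
    using k0 by (intro mult_left_mono) auto
  then have "- (8 * \<kappa> * dual_pairing f (\<lambda>x. patchwork m x - m x)) \<le> 8 * \<kappa> * (l2_norm f * (sqrt (?n * (4 / \<kappa>)) * ?\<eta> * (B * ?F)))"
    by (simp only: mult_minus_right)
  moreover have "energy s (\<lambda>x. u\<^sub>a x - u\<^sub>b x) \<le> 4 * (energy s (patchwork m) - energy s m) - 8 * \<kappa> * dual_pairing f (\<lambda>x. patchwork m x - m x)"
    using energy_gap(1)[OF s f a b v] by (simp add: m_def \<kappa>_def)
  ultimately have "energy s (\<lambda>x. u\<^sub>a x - u\<^sub>b x) \<le> 4 * (K * B\<^sup>2 * ?\<eta> * (l2_norm f * ?F)) + 8 * \<kappa> * (l2_norm f * (sqrt (?n * (4 / \<kappa>)) * ?\<eta> * (B * ?F)))"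
    by (rule combine[OF _ _ 1])
  also have "\<dots> = (4 * K * B\<^sup>2 + 8 * \<kappa> * sqrt (?n * (4 / \<kappa>)) * B) * ?\<eta> * (l2_norm f * ?F)"
  proof -
    have "4 * (k * b * e * (l * F)) + 8 * c * (l * (S * e * (B * F))) = (4 * k * b + 8 * c * S * B) * e * (l * F)"
      for k b e l F c S B :: real
      by (simp add: algebra_simps)
    then show ?thesis .
  qed
  also have "4 * K * B\<^sup>2 + 8 * \<kappa> * sqrt (?n * (4 / \<kappa>)) * B = stability_constant TYPE('a) s \<tau> r ?n L"
    unfolding stability_constant_def Let_def K_def B_def \<kappa>_def ..
  finally show ?thesis .
qed

end

section \<open>The stability estimate\<close>

theorem theorem2:
  fixes s \<rho> \<theta> d :: real
  assumes "0 < s" and "s < 1" and "0 < \<rho>" and "0 < \<theta>" and "\<theta> < pi / 2"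
  shows "\<exists>C>0. \<forall>(D :: 'a::euclidean_space set) \<Omega>\<^sub>a \<Omega>\<^sub>b f u\<^sub>a u\<^sub>b.
           (\<exists>x0 r. 0 < r \<and> D = ball x0 r) \<and> diameter D = d \<and>
           open \<Omega>\<^sub>a \<and> bounded \<Omega>\<^sub>a \<and> \<Omega>\<^sub>a \<subseteq> D \<and>
           open \<Omega>\<^sub>b \<and> bounded \<Omega>\<^sub>b \<and> \<Omega>\<^sub>b \<subseteq> D \<and>
           lipschitz_cone_condition \<rho> \<theta> \<Omega>\<^sub>a \<and>
           square_integrable f \<and>
           weak_solution s \<Omega>\<^sub>a f u\<^sub>a \<and> weak_solution s \<Omega>\<^sub>b f u\<^sub>b \<and>
           set_deviation \<Omega>\<^sub>b \<Omega>\<^sub>a < ennreal (\<rho> * sin \<theta> / 2)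
           \<longrightarrow>
           gagliardo_seminorm s (\<lambda>x. u\<^sub>a x - u\<^sub>b x)
             \<le> C * l2_norm f powr (1 / 2) * dual_sobolev_norm s f powr (1 / 2)
                 * enn2real (set_deviation \<Omega>\<^sub>b \<Omega>\<^sub>a) powr (s / 2)"
proof -
  note s = assms(1,2) and \<theta> = assms(4,5)
  obtain P :: "'a set" and L :: real and \<phi> :: "'a option \<Rightarrow> 'a \<Rightarrow> real" where
    P: "finite P" "1 \<le> L"
    and \<phi>_nonneg: "\<And>i x. i \<in> insert None (Some ` P) \<Longrightarrow> 0 \<le> \<phi> i x"
    and \<phi>_sum: "\<And>x. (\<Sum>i\<in>insert None (Some ` P). \<phi> i x) = 1"
    and \<phi>_lipschitz: "\<And>i x y. i \<in> insert None (Some ` P) \<Longrightarrow> \<bar>\<phi> i x - \<phi> i y\<bar> \<le> L * norm (x - y)"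
    and \<phi>_support: "\<And>p x. p \<in> P \<Longrightarrow> \<phi> (Some p) x \<noteq> 0 \<Longrightarrow> x \<in> ball p \<rho>"
    and \<phi>_None: "\<And>x. norm x < d / 2 \<Longrightarrow> \<phi> None x = 0"
    by (rule exists_partition_of_unity[OF assms(3)]) blast
  let ?I = "insert None (Some ` P)"
  define Q where "Q = stability_constant TYPE('a) s (\<rho> / 2) (d / 2) (real (card ?I)) L"
  have Q0: "0 \<le> Q" unfolding Q_def using P(2) by (intro stability_constant_nonneg s) auto
  have sin0: "0 < sin \<theta>" using \<theta> by (intro sin_gt_zero) auto
  \<comment> \<open>the summand \<open>1\<close> only ensures positivity\<close>
  define C where "C = sqrt (Q / sin \<theta> powr s) + 1"
  have C: "0 < C" "sqrt (Q / sin \<theta> powr s) \<le> C"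
    unfolding C_def using Q0 by (auto intro: add_nonneg_pos)
  show ?thesis
  proof (rule exI[of _ C], intro conjI C allI impI, elim conjE exE)
    fix D \<Omega>\<^sub>a \<Omega>\<^sub>b :: "'a set" and f u\<^sub>a u\<^sub>b :: "'a \<Rightarrow> real" and x0 :: 'a and r :: real
    assume r: "0 < r" "D = ball x0 r" and d: "diameter D = d"
      and sub: "\<Omega>\<^sub>a \<subseteq> D" "\<Omega>\<^sub>b \<subseteq> D" and cone: "lipschitz_cone_condition \<rho> \<theta> \<Omega>\<^sub>a"
      and f: "square_integrable f" and a: "weak_solution s \<Omega>\<^sub>a f u\<^sub>a" and b: "weak_solution s \<Omega>\<^sub>b f u\<^sub>b"
      and dev: "set_deviation \<Omega>\<^sub>b \<Omega>\<^sub>a < ennreal (\<rho> * sin \<theta> / 2)"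
    have dr: "d / 2 = r" using d r by simp
    define \<delta> where "\<delta> = enn2real (set_deviation \<Omega>\<^sub>b \<Omega>\<^sub>a)"
    have dev\<delta>: "set_deviation \<Omega>\<^sub>b \<Omega>\<^sub>a = ennreal \<delta>" and \<delta>0: "0 \<le> \<delta>"
      using dev by (auto simp: \<delta>_def less_top[symmetric] intro!: ennreal_enn2real[symmetric] elim: order_less_trans)
    have \<delta>: "\<delta> < \<rho> * sin \<theta> / 2" using dev \<delta>0 unfolding dev\<delta> by (simp add: ennreal_less_iff)
    define m where "m = (\<lambda>x. (1/2) * u\<^sub>a x + (1/2) * u\<^sub>b x)"
    let ?E = "energy s (\<lambda>x. u\<^sub>a x - u\<^sub>b x)" and ?F = "l2_norm f * dual_sobolev_norm s f"
    have F0: "0 \<le> ?F" using dual_sobolev_norm_bounds(2)[OF f] by simp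
    have "\<forall>p. \<exists>n. n \<in> cone_directions \<rho> \<theta> (x0 + p) \<Omega>\<^sub>a"
      using cone by (auto simp: lipschitz_cone_condition_def)
    then obtain n where n: "\<And>p. n p \<in> cone_directions \<rho> \<theta> (x0 + p) \<Omega>\<^sub>a" by metis
    \<comment> \<open>every translation length between \<open>\<delta> / sin \<theta>\<close> and \<open>\<rho> / 2\<close> is admissible\<close>
    have scale: "?E \<le> Q * t powr s * ?F" if t: "0 < t" "t < \<rho> / 2" "\<delta> < t * sin \<theta>" for t
    proof -
      define h where "h i = (case i of None \<Rightarrow> 0 | Some p \<Rightarrow> t *\<^sub>R n p)" for i
      define \<psi> where "\<psi> i x = \<phi> i (x - x0)" for i x
      have nn: "norm (n p) = 1" for p using n[of p] by (simp add: cone_directions_def)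
      interpret translation_patchwork ?I \<psi> h L t
      proof
        show "finite ?I" using P by simp
        show "0 \<le> \<psi> i x" if "i \<in> ?I" for i x unfolding \<psi>_def by (rule \<phi>_nonneg[OF that])
        show "(\<Sum>i\<in>?I. \<psi> i x) = 1" for x unfolding \<psi>_def by (rule \<phi>_sum)
        show "\<bar>\<psi> i x - \<psi> i y\<bar> \<le> L * norm (x - y)" if "i \<in> ?I" for i x y
          using \<phi>_lipschitz[OF that, of "x - x0" "y - x0"] by (simp add: \<psi>_def)
        show "1 \<le> L" by (rule P)
        show "norm (h i) \<le> t" for i using t by (auto simp: h_def nn split: option.split)
        show "0 < t" by (rule t)
      qed
      have "u\<^sub>a \<in> sobolev_zero s \<Omega>\<^sub>a" "u\<^sub>b \<in> sobolev_zero s \<Omega>\<^sub>b"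
        using a b by (auto simp: weak_solution_def)
      then have "AE x in lborel. x \<notin> \<Omega>\<^sub>a \<longrightarrow> u\<^sub>a x = 0" "AE x in lborel. x \<notin> \<Omega>\<^sub>b \<longrightarrow> u\<^sub>b x = 0"
        by (auto simp: sobolev_zero_def)
      then have "AE x in lborel. x \<notin> \<Omega>\<^sub>a \<union> \<Omega>\<^sub>b \<longrightarrow> m x = 0"
        by eventually_elim (auto simp: m_def)
      then obtain N where N: "N \<in> null_sets lborel" "\<And>x. x \<notin> N \<Longrightarrow> x \<notin> \<Omega>\<^sub>a \<union> \<Omega>\<^sub>b \<Longrightarrow> m x = 0"
        unfolding eventually_ae_filter by auto
      have "AE x in lborel. \<forall>i\<in>?I. h i + 1 *\<^sub>R x \<notin> N"
      proof (rule AE_finite_allI)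
        fix i assume "i \<in> ?I"
        have [measurable]: "N \<in> sets borel" using N(1) by (auto dest: null_setsD2)
        have "AE x in lborel. x \<notin> N" using N(1) by (rule AE_not_in)
        then show "AE x in lborel. h i + 1 *\<^sub>R x \<notin> N"
          by (intro AE_lborel_affine) auto
      qed (use P in simp)
      then have vanish: "AE x in lborel. x \<notin> \<Omega>\<^sub>a \<inter> \<Omega>\<^sub>b \<longrightarrow> patchwork m x = 0"
      proof eventually_elim
        case (elim x)
        show ?case
        proof
          assume x: "x \<notin> \<Omega>\<^sub>a \<inter> \<Omega>\<^sub>b"
          have "\<psi> i x * m (x + h i) = 0" if i: "i \<in> ?I" for i
          proof (cases "\<psi> i x = 0")
            case False
            have "x + h i \<notin> N" using elim i by (auto simp: add.commute)
            moreover have "x + h i \<notin> \<Omega>\<^sub>a \<union> \<Omega>\<^sub>b"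
            proof (cases i)
              case None
              then have "\<not> norm (x - x0) < d / 2" using False \<phi>_None by (auto simp: \<psi>_def)
              then have "x \<notin> D" unfolding dr using r by (simp add: dist_norm norm_minus_commute)
              then show ?thesis using None sub by (auto simp: h_def)
            next
              case (Some p)
              then have "p \<in> P" using i by auto
              have "x \<in> ball (x0 + p) \<rho>"
                using \<phi>_support[OF \<open>p \<in> P\<close>, of "x - x0"] False Some
                by (simp add: \<psi>_def dist_norm norm_minus_commute algebra_simps)
              then have "x + t *\<^sub>R n p \<notin> \<Omega>\<^sub>a \<union> \<Omega>\<^sub>b"
                using t \<delta>0 dev\<delta> by (intro cone_translation_leaves_union[OF n \<theta> _ _ _ _ x]) (auto simp: ennreal_less_iff)
              then show ?thesis using Some by (simp add: h_def)
            qed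
            ultimately show ?thesis using N(2) by simp
          qed simp
          then show "patchwork m x = 0" unfolding patchwork_def by (rule sum.neutral[rule_format])
        qed
      qed
      show ?thesis
        unfolding Q_def dr
        by (rule patchwork_stability[OF s f _ a b _ _ r(1) vanish[unfolded m_def]]) (use t sub r in auto)
    qed
    define t0 where "t0 = \<delta> / sin \<theta>"
    have t0: "0 \<le> t0" "t0 < \<rho> / 2"
      using \<delta>0 \<delta> sin0 by (auto simp: t0_def field_simps)
    \<comment> \<open>lengths that decrease to the excluded value \<open>\<delta> / sin \<theta>\<close>; this also covers \<open>\<delta> = 0\<close>\<close>
    define w where "w k = t0 + (\<rho> / 2 - t0) * inverse (real (Suc (Suc k)))" for k
    have w: "0 < w k" "w k < \<rho> / 2" "\<delta> < w k * sin \<theta>" for k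
    proof -
      have 1: "0 < (\<rho> / 2 - t0) * inverse (real (Suc (Suc k)))" using t0 by simp
      have "(\<rho> / 2 - t0) * inverse (real (Suc (Suc k))) < (\<rho> / 2 - t0) * 1"
        using t0 by (intro mult_strict_left_mono) (auto simp: field_simps)
      then have 2: "(\<rho> / 2 - t0) * inverse (real (Suc (Suc k))) < \<rho> / 2 - t0" by (simp only: mult_1_right)
      show "0 < w k" unfolding w_def by (rule add_nonneg_pos[OF t0(1) 1])
      show "w k < \<rho> / 2" unfolding w_def using 2 by linarith
      have "t0 < w k" using 1 by (simp add: w_def)
      then show "\<delta> < w k * sin \<theta>" using sin0 by (simp add: t0_def field_simps)
    qed
    have "w \<longlonglongrightarrow> t0 + (\<rho> / 2 - t0) * 0"
      unfolding w_def by (intro tendsto_intros LIMSEQ_Suc[OF LIMSEQ_inverse_real_of_nat])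
    then have "(\<lambda>k. Q * w k powr s * ?F) \<longlonglongrightarrow> Q * t0 powr s * ?F"
      using s w by (intro tendsto_intros) (auto intro!: always_eventually less_imp_le)
    then have "?E \<le> Q * t0 powr s * ?F"
      by (rule LIMSEQ_le_const) (use scale[OF w] in auto)
    also have "\<dots> = (Q / sin \<theta> powr s) * \<delta> powr s * ?F"
      using \<delta>0 sin0 by (simp add: t0_def powr_divide)
    finally have "gagliardo_seminorm s (\<lambda>x. u\<^sub>a x - u\<^sub>b x) \<le> sqrt ((Q / sin \<theta> powr s) * \<delta> powr s * ?F)"
      by (rule real_le_rsqrt)
    also have "\<dots> = sqrt (Q / sin \<theta> powr s) * sqrt (l2_norm f) * sqrt (dual_sobolev_norm s f) * sqrt (\<delta> powr s)"
      by (simp only: real_sqrt_mult mult_ac)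
    also have "\<dots> \<le> C * sqrt (l2_norm f) * sqrt (dual_sobolev_norm s f) * sqrt (\<delta> powr s)"
      using dual_sobolev_norm_bounds(2)[OF f] by (intro mult_right_mono C) auto
    also have "\<dots> = C * l2_norm f powr (1 / 2) * dual_sobolev_norm s f powr (1 / 2) * \<delta> powr (s / 2)"
      using dual_sobolev_norm_bounds(2)[OF f]
      by (simp add: powr_half_sqrt[symmetric] powr_powr)
    finally show "gagliardo_seminorm s (\<lambda>x. u\<^sub>a x - u\<^sub>b x)
             \<le> C * l2_norm f powr (1 / 2) * dual_sobolev_norm s f powr (1 / 2)
                 * enn2real (set_deviation \<Omega>\<^sub>b \<Omega>\<^sub>a) powr (s / 2)"
      unfolding \<delta>_def .
  qed
qed

end
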